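(* Let $(Y_{i\,j})_{i,j\in\mathbb N}$ be independent identically distributed real random variables with $\mathbb E[Y_{1\,1}]=0$ and $\mathbb E[Y_{1\,1}^2]=1$. Fix $l\in\mathbb N$ and assume $\mathbb E[Y_{1\,1}^{2l}]<\infty$. For $p\le n$ let $\mathbf X_{p,n}=(Y_{i\,j})_{i\le p,\,j\le n}\in\mathbb R^{p\times n}$ and $\mathbf S_{p,n}=\frac1n\mathbf X_{p,n}\mathbf X_{p,n}^T$. Then for $p\le n$ \begin{align*} \mathbb E[\operatorname{tr}(\mathbf S_{p,n}^l)]=\sum_{b=1}^{l\wedge p}\Bigg[&\frac{\binom{p}{b}\binom{n-b}{l+1-b}}{n^l}\,l!\binom{l-1}{b-1}\\ &+\frac{\binom{p}{b}\binom{n-b}{l-b}}{n^l}\Bigg\{\frac{b!(l-b)!}{2}\Bigg(\binom{2l}{2b}+(2b-1)\binom{l}{b}^2\Bigg)\\ &\qquad+\big(\mathbb E[Y_{1\,1}^4]-3\big)\,\mathbb 1_{b<l}\,b!(l-b)!\binom{l}{b-1}\binom{l}{b+1}\Bigg\}+\mathcal O\Big(\frac{p^b}{n^{b+1}}\Big)\Bigg]. \end{align*}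
   Context: $a\wedge b=\min(a,b)$. For each $b$, the term $\mathcal O(p^b/n^{b+1})$ denotes a quantity whose absolute value is bounded by $C\,p^b/n^{b+1}$ for a constant $C$ not depending on $p,n$ (uniformly over $p\le n$). *)

theory Defs
  imports "HOL-Probability.Probability" "Jordan_Normal_Form.Matrix"
begin

definition mat_trace :: "'a::comm_monoid_add mat \<Rightarrow> 'a" where
  "mat_trace A = (\<Sum>i<dim_row A. A $$ (i, i))"

text \<open>The data matrix X_{p,n} = (Y i j)_{1<=i<=p, 1<=j<=n} at outcome w
  (Jordan_Normal_Form matrices are 0-indexed, so entry (i,j) is Y (i+1) (j+1)).\<close>
definition Xmat :: "(nat \<Rightarrow> nat \<Rightarrow> 'a \<Rightarrow> real) \<Rightarrow> nat \<Rightarrow> nat \<Rightarrow> 'a \<Rightarrow> real mat" where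
  "Xmat Y p n w = mat p n (\<lambda>(i, j). Y (Suc i) (Suc j) w)"

definition Smat :: "(nat \<Rightarrow> nat \<Rightarrow> 'a \<Rightarrow> real) \<Rightarrow> nat \<Rightarrow> nat \<Rightarrow> 'a \<Rightarrow> real mat" where
  "Smat Y p n w = (1 / real n) \<cdot>\<^sub>m (Xmat Y p n w * transpose_mat (Xmat Y p n w))"

end

theory Submission
  imports Defs
begin

text \<open>
  Expanding the trace, \<open>n ^ l\<close> times the expectation is a sum over closed walks of length \<open>2 l\<close> in
  the complete bipartite graph on \<open>p + n\<close> vertices, where a walk is weighted by the product over its
  edges of the moment whose order is the multiplicity of the edge. Since the mean vanishes, only
  walks using every edge at least twice matter.

  A \<^emph>\<open>leaf\<close> of a walk is an interior position whose vertex is visited only once and whose two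
  neighbours coincide. Deleting the leftmost leaf does not change the weight, and recording
  its position yields a linear recursion of ballot type, whose boundary values are the walks
  without leaves. In a leafless walk of nonzero weight every vertex is visited twice, so it has at most
  \<open>l\<close> vertices: trees, with \<open>l + 1\<close> vertices, give the leading Narayana term. A leafless walk with
  exactly \<open>l\<close> vertices is a path leading to a cycle of length \<open>2 m\<close> that is traversed twice, either twice in the
  same direction or back and forth from one of its vertices. This makes \<open>2 m + 1\<close> patterns, except
  that for \<open>m = 1\<close> there is one pattern, a single edge of multiplicity four. Solving the recursion, each pattern
  contributes \<open>(l choose (b - m)) * (l choose (b + m))\<close>; the sum over \<open>m\<close> is evaluated by
  Vandermonde's identity and by telescoping. All other walks have at most \<open>l - 1\<close> vertices and are absorbed
  in the error term.
\<close>

section \<open>Closed walks and insertion of a leaf\<close>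

text \<open>A walk may have many leaves, and deleting one may create another, so the bijection needs
  a canonical leaf. Inserting a fresh leaf at position a gives its neighbour at position a - 1 a
  second visit; a leaf there disappears. Hence "no leaf before a" after the insertion corresponds to
  "no leaf before a - 1" in the shorter walk, and this shift makes a an argument of the recursion.
  Roots on either side are allowed because a leafless walk that never revisits its root before the
  end becomes, once that root is stripped, a leafless walk rooted on the opposite side.

  The exact counts contain \<open>(n choose c)\<close>, whereas the theorem has
  \<open>((n - b) choose c)\<close>. Vandermonde's identity turns the binomial for c = l + 1 - b
  into its shifted form plus b times the shifted binomial for l - b, up to the admissible error. The
  second-order coefficient thereby gains b times the Narayana coefficient: with B =
  \<open>(l choose b)\<close>, the terms - B^2 / 2 + b (l - b) / l * B^2 and the correction b^2 / l
  * B^2 add up to (2 b - 1) B^2 / 2, the form in the theorem.\<close>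

type_synonym vertex = "bool \<times> nat"

fun edges :: "'a list \<Rightarrow> 'a set list" where
  "edges (x # y # w) = {x, y} # edges (y # w)"
| "edges w = []"

definition edge_weight :: "(nat \<Rightarrow> real) \<Rightarrow> 'a list \<Rightarrow> real" where
  "edge_weight \<mu> w = (\<Prod>e\<in>set (edges w). \<mu> (count_list (edges w) e))"

text \<open>A vertex \<open>(True, i)\<close> is a row index and \<open>(False, j)\<close> a column index, both counted from 0;
  a closed walk lists its root at both ends.\<close>

definition closed_walks :: "(bool \<Rightarrow> nat) \<Rightarrow> bool \<Rightarrow> nat \<Rightarrow> vertex list set" where
  "closed_walks N \<tau> l = {w. length w = 2 * l + 1 \<and> (\<forall>x\<in>set w. snd x < N (fst x)) \<and>
     successively (\<lambda>x y. fst x \<noteq> fst y) w \<and> fst (hd w) = \<tau> \<and> hd w = last w}"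

definition num_of :: "bool \<Rightarrow> vertex list \<Rightarrow> nat" where
  "num_of s w = card {x \<in> set w. fst x = s}"

definition leaf_at :: "nat \<Rightarrow> 'a list \<Rightarrow> bool" where
  "leaf_at k w \<longleftrightarrow> 0 < k \<and> Suc k < length w \<and> w ! (k - 1) = w ! Suc k \<and> count_list w (w ! k) = 1"

text \<open>The threshold \<open>a\<close> interpolates: \<open>a = 0\<close> imposes nothing, and
  since interior positions run from 1 to 2 l - 1, \<open>a = 2 * l\<close> leaves only walks without
  leaves.\<close>

definition late_walks :: "(bool \<Rightarrow> nat) \<Rightarrow> bool \<Rightarrow> nat \<Rightarrow> nat \<Rightarrow> nat \<Rightarrow> nat \<Rightarrow> vertex list set" where
  "late_walks N \<tau> l b c a = {w \<in> closed_walks N \<tau> l. num_of \<tau> w = b \<and> num_of (\<not> \<tau>) w = c \<and>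
     (\<forall>k<a. \<not> leaf_at k w)}"

text \<open>The two slices overlap in position a - 1, so the vertex there ends up on both sides of
  \<open>x\<close>: the walk makes a detour to \<open>x\<close> and back.\<close>

definition leaf_insert :: "nat \<Rightarrow> 'a \<Rightarrow> 'a list \<Rightarrow> 'a list" where
  "leaf_insert a x w = take a w @ x # drop (a - 1) w"

section \<open>Edges and weights under insertion of a leaf\<close>

lemma edges_append: "edges (u @ y # v) = edges (u @ [y]) @ edges (y # v)"
  by (induction u rule: edges.induct) auto

lemma length_edges: "length (edges w) = length w - 1"
  by (induction w rule: edges.induct) auto

lemma nth_edges: "Suc k < length w \<Longrightarrow> edges w ! k = {w ! k, w ! Suc k}"
proof (induction w arbitrary: k rule: edges.induct)
  case (1 x y w)
  then show ?case by (cases k) auto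
qed auto

lemma edges_subset: "e \<in> set (edges w) \<Longrightarrow> e \<subseteq> set w"
  by (induction w rule: edges.induct) auto

text \<open>Shared by the insertion of a leaf and by wrapping a new root around a walk: both
  traverse one fresh edge exactly twice, and its factor \<open>\<mu> 2\<close> is 1.\<close>

lemma edge_weight_new_double_edge:
  assumes "\<mu> 2 = (1::real)" "f \<notin> set (edges w)"
    "\<And>e. count_list (edges w') e = count_list (edges w) e + (if e = f then 2 else 0)"
  shows "edge_weight \<mu> w' = edge_weight \<mu> w"
proof -
  have "e \<in> set (edges w') \<longleftrightarrow> e \<in> insert f (set (edges w))" for e
  proof -
    have "count_list (edges w') e = 0 \<longleftrightarrow> count_list (edges w) e = 0 \<and> e \<noteq> f"
      unfolding assms(3) by simp
    then show ?thesis unfolding count_list_0_iff by blast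
  qed
  then have s: "set (edges w') = insert f (set (edges w))" by blast
  have c: "count_list (edges w') f = 2" using assms(2) unfolding assms(3) by (simp add: count_list_0_iff)
  have "edge_weight \<mu> w' = \<mu> (count_list (edges w') f) * (\<Prod>e\<in>set (edges w). \<mu> (count_list (edges w') e))"
    unfolding edge_weight_def s using assms(2) by (simp add: prod.insert)
  also have "(\<Prod>e\<in>set (edges w). \<mu> (count_list (edges w') e)) = edge_weight \<mu> w"
    unfolding edge_weight_def
  proof (rule prod.cong[OF refl])
    fix e assume "e \<in> set (edges w)"
    then have "e \<noteq> f" using assms(2) by blast
    then show "\<mu> (count_list (edges w') e) = \<mu> (count_list (edges w) e)" unfolding assms(3) by simp
  qed
  finally show ?thesis using assms(1) c by simp
qed

lemma leaf_insert_split: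
  assumes "0 < a" "a \<le> length w"
  obtains u y v where "w = u @ y # v" "length u = a - 1" "y = w ! (a - 1)"
    "leaf_insert a x w = u @ [y, x, y] @ v"
proof -
  obtain a' where a: "a = Suc a'" using assms(1) by (cases a) auto
  have l: "a' < length w" using assms a by simp
  have w: "w = take a' w @ w ! a' # drop (Suc a') w" using l by (rule id_take_nth_drop)
  have "leaf_insert a x w = take a' w @ [w ! a', x, w ! a'] @ drop (Suc a') w"
    using l by (simp add: leaf_insert_def a take_Suc_conv_app_nth Cons_nth_drop_Suc)
  then show ?thesis using that[OF w] l a by simp
qed

lemma edge_weight_leaf_insert:
  assumes "\<mu> 2 = (1::real)" "0 < a" "a \<le> length w" "x \<notin> set w"
  shows "edge_weight \<mu> (leaf_insert a x w) = edge_weight \<mu> w"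
proof -
  obtain u y v where w: "w = u @ y # v" and i: "leaf_insert a x w = u @ [y, x, y] @ v"
    using leaf_insert_split[OF assms(2,3)] by metis
  have e: "edges (leaf_insert a x w) = edges (u @ [y]) @ [{y, x}, {x, y}] @ edges (y # v)"
    unfolding i using edges_append[of u y "x # y # v"] by simp
  have e': "edges w = edges (u @ [y]) @ edges (y # v)"
    unfolding w by (rule edges_append)
  show ?thesis
  proof (rule edge_weight_new_double_edge[where f = "{x, y}"])
    show "{x, y} \<notin> set (edges w)" using edges_subset[of "{x, y}" w] assms(4) by blast
    show "count_list (edges (leaf_insert a x w)) e = count_list (edges w) e + (if e = {x, y} then 2 else 0)" for e
      by (auto simp: e e' insert_commute)
  qed (use assms in auto)
qed

lemma length_leaf_insert: "0 < a \<Longrightarrow> a \<le> length w \<Longrightarrow> length (leaf_insert a x w) = length w + 2"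
  by (auto simp: leaf_insert_def)

lemma set_leaf_insert:
  assumes "0 < a" "a \<le> length w"
  shows "set (leaf_insert a x w) = insert x (set w)"
proof -
  obtain u y v where "w = u @ y # v" "leaf_insert a x w = u @ [y, x, y] @ v"
    using leaf_insert_split[OF assms] by metis
  then show ?thesis by force
qed

lemma leaf_at_leaf_insert:
  assumes "0 < a" "a \<le> length w" "x \<notin> set w"
  shows "leaf_at a (leaf_insert a x w)"
proof -
  obtain u y v where "w = u @ y # v" "length u = a - 1"
    and "leaf_insert a x w = u @ [y, x, y] @ v"
    using leaf_insert_split[OF assms(1,2)] by metis
  with assms show ?thesis
    by (auto simp: leaf_at_def nth_append count_list_0_iff)
qed

lemma count_list_ge_2I:
  assumes "i < j" "j < length w" "w ! i = w ! j"
  shows "2 \<le> count_list w (w ! i)"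
proof -
  have w: "w = take j w @ w ! j # drop (Suc j) w" using assms(2) by (rule id_take_nth_drop)
  have "w ! i \<in> set (take j w)" using assms by (metis length_take in_set_conv_nth min.absorb4 nth_take)
  then have "count_list (take j w) (w ! i) \<noteq> 0" by (simp add: count_list_0_iff)
  then show ?thesis using assms(3) by (subst w) simp
qed

text \<open>The insertion duplicates the vertex at position a - 1, so this position is no leaf
  afterwards, whatever it was before; hence the bound a - 1 on the right. At earlier positions
  nothing changes, since an earlier visit of the duplicated vertex was already one of two.\<close>

lemma no_leaf_before_leaf_insert:
  assumes "0 < a" "a \<le> length w" "x \<notin> set w"
  shows "(\<forall>k<a. \<not> leaf_at k (leaf_insert a x w)) \<longleftrightarrow> (\<forall>k<a-1. \<not> leaf_at k w)"
proof -
  obtain u y v where w: "w = u @ y # v" and u: "length u = a - 1"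
    and i: "leaf_insert a x w = u @ [y, x, y] @ v"
    using leaf_insert_split[OF assms(1,2)] by metis
  let ?i = "leaf_insert a x w"
  have last: "\<not> leaf_at (a - 1) ?i"
  proof
    assume "leaf_at (a - 1) ?i"
    then have "count_list ?i (?i ! (a - 1)) = 1" by (simp add: leaf_at_def)
    moreover have "?i ! (a - 1) = y" unfolding i using u by (simp add: nth_append)
    ultimately show False using assms(3) unfolding i by (simp split: if_splits)
  qed
  have eq: "leaf_at k ?i \<longleftrightarrow> leaf_at k w" if k: "k < a - 1" for k
  proof (cases "w ! k = y")
    case True
    have n: "w ! k = w ! (a - 1)" "?i ! k = ?i ! (a - 1)"
      using True k u unfolding i by (auto simp: w nth_append)
    have "2 \<le> count_list w (w ! k)" "2 \<le> count_list ?i (?i ! k)"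
      using k assms(1,2) n count_list_ge_2I[of k "a - 1" w] count_list_ge_2I[of k "a - 1" ?i]
      by (simp_all add: length_leaf_insert)
    then show ?thesis by (auto simp: leaf_at_def)
  next
    case False
    have n: "?i ! j = w ! j" if "j \<le> Suc k" for j
      using that k u unfolding i by (auto simp: w nth_append)
    have "w ! k \<noteq> x" using assms(2,3) k by (metis diff_le_self dual_order.strict_trans1 nth_mem)
    then have "count_list ?i (w ! k) = count_list w (w ! k)" using False unfolding i by (simp add: w)
    then show ?thesis using n[of k] n[of "k - 1"] n[of "Suc k"] k assms(2)
      by (auto simp: leaf_at_def length_leaf_insert)
  qed
  show ?thesis using eq last assms(1) by (metis Suc_diff_1 less_Suc_eq)
qed

lemma closed_walks_leaf_insert_iff:
  assumes "0 < a" "a \<le> length w" "x \<notin> set w"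
  shows "leaf_insert a x w \<in> closed_walks N \<tau> (Suc l) \<longleftrightarrow>
    w \<in> closed_walks N \<tau> l \<and> snd x < N (fst x) \<and> fst x \<noteq> fst (w ! (a - 1))"
proof -
  obtain u y v where w: "w = u @ y # v" and u: "length u = a - 1"
    and i: "leaf_insert a x w = u @ [y, x, y] @ v" and y: "y = w ! (a - 1)"
    using leaf_insert_split[OF assms(1,2)] by metis
  have "hd (leaf_insert a x w) = hd w" unfolding i by (cases u) (auto simp: w)
  moreover have "last (leaf_insert a x w) = last w" unfolding i by (cases v) (auto simp: w)
  moreover have "successively (\<lambda>x y. fst x \<noteq> fst y) (leaf_insert a x w) \<longleftrightarrow>
     successively (\<lambda>x y. fst x \<noteq> fst y) w \<and> fst x \<noteq> fst y"
    unfolding i by (cases v) (auto simp: w successively_append_iff)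
  ultimately show ?thesis
    unfolding closed_walks_def using y by (auto simp: length_leaf_insert[OF assms(1,2)] set_leaf_insert[OF assms(1,2)])
qed

lemma closed_walks_fst_nth:
  assumes "w \<in> closed_walks N \<tau> l" "k \<le> 2 * l"
  shows "fst (w ! k) = (\<tau> = even k)"
  using assms(2)
proof (induction k)
  case 0
  then show ?case using assms(1) by (auto simp: closed_walks_def hd_conv_nth[symmetric] length_greater_0_conv[symmetric] simp del: length_greater_0_conv)
next
  case (Suc k)
  then have "fst (w ! k) \<noteq> fst (w ! Suc k)"
    using assms(1) by (intro successively_nth[where P = "\<lambda>x y. fst x \<noteq> fst y"]) (auto simp: closed_walks_def)
  then show ?case using Suc by auto
qed

lemma leaf_at_imp_leaf_insert:
  assumes "leaf_at a w"
  obtains w' where "w = leaf_insert a (w ! a) w'" "w ! a \<notin> set w'" "length w = length w' + 2"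
proof -
  obtain a' where a: "a = Suc a'" using assms by (cases a) (auto simp: leaf_at_def)
  have l: "Suc (Suc a') < length w" and e: "w ! a' = w ! Suc (Suc a')"
    and c: "count_list w (w ! a) = 1" using assms by (auto simp: leaf_at_def a)
  have w: "w = take (Suc a') w @ w ! a # drop (Suc (Suc a')) w"
    using l a by (metis Suc_lessD id_take_nth_drop)
  define w' where "w' = take a' w @ drop (Suc (Suc a')) w"
  have "count_list w (w ! a) = count_list (take (Suc a') w) (w ! a) + 1 + count_list (drop (Suc (Suc a')) w) (w ! a)"
    by (subst (1) w) simp
  then have "w ! a \<notin> set (take (Suc a') w)" "w ! a \<notin> set (drop (Suc (Suc a')) w)"
    using c by (auto simp flip: count_list_0_iff)
  then have n: "w ! a \<notin> set w'"
    using set_take_subset_set_take[of a' "Suc a'" w] by (auto simp: w'_def)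
  obtain r where d: "drop (Suc (Suc a')) w = w ! a' # r"
    using l e by (metis Cons_nth_drop_Suc)
  have "take (Suc a') w = take a' w @ [w ! a']"
    using l by (simp add: take_Suc_conv_app_nth)
  then have "leaf_insert a (w ! a) w' = take (Suc a') w @ w ! a # drop (Suc (Suc a')) w"
    using l unfolding leaf_insert_def w'_def a d by simp
  then have "w = leaf_insert a (w ! a) w'" using w by simp
  moreover have "length w = length w' + 2" using l by (simp add: w'_def)
  ultimately show ?thesis using that n by blast
qed

lemma num_of_leaf_insert:
  assumes "0 < a" "a \<le> length w" "x \<notin> set w"
  shows "num_of s (leaf_insert a x w) = num_of s w + (if fst x = s then 1 else 0)"
proof -
  have "{z \<in> insert x (set w). fst z = s} =
    (if fst x = s then insert x {z \<in> set w. fst z = s} else {z \<in> set w. fst z = s})" by auto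
  then show ?thesis using assms(3) by (simp add: num_of_def set_leaf_insert[OF assms(1,2)])
qed

lemma card_fresh:
  assumes "\<forall>x\<in>set w. snd x < N (fst x)"
  shows "card {x. fst x = s \<and> snd x < N s \<and> x \<notin> set w} = N s - num_of s w" "num_of s w \<le> N s"
proof -
  have e: "{x. fst x = s \<and> snd x < N s} = Pair s ` {..<N s}" by force
  have A: "finite {x. fst x = s \<and> snd x < N s}" "card {x. fst x = s \<and> snd x < N s} = N s"
    unfolding e by (auto simp: card_image inj_on_def)
  have S: "{x \<in> set w. fst x = s} \<subseteq> {x. fst x = s \<and> snd x < N s}" using assms by auto
  have "{x. fst x = s \<and> snd x < N s \<and> x \<notin> set w} = {x. fst x = s \<and> snd x < N s} - {x \<in> set w. fst x = s}"
    by auto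
  then show "card {x. fst x = s \<and> snd x < N s \<and> x \<notin> set w} = N s - num_of s w"
    using A card_Diff_subset[OF _ S] by (simp add: num_of_def)
  show "num_of s w \<le> N s" using card_mono[OF A(1) S] A(2) by (simp add: num_of_def)
qed

section \<open>The recursion on the position of the leftmost leaf\<close>

lemma finite_closed_walks: "finite (closed_walks N \<tau> l)"
proof -
  have "closed_walks N \<tau> l \<subseteq> {w. set w \<subseteq> (SIGMA s:UNIV. {..<N s}) \<and> length w = 2 * l + 1}"
    by (auto simp: closed_walks_def)
  then show ?thesis by (rule finite_subset) (auto intro!: finite_lists_length_eq finite_SigmaI)
qed

lemma finite_late_walks: "finite (late_walks N \<tau> l b c a)"
  using finite_closed_walks[of N \<tau> l] by (auto simp: late_walks_def)

definition late_sum :: "(nat \<Rightarrow> real) \<Rightarrow> (bool \<Rightarrow> nat) \<Rightarrow> bool \<Rightarrow> nat \<Rightarrow> nat \<Rightarrow> nat \<Rightarrow> nat \<Rightarrow> real" where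
  "late_sum \<mu> N \<tau> l b c a = (\<Sum>w\<in>late_walks N \<tau> l b c a. edge_weight \<mu> w)"

text \<open>Walks whose leftmost leaf sits exactly at \<open>a\<close> correspond to pairs of a
  shorter walk and a fresh vertex of the same weight. The parity of \<open>a\<close> fixes the side
  of the fresh vertex, and the labels still available there give the factor. The bound 2 l + 1 is
  the last interior position of the longer walk.\<close>

lemma late_sum_leaf:
  assumes "\<mu> 2 = 1" "1 \<le> a" "a \<le> 2 * l + 1"
    and "b' = (if even a then Suc b else b)" "c' = (if even a then c else Suc c)"
  shows "late_sum \<mu> N \<tau> (Suc l) b' c' a = late_sum \<mu> N \<tau> (Suc l) b' c' (Suc a)
    + (if even a then real (N \<tau>) - real b else real (N (\<not> \<tau>)) - real c) * late_sum \<mu> N \<tau> l b c (a - 1)"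
proof -
  define s where "s = (\<tau> = even a)"
  define T where "T = (SIGMA w:late_walks N \<tau> l b c (a - 1). {x. fst x = s \<and> snd x < N s \<and> x \<notin> set w})"
  define L where "L = {w \<in> late_walks N \<tau> (Suc l) b' c' a. leaf_at a w}"
  have "late_walks N \<tau> (Suc l) b' c' a = late_walks N \<tau> (Suc l) b' c' (Suc a) \<union> L"
    by (auto simp: late_walks_def L_def less_Suc_eq)
  moreover have "late_walks N \<tau> (Suc l) b' c' (Suc a) \<inter> L = {}"
    by (auto simp: late_walks_def L_def)
  ultimately have split: "late_sum \<mu> N \<tau> (Suc l) b' c' a =
      late_sum \<mu> N \<tau> (Suc l) b' c' (Suc a) + sum (edge_weight \<mu>) L"
    unfolding late_sum_def using finite_late_walks[of N \<tau> "Suc l" b' c']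
    by (metis finite_Un sum.union_disjoint)
  have tyw: "fst (w ! (a - 1)) \<noteq> s" if "w \<in> closed_walks N \<tau> l" for w
    using closed_walks_fst_nth[OF that, of "a - 1"] assms(2,3) by (auto simp: s_def)
  have len: "length w = 2 * l + 1" if "w \<in> closed_walks N \<tau> l" for w
    using that by (simp add: closed_walks_def)
  have img: "(\<lambda>(w, x). leaf_insert a x w) ` T = L"
  proof (intro Set.set_eqI iffI)
    fix w assume "w \<in> (\<lambda>(w, x). leaf_insert a x w) ` T"
    then obtain v x where v: "v \<in> late_walks N \<tau> l b c (a - 1)" and x: "fst x = s" "snd x < N s" "x \<notin> set v"
      and w: "w = leaf_insert a x v" by (auto simp: T_def)
    have vc: "v \<in> closed_walks N \<tau> l" using v by (simp add: late_walks_def)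
    have a: "0 < a" "a \<le> length v" using assms len[OF vc] by auto
    have "num_of \<tau> w = b'" "num_of (\<not> \<tau>) w = c'"
      using v x assms(4,5) num_of_leaf_insert[OF a x(3)] by (auto simp: w late_walks_def s_def)
    moreover have "w \<in> closed_walks N \<tau> (Suc l)"
      unfolding w closed_walks_leaf_insert_iff[OF a x(3)] using vc x tyw[OF vc] by auto
    moreover have "\<forall>k<a. \<not> leaf_at k w"
      unfolding w no_leaf_before_leaf_insert[OF a x(3)] using v by (simp add: late_walks_def)
    ultimately show "w \<in> L" using leaf_at_leaf_insert[OF a x(3)] by (simp add: L_def late_walks_def w)
  next
    fix w assume "w \<in> L"
    then have w: "w \<in> closed_walks N \<tau> (Suc l)" "num_of \<tau> w = b'" "num_of (\<not> \<tau>) w = c'"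
      "\<forall>k<a. \<not> leaf_at k w" "leaf_at a w" by (auto simp: L_def late_walks_def)
    obtain v where v: "w = leaf_insert a (w ! a) v" "w ! a \<notin> set v" "length w = length v + 2"
      using leaf_at_imp_leaf_insert[OF w(5)] .
    define x where "x = w ! a"
    have wi: "w = leaf_insert a x v" and x: "x \<notin> set v" using v x_def by auto
    have a: "0 < a" "a \<le> length v" using assms v(3) w(1) by (auto simp: closed_walks_def)
    have vx: "v \<in> closed_walks N \<tau> l" "snd x < N (fst x)"
      using w(1) unfolding wi closed_walks_leaf_insert_iff[OF a x] by auto
    have fx: "fst x = s" unfolding x_def s_def using closed_walks_fst_nth[OF w(1), of a] assms(3) by simp
    have "num_of \<tau> v = b" "num_of (\<not> \<tau>) v = c"
      using w(2,3) assms(4,5) fx unfolding wi num_of_leaf_insert[OF a x] by (auto simp: s_def split: if_splits)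
    moreover have "\<forall>k<a-1. \<not> leaf_at k v" using w(4) unfolding wi no_leaf_before_leaf_insert[OF a x] .
    ultimately have "(v, x) \<in> T" using vx fx x by (simp add: T_def late_walks_def)
    then show "w \<in> (\<lambda>(w, x). leaf_insert a x w) ` T" using wi by force
  qed
  have inj: "inj_on (\<lambda>(w, x). leaf_insert a x w) T"
  proof (rule inj_onI, clarify)
    fix w x v y assume "(w, x) \<in> T" "(v, y) \<in> T" and e: "leaf_insert a x w = leaf_insert a y v"
    then have "length w = 2 * l + 1" "length v = 2 * l + 1" by (auto simp: T_def late_walks_def len)
    then have "take a w = take a v \<and> x = y \<and> drop (a - 1) w = drop (a - 1) v"
      using e by (simp add: leaf_insert_def)
    moreover from this have "drop a w = drop a v" using assms(2)
      by (metis drop_drop le_add_diff_inverse2 add.commute)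
    ultimately show "w = v \<and> x = y" by (metis append_take_drop_id)
  qed
  have "sum (edge_weight \<mu>) L = (\<Sum>(w, x)\<in>T. edge_weight \<mu> (leaf_insert a x w))"
    unfolding img[symmetric] sum.reindex[OF inj] by (simp add: case_prod_unfold comp_def)
  also have "\<dots> = (\<Sum>(w, x)\<in>T. edge_weight \<mu> w)"
    using assms by (intro sum.cong) (auto simp: T_def late_walks_def len intro!: edge_weight_leaf_insert)
  also have "\<dots> = (\<Sum>w\<in>late_walks N \<tau> l b c (a - 1). \<Sum>x\<in>{x. fst x = s \<and> snd x < N s \<and> x \<notin> set w}. edge_weight \<mu> w)"
    unfolding T_def
  proof (rule sum.Sigma[symmetric])
    have "finite {x::vertex. fst x = s \<and> snd x < N s}"
      by (rule finite_subset[of _ "{s} \<times> {..<N s}"]) auto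
    then show "\<forall>w\<in>late_walks N \<tau> l b c (a - 1). finite {x. fst x = s \<and> snd x < N s \<and> x \<notin> set w}"
      by (auto elim: rev_finite_subset)
  qed (rule finite_late_walks)
  also have "\<dots> = (\<Sum>w\<in>late_walks N \<tau> l b c (a - 1).
      (if even a then real (N \<tau>) - real b else real (N (\<not> \<tau>)) - real c) * edge_weight \<mu> w)"
  proof (rule sum.cong[OF refl])
    fix w assume w: "w \<in> late_walks N \<tau> l b c (a - 1)"
    then have "\<forall>x\<in>set w. snd x < N (fst x)" by (simp add: late_walks_def closed_walks_def)
    note f = card_fresh[OF this, of s]
    have "num_of s w = (if even a then b else c)" using w by (auto simp: late_walks_def s_def)
    then show "(\<Sum>x\<in>{x. fst x = s \<and> snd x < N s \<and> x \<notin> set w}. edge_weight \<mu> w) =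
      (if even a then real (N \<tau>) - real b else real (N (\<not> \<tau>)) - real c) * edge_weight \<mu> w"
      using f by (auto simp: s_def of_nat_diff)
  qed
  finally have "sum (edge_weight \<mu>) L = (if even a then real (N \<tau>) - real b else real (N (\<not> \<tau>)) - real c) *
      late_sum \<mu> N \<tau> l b c (a - 1)" by (simp only: late_sum_def sum_distrib_left)
  then show ?thesis using split by simp
qed

section \<open>Solution of the leaf recursion\<close>

text \<open>Integer lower index, because truncated subtraction on \<^typ>\<open>nat\<close> would turn a negative lower index into 0.\<close>

definition ibinom :: "nat \<Rightarrow> int \<Rightarrow> real" where
  "ibinom n k = (if k < 0 then 0 else real (n choose nat k))"

lemma ibinom_Suc: "ibinom (Suc n) k = ibinom n k + ibinom n (k - 1)"
proof (cases "k \<le> 0")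
  case True
  then show ?thesis by (cases "k = 0") (auto simp: ibinom_def)
next
  case False
  then obtain j where "k = int (Suc j)" by (metis gr0_implies_Suc not_le zero_less_imp_eq_int)
  then show ?thesis by (simp add: ibinom_def nat_add_distrib)
qed

lemma ibinom_0: "ibinom 0 k = (if k = 0 then 1 else 0)"
  by (auto simp: ibinom_def binomial_eq_0_iff)

lemma ibinom_eq_0: "k < 0 \<or> int n < k \<Longrightarrow> ibinom n k = 0"
  by (auto simp: ibinom_def intro!: binomial_eq_0)

lemma ibinom_of_nat: "ibinom n (int k) = real (n choose k)"
  by (simp add: ibinom_def)

definition diag_sum :: "nat \<Rightarrow> int \<Rightarrow> int \<Rightarrow> nat \<Rightarrow> real" where
  "diag_sum L x y t = (\<Sum>i<t. ibinom L (x - int i) * ibinom L (y + 1 - int t + int i))"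

text \<open>With h(t) = (\<alpha>^t - \<beta>^t) / (\<alpha> - \<beta>) this is q * h(t + 1)
  expanded by q = 1 + \<alpha> * \<beta> + (\<alpha> + \<beta>) and (\<alpha> + \<beta>) * h(t + 1)
  = h(t + 2) + \<alpha> * \<beta> * h(t). On coefficients, Pascal's rule in both factors yields four
  sums, and the two mixed ones are regrouped from ranges of length t + 1 into ranges of length t + 2
  and t.\<close>

lemma diag_sum_Suc:
  "diag_sum (Suc L) x y (Suc t) = diag_sum L x y (Suc (Suc t)) + diag_sum L (x - 1) (y - 1) (Suc t)
     + diag_sum L x y (Suc t) + diag_sum L (x - 1) (y - 1) t"
proof -
  let ?B = "ibinom L"
  define f where "f i = ?B (x - int i) * ?B (y - 1 - int t + int i)" for i
  have "diag_sum (Suc L) x y (Suc t) = (\<Sum>i<Suc t. ?B (x - int i) * ?B (y - int t + int i))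
      + (\<Sum>i<Suc t. ?B (x - 1 - int i) * ?B (y - 1 - int t + int i))
      + (\<Sum>i<Suc t. f i + f (Suc i))"
    unfolding diag_sum_def sum.distrib[symmetric] f_def
    by (intro sum.cong) (auto simp: ibinom_Suc algebra_simps)
  also have "(\<Sum>i<Suc t. ?B (x - int i) * ?B (y - int t + int i)) = diag_sum L x y (Suc t)"
    unfolding diag_sum_def by (intro sum.cong) (auto simp: algebra_simps)
  also have "(\<Sum>i<Suc t. ?B (x - 1 - int i) * ?B (y - 1 - int t + int i)) = diag_sum L (x - 1) (y - 1) (Suc t)"
    unfolding diag_sum_def by (intro sum.cong) (auto simp: algebra_simps)
  also have "(\<Sum>i<Suc t. f i + f (Suc i)) = (\<Sum>i<Suc (Suc t). f i) + (\<Sum>i<t. f (Suc i))"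
  proof -
    have "(\<Sum>i<Suc t. f (Suc i)) = (\<Sum>i<t. f (Suc i)) + f (Suc t)" by simp
    then show ?thesis by (simp add: sum.distrib)
  qed
  also have "(\<Sum>i<Suc (Suc t). f i) = diag_sum L x y (Suc (Suc t))"
    unfolding diag_sum_def f_def by (intro sum.cong) (auto simp: algebra_simps)
  also have "(\<Sum>i<t. f (Suc i)) = diag_sum L (x - 1) (y - 1) t"
    unfolding diag_sum_def f_def by (intro sum.cong) (auto simp: algebra_simps)
  finally show ?thesis by simp
qed

lemma diag_sum_0:
  "diag_sum 0 x y t = (if 0 \<le> x \<and> x < int t \<and> x + y + 1 = int t then 1 else 0)"
proof -
  have "diag_sum 0 x y t = (\<Sum>i<t. if int i = x \<and> x + y + 1 = int t then 1 else 0)"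
    unfolding diag_sum_def by (intro sum.cong) (auto simp: ibinom_0)
  also have "\<dots> = (\<Sum>i\<in>{i\<in>{..<t}. int i = x \<and> x + y + 1 = int t}. 1)"
    by (subst sum.inter_filter) auto
  also have "{i\<in>{..<t}. int i = x \<and> x + y + 1 = int t} =
    (if 0 \<le> x \<and> x < int t \<and> x + y + 1 = int t then {nat x} else {})" by auto
  finally show ?thesis by simp
qed

text \<open>With \<open>q = (1 + \<alpha>) (1 + \<beta>)\<close>, the leaf recursion on coefficients of \<open>\<alpha>\<^sup>x \<beta>\<^sup>y q\<^sup>l\<close> has characteristic
  roots \<open>\<alpha> / q\<close> and \<open>\<beta> / q\<close>; \<open>diag_sum\<close> is a coefficient of \<open>(\<alpha>\<^sup>t - \<beta>\<^sup>t) / (\<alpha> - \<beta>) q\<^sup>L\<close>.\<close>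

definition ballot :: "nat \<Rightarrow> int \<Rightarrow> int \<Rightarrow> nat \<Rightarrow> real" where
  "ballot l x y a = diag_sum (l - a div 2) x y (Suc (a div 2))
     + (if even a then diag_sum (l - a div 2) (x - 1) (y - 1) (a div 2) else 0)"

text \<open>Immediate from the definition: the extra summand of \<open>ballot\<close> at even
  arguments is the last term here.\<close>

lemma ballot_even:
  assumes "even a" "1 \<le> a" "a < 2 * Suc l + 1"
  shows "ballot (Suc l) x y a = ballot (Suc l) x y (Suc a) + ballot l (x - 1) (y - 1) (a - 1)"
proof -
  obtain t where a: "a = 2 * Suc t" using assms by (metis One_nat_def dvdE mult_0_right not_less_eq_eq old.nat.exhaust order_refl)
  have "(a - 1) div 2 = t" "odd (a - 1)" "a div 2 = Suc t" "Suc a div 2 = Suc t" using a by auto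
  then show ?thesis using assms by (simp add: ballot_def)
qed

text \<open>The four terms of \<open>diag_sum_Suc\<close> are the two summands of each of the
  even-argument values on the right.\<close>

lemma ballot_odd:
  assumes "odd a" "a < 2 * Suc l"
  shows "ballot (Suc l) x y a = ballot (Suc l) x y (Suc a) + ballot l x y (a - 1)"
proof -
  obtain t where a: "a = 2 * t + 1" using assms by (metis oddE)
  have L: "Suc l - t = Suc (l - t)" using assms a by simp
  have "(a - 1) div 2 = t" "even (a - 1)" "a div 2 = t" "Suc a div 2 = Suc t" using a by auto
  then show ?thesis using assms unfolding ballot_def by (simp add: L diag_sum_Suc)
qed

lemma ballot_eq_0:
  assumes "x < 0 \<or> int l < y" "a div 2 \<le> l"
  shows "ballot l x y a = 0"
proof -
  have z: "ibinom (l - a div 2) (x - int i) * ibinom (l - a div 2) (y + 1 - int (Suc (a div 2)) + int i) = 0"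
    "ibinom (l - a div 2) (x - 1 - int i) * ibinom (l - a div 2) (y - 1 + 1 - int (a div 2) + int i) = 0" for i
    using assms by (auto simp: of_nat_diff intro!: ibinom_eq_0)
  show ?thesis unfolding ballot_def diag_sum_def by (simp only: z sum.neutral_const add_0 if_cancel)
qed

lemma ballot_start: "ballot l x y (Suc 0) = ibinom l x * ibinom l y"
  by (simp add: ballot_def diag_sum_def)

lemma ballot_0: "ballot l x y 0 = ballot l x y 1"
  by (simp add: ballot_def diag_sum_def)

text \<open>At \<open>a = 2 * l\<close> the power of q is gone, so each coefficient is 0 or 1. The
  two summands of \<open>ballot\<close> are homogeneous of degrees l and l + 1, so 2 b picks one of
  them according to the parity of l. The resulting indicator is the one found for leafless walks in
  \<open>sum_core_walks\<close>.\<close>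

lemma ballot_top:
  assumes "1 \<le> m"
  shows "ballot l (int b - int m) (int b + int m) (2 * l) = (if b = (l + 1) div 2 \<and> m \<le> l div 2 then 1 else 0)"
  using assms unfolding ballot_def by (auto simp: diag_sum_0)

text \<open>Both coefficients belong to the same homogeneous polynomial, all of whose coefficients
  are 1, so they cancel unless the exponent b - 2 is negative while b - 1 is not.\<close>

lemma ballot_diff_top:
  "ballot l (int b - 1) (int b - 1) (2 * l + 1) - ballot l (int b - 2) (int b) (2 * l + 1)
     = (if l = 0 \<and> b = 1 then 1 else 0)"
  unfolding ballot_def by (auto simp: diag_sum_0)

text \<open>Serves both orders, which satisfy the same recursion with different boundaries
  \<open>top\<close> and different column counts. The outer induction is on l; inside it,
  \<open>a\<close> descends from the boundary, since each step expresses the value at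
  \<open>a\<close> by the one at a + 1 and a value for the previous l. The bound \<open>M\<close>
  allows solutions that match the boundary only for bounded l.\<close>

lemma leaf_recursion_unique:
  fixes F G :: "nat \<Rightarrow> nat \<Rightarrow> nat \<Rightarrow> real" and top :: "nat \<Rightarrow> nat"
  assumes "\<And>l. top (Suc l) \<le> top l + 2" "\<And>l. 1 \<le> top (Suc l)"
    and "\<And>b a. a \<le> top 0 \<Longrightarrow> F 0 b a = G 0 b a"
    and "\<And>l b. l < M \<Longrightarrow> F (Suc l) b (top (Suc l)) = G (Suc l) b (top (Suc l))"
    and "\<And>l b. F (Suc l) b 0 = F (Suc l) b 1" "\<And>l b. G (Suc l) b 0 = G (Suc l) b 1"
    and "\<And>l a. a \<le> top (Suc l) \<Longrightarrow> F (Suc l) 0 a = G (Suc l) 0 a"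
    and "\<And>l b a. even a \<Longrightarrow> 1 \<le> a \<Longrightarrow> a < top (Suc l) \<Longrightarrow>
      F (Suc l) (Suc b) a = F (Suc l) (Suc b) (Suc a) + \<alpha> b * F l b (a - 1)"
    and "\<And>l b a. even a \<Longrightarrow> 1 \<le> a \<Longrightarrow> a < top (Suc l) \<Longrightarrow>
      G (Suc l) (Suc b) a = G (Suc l) (Suc b) (Suc a) + \<alpha> b * G l b (a - 1)"
    and "\<And>l b a. odd a \<Longrightarrow> a < top (Suc l) \<Longrightarrow> b \<le> d l \<Longrightarrow>
      F (Suc l) b a = F (Suc l) b (Suc a) + \<beta> l b * F l b (a - 1)"
    and "\<And>l b a. odd a \<Longrightarrow> a < top (Suc l) \<Longrightarrow> b \<le> d l \<Longrightarrow>
      G (Suc l) b a = G (Suc l) b (Suc a) + \<beta> l b * G l b (a - 1)"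
    and "\<And>l b a. a \<le> top (Suc l) \<Longrightarrow> d l < b \<Longrightarrow> F (Suc l) b a = G (Suc l) b a"
    and "l \<le> M" "a \<le> top l"
  shows "F l b a = G l b a"
  using assms(13,14)
proof (induction l arbitrary: a b)
  case 0
  then show ?case using assms(3) by simp
next
  case (Suc l)
  have pos: "F (Suc l) b a = G (Suc l) b a" if "1 \<le> a" "a \<le> top (Suc l)" for a
    using that(2,1)
  proof (induction rule: inc_induct)
    case base
    then show ?case using assms(4) Suc.prems(1) by simp
  next
    case (step a)
    have IH: "F l b' (a - 1) = G l b' (a - 1)" for b'
      using step.hyps assms(1)[of l] Suc.prems by (intro Suc.IH) auto
    consider "d l < b" | "odd a" "b \<le> d l" | "even a" "b = 0" | b' where "even a" "b = Suc b'"
      by (metis not_le_imp_less old.nat.exhaust)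
    then show ?case
    proof cases
      case 1
      then show ?thesis using assms(12) step.hyps by simp
    next
      case 2
      then show ?thesis using assms(10,11) step IH by simp
    next
      case 3
      then show ?thesis using assms(7) step.hyps by simp
    next
      case 4
      then show ?thesis using assms(8,9) step IH by simp
    qed
  qed
  show ?case
  proof (cases "a = 0")
    case True
    then show ?thesis using pos[of 1] assms(2,5,6) by simp
  next
    case False
    then show ?thesis using pos Suc.prems by simp
  qed
qed

section \<open>Walks without leaves\<close>

definition doubled :: "'a list \<Rightarrow> bool" where
  "doubled w \<longleftrightarrow> (\<forall>e\<in>set (edges w). count_list (edges w) e \<noteq> 1)"

definition core_walks :: "(bool \<Rightarrow> nat) \<Rightarrow> bool \<Rightarrow> nat \<Rightarrow> nat \<Rightarrow> nat \<Rightarrow> vertex list set" where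
  "core_walks N \<tau> l b c = {w \<in> closed_walks N \<tau> l. num_of \<tau> w = b \<and> num_of (\<not> \<tau>) w = c \<and>
     doubled w \<and> (\<forall>x\<in>set w. 2 \<le> count_list w x)}"

lemma doubled_if_edge_weight_nonzero:
  assumes "\<mu> 1 = 0" "edge_weight \<mu> w \<noteq> 0"
  shows "doubled w"
  using assms by (auto simp: doubled_def edge_weight_def)

text \<open>If a vertex is visited only once and is no leaf, its two neighbours differ, so the edge
  leading to it is used only once.\<close>

lemma doubled_no_leaf_count:
  assumes "doubled w" "0 < k" "Suc k < length w" "\<not> leaf_at k w"
  shows "2 \<le> count_list w (w ! k)"
proof (rule ccontr)
  assume c: "\<not> 2 \<le> count_list w (w ! k)"
  have "w ! k \<in> set w" using assms by simp
  then have "count_list w (w ! k) \<noteq> 0" by (simp add: count_list_0_iff)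
  with c have c1: "count_list w (w ! k) = 1" by simp
  then have ne: "w ! (k - 1) \<noteq> w ! Suc k" using assms by (simp add: leaf_at_def)
  define x y z where "x = w ! k" "y = w ! (k - 1)" "z = w ! Suc k"
  obtain u v where w: "w = u @ [y, x, z] @ v"
  proof
    have "w = take (k - 1) w @ w ! (k - 1) # drop k w"
      using assms id_take_nth_drop[of "k - 1" w] by simp
    also have "drop k w = w ! k # w ! Suc k # drop (Suc (Suc k)) w"
      using assms by (simp add: Cons_nth_drop_Suc)
    finally show "w = take (k - 1) w @ [y, x, z] @ drop (Suc (Suc k)) w" by (simp add: x_y_z_def)
  qed
  have "count_list w x = 1" using c1 by (simp add: x_y_z_def)
  then have nin: "x \<notin> set (u @ [y])" "x \<notin> set (z # v)"
    unfolding w by (auto simp flip: count_list_0_iff split: if_splits)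
  have e: "edges w = edges (u @ [y]) @ [{y, x}, {x, z}] @ edges (z # v)"
    unfolding w using edges_append[of u y "x # z # v"] by simp
  have "{y, x} \<notin> set (edges (u @ [y]))" "{y, x} \<notin> set (edges (z # v))"
    using nin edges_subset by blast+
  then have "count_list (edges w) {y, x} = 1"
    using ne nin unfolding e by (auto simp: count_list_0_iff doubleton_eq_iff x_y_z_def)
  moreover have "{y, x} \<in> set (edges w)" unfolding e by simp
  ultimately show False using assms(1) by (auto simp: doubled_def)
qed

lemma num_of_add: "num_of \<tau> w + num_of (\<not> \<tau>) w = card (set w)"
proof -
  have "set w = {x \<in> set w. fst x = \<tau>} \<union> {x \<in> set w. fst x = (\<not> \<tau>)}" by auto
  moreover have "card \<dots> = num_of \<tau> w + num_of (\<not> \<tau>) w"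
    unfolding num_of_def by (intro card_Un_disjoint) auto
  ultimately show ?thesis by simp
qed

lemma core_walks_small: "w \<in> core_walks N \<tau> l b c \<Longrightarrow> b + c \<le> l"
proof -
  assume w: "w \<in> core_walks N \<tau> l b c"
  then have "2 * card (set w) \<le> (\<Sum>x\<in>set w. count_list w x)"
    using sum_bounded_below[of "set w" 2 "count_list w"] by (simp add: core_walks_def mult.commute)
  also have "\<dots> = 2 * l + 1" using w sum_count_set[of w "set w"] by (simp add: core_walks_def closed_walks_def)
  also have "card (set w) = b + c" using w num_of_add[of \<tau> w] by (auto simp: core_walks_def)
  finally show ?thesis by simp
qed

text \<open>Inside the walk a nonzero weight without leaves forces every vertex to be visited twice,
  by \<open>doubled_no_leaf_count\<close>; the root is listed at both ends, which are distinct
  positions as \<open>1 \<le> l\<close>.\<close>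

lemma late_sum_core:
  assumes "\<mu> 1 = 0" "1 \<le> l"
  shows "late_sum \<mu> N \<tau> l b c (2 * l) = (\<Sum>w\<in>core_walks N \<tau> l b c. edge_weight \<mu> w)"
  unfolding late_sum_def
proof (rule sum.mono_neutral_right)
  show "core_walks N \<tau> l b c \<subseteq> late_walks N \<tau> l b c (2 * l)"
  proof
    fix w assume w: "w \<in> core_walks N \<tau> l b c"
    have "\<not> leaf_at k w" for k
    proof
      assume k: "leaf_at k w"
      then have "w ! k \<in> set w" by (simp add: leaf_at_def)
      then have "2 \<le> count_list w (w ! k)" using w by (simp add: core_walks_def)
      then show False using k by (simp add: leaf_at_def)
    qed
    then show "w \<in> late_walks N \<tau> l b c (2 * l)" using w by (simp add: core_walks_def late_walks_def)
  qed
  show "\<forall>w\<in>late_walks N \<tau> l b c (2 * l) - core_walks N \<tau> l b c. edge_weight \<mu> w = 0"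
  proof (rule ballI, rule ccontr)
    fix w assume w: "w \<in> late_walks N \<tau> l b c (2 * l) - core_walks N \<tau> l b c" and "edge_weight \<mu> w \<noteq> 0"
    then have d: "doubled w" using doubled_if_edge_weight_nonzero assms by blast
    have len: "length w = 2 * l + 1" and ends: "hd w = last w"
      using w by (auto simp: late_walks_def closed_walks_def)
    have "w ! 0 = w ! (2 * l)" using ends len
      by (metis Zero_not_Suc add_diff_cancel_right' hd_conv_nth last_conv_nth list.size(3) add.commute plus_1_eq_Suc)
    then have c0: "2 \<le> count_list w (w ! 0)" "w ! 0 = w ! (2 * l)"
      using count_list_ge_2I[of 0 "2 * l" w] len assms(2) by auto
    have "2 \<le> count_list w (w ! k)" if "k < length w" for k
    proof (cases "k = 0 \<or> k = 2 * l")
      case True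
      then show ?thesis using c0 by auto
    next
      case False
      then show ?thesis using w that len by (intro doubled_no_leaf_count[OF d]) (auto simp: late_walks_def)
    qed
    then have "\<forall>x\<in>set w. 2 \<le> count_list w x" by (metis in_set_conv_nth)
    then show False using w d by (auto simp: core_walks_def late_walks_def)
  qed
qed (rule finite_late_walks)

lemma finite_core_walks: "finite (core_walks N \<tau> l b c)"
  using finite_closed_walks[of N \<tau> l] by (auto simp: core_walks_def)

section \<open>Leafless walks: stripping a root outside the cycle\<close>

definition cyclic_core_walks :: "(bool \<Rightarrow> nat) \<Rightarrow> bool \<Rightarrow> nat \<Rightarrow> nat \<Rightarrow> nat \<Rightarrow> vertex list set" where
  "cyclic_core_walks N \<tau> l b c = {w \<in> core_walks N \<tau> l b c. 3 \<le> count_list w (hd w)}"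

lemma edges_wrap: "v \<noteq> [] \<Longrightarrow> edges (r # v @ [s]) = {r, hd v} # edges v @ [{last v, s}]"
  by (induction v arbitrary: r rule: edges.induct) auto

lemma num_of_wrap:
  assumes "r \<notin> set v"
  shows "num_of s (r # v @ [r]) = num_of s v + (if fst r = s then 1 else 0)"
proof -
  have "{x \<in> set (r # v @ [r]). fst x = s} =
    (if fst r = s then insert r {x \<in> set v. fst x = s} else {x \<in> set v. fst x = s})" by auto
  then show ?thesis using assms by (simp add: num_of_def)
qed

lemma closed_walks_wrap_iff:
  assumes "v \<noteq> []" "hd v = last v"
  shows "r # v @ [r] \<in> closed_walks N \<tau> (Suc l) \<longleftrightarrow> v \<in> closed_walks N (\<not> \<tau>) l \<and> fst r = \<tau> \<and> snd r < N \<tau>"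
proof -
  have "successively (\<lambda>x y. fst x \<noteq> fst y) (r # v @ [r]) \<longleftrightarrow>
      successively (\<lambda>x y. fst x \<noteq> fst y) v \<and> fst (hd v) = (\<not> fst r)"
    using assms by (auto simp: successively_Cons successively_append_iff)
  moreover have "(\<forall>x\<in>set (r # v @ [r]). snd x < N (fst x)) \<longleftrightarrow> (\<forall>x\<in>set v. snd x < N (fst x)) \<and> snd r < N (fst r)"
    by auto
  moreover have "hd (r # v @ [r]) = last (r # v @ [r])" "length (r # v @ [r]) = length v + 2" by auto
  ultimately show ?thesis using assms(2) unfolding closed_walks_def mem_Collect_eq by auto
qed

text \<open>If the root occurs only at the two ends, the only edges through it are the first and the
  last one. As no edge is used exactly once, these two coincide, so the inner walk is closed as
  well; it is again leafless and is rooted on the other side.\<close>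

lemma core_walks_strip_root:
  "{w \<in> core_walks N \<tau> (Suc l) (Suc b) c. \<not> 3 \<le> count_list w (hd w)} =
   (\<lambda>(v, r). r # v @ [r]) ` (SIGMA v:core_walks N (\<not> \<tau>) l c b. {x. fst x = \<tau> \<and> snd x < N \<tau> \<and> x \<notin> set v})"
  (is "?A = ?f ` ?T")
proof (intro Set.set_eqI iffI)
  fix w assume "w \<in> ?A"
  then have w: "w \<in> closed_walks N \<tau> (Suc l)" "num_of \<tau> w = Suc b" "num_of (\<not> \<tau>) w = c" "doubled w"
    "\<forall>x\<in>set w. 2 \<le> count_list w x" "\<not> 3 \<le> count_list w (hd w)" by (auto simp: core_walks_def)
  define r where "r = hd w"
  define v where "v = butlast (tl w)"
  have lw: "length w = 2 * l + 3" "last w = r" using w(1) by (auto simp: closed_walks_def r_def)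
  then have t: "w = r # tl w" "tl w \<noteq> []" unfolding r_def by (cases w; force)+
  have "last (tl w) = r" using t lw by (metis last_ConsR)
  then have wv: "w = r # v @ [r]" "length v = 2 * l + 1"
    using t append_butlast_last_id[OF t(2)] lw unfolding v_def by auto
  have cr: "r \<notin> set v" using w(6) unfolding wv(1) by (simp flip: count_list_0_iff)
  have vne: "v \<noteq> []" using wv(2) by auto
  have ew: "edges w = {r, hd v} # edges v @ [{last v, r}]"
    unfolding wv(1) using vne by (rule edges_wrap)
  have ne: "{r, x} \<notin> set (edges v)" for x using cr edges_subset[of "{r, x}" v] by blast
  have "count_list (edges w) {r, hd v} \<noteq> 1" using w(4) by (auto simp: doubled_def ew)
  then have hl: "hd v = last v" using ne cr vne
    unfolding ew by (auto simp: count_list_0_iff doubleton_eq_iff split: if_splits)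
  have dv: "doubled v"
    unfolding doubled_def
  proof
    fix e assume e: "e \<in> set (edges v)"
    then have "e \<noteq> {r, hd v}" "e \<noteq> {last v, r}" using ne[of "hd v"] ne[of "last v"] by (auto simp: insert_commute)
    then have "count_list (edges w) e = count_list (edges v) e" by (auto simp: ew)
    then show "count_list (edges v) e \<noteq> 1" using w(4) e by (auto simp: doubled_def ew)
  qed
  have cv: "2 \<le> count_list v x" if "x \<in> set v" for x
  proof -
    have "x \<noteq> r" using that cr by auto
    then show ?thesis using w(5) that by (auto simp: wv(1))
  qed
  have vcl: "v \<in> closed_walks N (\<not> \<tau>) l" and rN: "snd r < N \<tau>" and s: "fst r = \<tau>"
    using w(1) closed_walks_wrap_iff[OF vne hl] unfolding wv(1) by auto
  have "num_of \<tau> w = Suc (num_of \<tau> v)" "num_of (\<not> \<tau>) w = num_of (\<not> \<tau>) v"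
    unfolding wv(1) num_of_wrap[OF cr] using s by auto
  then have "(v, r) \<in> ?T" using vcl dv cv w(2,3) s rN cr by (auto simp: core_walks_def)
  then show "w \<in> ?f ` ?T" using wv(1) by force
next
  fix w assume "w \<in> ?f ` ?T"
  then obtain v r where v: "v \<in> core_walks N (\<not> \<tau>) l c b" and r: "fst r = \<tau>" "snd r < N \<tau>" "r \<notin> set v"
    and wv: "w = r # v @ [r]" by auto
  have vcl: "v \<in> closed_walks N (\<not> \<tau>) l" using v by (simp add: core_walks_def)
  have vne: "v \<noteq> []" and hl: "hd v = last v" using vcl by (auto simp: closed_walks_def)
  have ew: "edges w = {r, hd v} # edges v @ [{last v, r}]"
    unfolding wv(1) using vne by (rule edges_wrap)
  have ne: "{r, x} \<notin> set (edges v)" for x using r(3) edges_subset[of "{r, x}" v] by blast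
  have "doubled w"
    unfolding doubled_def
  proof
    fix e assume e: "e \<in> set (edges w)"
    show "count_list (edges w) e \<noteq> 1"
    proof (cases "e = {r, hd v}")
      case True
      then show ?thesis unfolding ew using hl by (simp add: insert_commute)
    next
      case False
      then have "e \<in> set (edges v)" "count_list (edges w) e = count_list (edges v) e"
        using e hl by (auto simp: ew insert_commute)
      then show ?thesis using v by (auto simp: core_walks_def doubled_def)
    qed
  qed
  moreover have "w \<in> closed_walks N \<tau> (Suc l)"
    unfolding wv closed_walks_wrap_iff[OF vne hl] using vcl r by simp
  moreover have "num_of \<tau> w = Suc (num_of \<tau> v)" "num_of (\<not> \<tau>) w = num_of (\<not> \<tau>) v"
    unfolding wv(1) num_of_wrap[OF r(3)] using r by auto
  moreover have "\<forall>x\<in>set w. 2 \<le> count_list w x"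
    using v r(3) by (auto simp: wv core_walks_def)
  moreover have "count_list w (hd w) = 2" using r(3) by (simp add: wv count_list_0_iff)
  ultimately show "w \<in> ?A" using v by (simp add: core_walks_def)
qed

section \<open>Doubled cycles\<close>

text \<open>A closed walk of length 2 l unrolled to all integers, which makes shifts and reflections
  free of wrap-around. Modulo the period, every vertex is visited exactly twice and every edge has a
  second passage; \<open>parity\<close> records that the graph is bipartite.\<close>

locale doubled_cycle =
  fixes v :: "int \<Rightarrow> 'a" and l :: nat
  assumes length_ge_2: "2 \<le> l"
    and periodic: "v (k + 2 * int l) = v k"
    and parity: "v s = v t \<Longrightarrow> even (s - t)"
    and partner: "\<exists>t. v t = v s \<and> \<not> 2 * int l dvd t - s"
    and at_most_twice: "v s = v t \<Longrightarrow> v s = v u \<Longrightarrow> 2 * int l dvd s - t \<or> 2 * int l dvd s - u \<or> 2 * int l dvd t - u"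
    and edge_partner: "\<exists>j. \<not> 2 * int l dvd j - k \<and> {v j, v (j + 1)} = {v k, v (k + 1)}"
begin

lemma periodic_mult: "v (k + 2 * int l * q) = v k"
proof (induction q rule: int_induct[where k = 0])
  case (step1 i)
  have "v (k + 2 * int l * (i + 1)) = v ((k + 2 * int l * i) + 2 * int l)" by (simp add: algebra_simps)
  then show ?case using step1 periodic[of "k + 2 * int l * i"] by simp
next
  case (step2 i)
  have "v (k + 2 * int l * i) = v ((k + 2 * int l * (i - 1)) + 2 * int l)" by (simp add: algebra_simps)
  then show ?case using step2 periodic[of "k + 2 * int l * (i - 1)"] by simp
qed simp

lemma period_cong:
  assumes "2 * int l dvd x - y"
  shows "v (x + j) = v (y + j)"
proof -
  obtain q where "x - y = 2 * int l * q" using assms by (auto simp: dvd_def)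
  then have "x + j = (y + j) + 2 * int l * q" by simp
  then show ?thesis by (metis periodic_mult)
qed

lemma period_cong0: "2 * int l dvd x - y \<Longrightarrow> v x = v y"
  using period_cong[of x y 0] by simp

lemma small_multiple: "2 * int l dvd x \<Longrightarrow> \<bar>x\<bar> < 2 * int l \<Longrightarrow> x = 0"
  using dvd_imp_le_int[of x "2 * int l"] by auto

lemma dvd_diff_commute: "2 * int l dvd x - y \<longleftrightarrow> 2 * int l dvd y - x"
  by (metis dvd_minus_iff minus_diff_eq)

text \<open>The edge on either side of s has a second passage, which contains another visit of
  \<open>v s\<close> or starts from s in the opposite direction. The only visits modulo the period
  are s and t, so the far end of the edge appears again next to one of them.\<close>

lemma neighbours_raw:
  assumes "v s = v t" "\<not> 2 * int l dvd s - t"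
  shows "v (s + 1) \<in> {v (s - 1), v (t - 1), v (t + 1)}" "v (s - 1) \<in> {v (s + 1), v (t - 1), v (t + 1)}"
proof -
  have cases: "v j = v s \<Longrightarrow> 2 * int l dvd j - s \<or> 2 * int l dvd j - t" for j
    using at_most_twice[of j s t] assms by auto
  obtain j where j: "\<not> 2 * int l dvd j - s" "{v j, v (j + 1)} = {v s, v (s + 1)}"
    using edge_partner[of s] by auto
  consider "v j = v s" "v (j + 1) = v (s + 1)" | "v j = v (s + 1)" "v (j + 1) = v s"
    using j(2) by (auto simp: doubleton_eq_iff)
  then show "v (s + 1) \<in> {v (s - 1), v (t - 1), v (t + 1)}"
  proof cases
    case 1
    then have "2 * int l dvd j - t" using cases j by blast
    then show ?thesis using 1 period_cong[of j t 1] by simp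
  next
    case 2
    then show ?thesis using cases[of "j + 1"] period_cong[of "j + 1" s "-1"] period_cong[of "j + 1" t "-1"] by auto
  qed
  obtain j where j: "\<not> 2 * int l dvd j - (s - 1)" "{v j, v (j + 1)} = {v (s - 1), v s}"
    using edge_partner[of "s - 1"] by auto
  consider "v j = v s" "v (j + 1) = v (s - 1)" | "v j = v (s - 1)" "v (j + 1) = v s"
    using j(2) by (auto simp: doubleton_eq_iff)
  then show "v (s - 1) \<in> {v (s + 1), v (t - 1), v (t + 1)}"
  proof cases
    case 1
    then show ?thesis using cases[of j] period_cong[of j s 1] period_cong[of j t 1] by auto
  next
    case 2
    have "\<not> 2 * int l dvd (j + 1) - s" using j(1) by (simp add: algebra_simps)
    then have "2 * int l dvd (j + 1) - t" using cases[of "j + 1"] 2 by blast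
    then show ?thesis using 2 period_cong[of "j + 1" t "-1"] by auto
  qed
qed

text \<open>Each of the four neighbours equals one of the other three, so they match up in pairs:
  the walk turns back at both visits, or passes both in the same direction, or in opposite
  directions.\<close>

lemma neighbours:
  assumes "v s = v t" "\<not> 2 * int l dvd s - t"
  shows "(v (s - 1) = v (s + 1) \<and> v (t - 1) = v (t + 1)) \<or>
    (v (s - 1) = v (t - 1) \<and> v (s + 1) = v (t + 1)) \<or> (v (s - 1) = v (t + 1) \<and> v (s + 1) = v (t - 1))"
proof -
  have four: "(a = b \<and> c = d) \<or> (a = c \<and> b = d) \<or> (a = d \<and> b = c)"
    if "b \<in> {a, c, d}" "a \<in> {b, c, d}" "d \<in> {c, a, b}" "c \<in> {d, a, b}" for a b c d :: 'a
    using that by auto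
  have "\<not> 2 * int l dvd t - s" using assms(2) dvd_diff_commute by blast
  from neighbours_raw[OF assms] neighbours_raw[OF assms(1)[symmetric] this] show ?thesis
    by (rule four)
qed

text \<open>The positions t + k + 1 and t - k - 1 are two visits of one vertex that share the
  neighbour towards t. By \<open>neighbours\<close> the neighbours away from t agree as well, and
  the symmetry spreads outwards from t.\<close>

lemma reflection_upto:
  assumes "v (t - 1) = v (t + 1)" "k < l"
  shows "v (t + int k) = v (t - int k) \<and> v (t + int k + 1) = v (t - int k - 1)"
  using assms(2)
proof (induction k)
  case 0
  then show ?case using assms(1) by simp
next
  case (Suc k)
  define s u where "s = t + int k + 1" and "u = t - int k - 1"
  have IH: "v (s - 1) = v (u + 1)" "v s = v u" using Suc by (auto simp: s_def u_def)
  have "\<not> 2 * int l dvd s - u" using small_multiple[of "s - u"] Suc.prems by (auto simp: s_def u_def)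
  from neighbours[OF IH(2) this] have "v (s + 1) = v (u - 1)" using IH by auto
  then show ?case using IH(2) by (simp add: s_def u_def algebra_simps)
qed

text \<open>The preceding lemma covers half a period on each side of t, and periodicity covers the
  rest.\<close>

lemma reflection:
  assumes "v (t - 1) = v (t + 1)"
  shows "v (t + k) = v (t - k)" "v (t + int l) = v t"
proof -
  have less: "v (t + int j) = v (t - int j)" if "j < l" for j using reflection_upto[OF assms that] by simp
  have refl: "v (t + k) = v (t - k)" for k
  proof -
    define r where "r = k mod (2 * int l)"
    have r: "0 \<le> r" "r < 2 * int l" using length_ge_2 by (auto simp: r_def)
    have d: "2 * int l dvd k - r" by (simp add: r_def dvd_minus_mod)
    have "2 * int l dvd (t + k) - (t + r)" "2 * int l dvd (t - r) - (t - k)" using d by auto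
    then have e: "v (t + k) = v (t + r)" "v (t - k) = v (t - r)" using period_cong0 by metis+
    have "v (t + r) = v (t - r)"
    proof (cases "r < int l")
      case True
      then show ?thesis using less[of "nat r"] r by auto
    next
      case False
      have a: "v (t + r) = v (t + r - 2 * int l)" "v (t - r) = v (t - r + 2 * int l)"
        by (auto intro!: period_cong0)
      show ?thesis
      proof (cases "r = int l")
        case True
        then show ?thesis using a by simp
      next
        case ne: False
        then have "v (t + int (nat (2 * int l - r))) = v (t - int (nat (2 * int l - r)))"
          using False r by (intro less) auto
        then show ?thesis using a r by (simp add: algebra_simps)
      qed
    qed
    then show ?thesis using e by simp
  qed
  show "v (t + k) = v (t - k)" by (rule refl)
  obtain u where u: "v u = v t" "\<not> 2 * int l dvd u - t" using partner by blast
  \<comment> \<open>The mirror image of the partner u is a further visit of \<open>v t\<close>.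
    Since only two exist, it coincides with u modulo the period, which leaves only u = t +
    l.\<close>
  have "v (2 * t - u) = v t" using refl[of "u - t"] u by (simp add: algebra_simps)
  then have "2 * int l dvd u - (2 * t - u) \<or> 2 * int l dvd t - (2 * t - u)"
    using at_most_twice[of u t "2 * t - u"] u by auto
  moreover have "t - (2 * t - u) = u - t" "u - (2 * t - u) = 2 * (u - t)" by auto
  ultimately have "2 * int l dvd 2 * (u - t)" using u by metis
  then have "int l dvd u - t" by (rule dvd_mult_cancel_left[THEN iffD1, THEN disjE]) auto
  then obtain q where q: "u - t = int l * q" by (auto simp: dvd_def)
  have "odd q"
  proof
    assume "even q"
    then have "2 * int l dvd u - t" unfolding q by auto
    then show False using u by blast
  qed
  then obtain q' where "q = 2 * q' + 1" by (metis oddE)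
  then have "u - (t + int l) = 2 * int l * q'" using q by (simp add: algebra_simps)
  then have "v u = v (t + int l)" by (intro period_cong0) (metis dvd_triv_left)
  then show "v (t + int l) = v t" using u by simp
qed

text \<open>Without turns, the visits 0 and r of a vertex are passed either in parallel or in
  opposite directions. In the latter case the two strands would meet halfway and turn there. So they
  are parallel, which propagates along the whole walk, and r becomes a period.\<close>

lemma rotation:
  assumes no_turn: "\<And>s. v (s - 1) \<noteq> v (s + 1)"
  shows "v (k + int l) = v k"
proof -
  obtain r0 where r0: "v r0 = v 0" "\<not> 2 * int l dvd r0 - 0" using partner[of 0] by blast
  define r where "r = r0 mod (2 * int l)"
  have "v r = v r0" unfolding r_def by (intro period_cong0) (metis dvd_minus_mod dvd_diff_commute)
  then have vr: "v r = v 0" using r0 by simp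
  have "0 \<le> r" "r \<noteq> 0" using r0(2) length_ge_2 by (auto simp: r_def dvd_eq_mod_eq_0)
  moreover have "r < 2 * int l" using length_ge_2 by (simp add: r_def)
  ultimately have rb: "0 < r" "r < 2 * int l" by auto
  have nd: "\<not> 2 * int l dvd 0 - r" using small_multiple[of r] rb dvd_diff_commute[of 0 r] by auto
  have nd': "\<not> 2 * int l dvd k - (k + r)" for k using nd by simp
  have "even r" using parity[OF vr] by simp
  have "v 1 = v (r + 1)"
  proof (rule ccontr)
    assume "v 1 \<noteq> v (r + 1)"
    then have anti: "v 1 = v (r - 1)" "v (-1) = v (r + 1)"
      using neighbours[of 0 r] vr nd no_turn[of 0] by auto
    have "v (int k) = v (r - int k) \<and> v (int k + 1) = v (r - int k - 1)" if "2 * int k < r" for k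
      using that
    proof (induction k)
      case 0
      then show ?case using anti vr by simp
    next
      case (Suc k)
      define s u where "s = int k + 1" and "u = r - int k - 1"
      have IH: "v (s - 1) = v (u + 1)" "v s = v u" using Suc by (auto simp: s_def u_def)
      have "\<not> 2 * int l dvd s - u" using small_multiple[of "s - u"] Suc.prems rb by (auto simp: s_def u_def)
      from neighbours[OF IH(2) this] have "v (s + 1) = v (u - 1)" using IH no_turn[of s] no_turn[of u] by auto
      then show ?case using IH(2) by (simp add: s_def u_def algebra_simps)
    qed
    \<comment> \<open>The two strands meet at r / 2, an integer by \<open>parity\<close>, where the
      neighbours on both sides would coincide.\<close>
    from this[of "nat (r div 2 - 1)"] have "v (r div 2 - 1) = v (r div 2 + 1)"
      using rb \<open>even r\<close> by (auto elim!: evenE)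
    then show False using no_turn by blast
  qed
  then have init: "v 0 = v (0 + r) \<and> v (0 + 1) = v (0 + r + 1)" using vr by (simp add: add.commute)
  have up: "v k = v (k + r) \<and> v (k + 1) = v (k + r + 1)" for k
  proof (induction k rule: int_induct[where k = 0])
    case base
    then show ?case using init by simp
  next
    case (step1 k)
    have "v (k + 1) = v (k + 1 + r)" using step1 by (simp add: algebra_simps)
    from neighbours[OF this nd'] have "v (k + 2) = v (k + r + 2)"
      using no_turn[of "k + 1"] no_turn[of "k + 1 + r"] step1 by (auto simp: algebra_simps)
    then show ?case using step1 by (simp add: algebra_simps)
  next
    case (step2 k)
    have "v k = v (k + r)" using step2 by simp
    from neighbours[OF this nd'] have "v (k - 1) = v (k + r - 1)"
      using no_turn[of k] no_turn[of "k + r"] step2 by auto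
    then show ?case using step2 by (simp add: algebra_simps)
  qed
  \<comment> \<open>Three visits 0, r and 2 r of one vertex: two must agree modulo 2 l, hence l
    divides r, and 0 < r < 2 l leaves r = l.\<close>
  have "v 0 = v (r + r)" using up[of 0] up[of r] by simp
  then have "2 * int l dvd 0 - r \<or> 2 * int l dvd 0 - (r + r) \<or> 2 * int l dvd r - (r + r)"
    using vr by (intro at_most_twice) auto
  then have "2 * int l dvd 2 * r" using nd by (auto simp: dvd_diff_commute[of 0])
  then have "int l dvd r" by (rule dvd_mult_cancel_left[THEN iffD1, THEN disjE]) auto
  then obtain q where q: "r = int l * q" by (auto simp: dvd_def)
  have "0 < q" "q < 2" using rb unfolding q using length_ge_2 by (auto simp: zero_less_mult_iff mult.commute[of 2])
  then have "q = 1" by simp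
  then show ?thesis using up[of k] q by simp
qed

lemma rotation_or_reflection:
  "(\<forall>k. v (k + int l) = v k) \<or> (\<exists>t<l. (\<forall>k. v (int t + k) = v (int t - k)) \<and> v (int t + int l) = v (int t))"
proof (cases "\<exists>s. v (s - 1) = v (s + 1)")
  case True
  then obtain s where s: "v (s - 1) = v (s + 1)" by blast
  \<comment> \<open>Moving the centre of a reflection by l shifts the mirror images by the full
    period 2 l, so the centre matters only modulo l.\<close>
  define t where "t = s mod int l"
  define q where "q = s div int l"
  have st: "s = t + int l * q" by (simp add: t_def q_def)
  have refl: "v (t + k) = v (t - k)" for k
  proof -
    have "v (t + k) = v (s + (k - int l * q))" by (simp add: st)
    also have "\<dots> = v (s - (k - int l * q))" by (rule reflection[OF s])
    also have "\<dots> = v (t - k)" unfolding st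
      using periodic_mult[of "t - k" q] by (simp add: algebra_simps)
    finally show ?thesis .
  qed
  have "v (t - 1) = v (t + 1)" using refl[of 1] by simp
  from reflection(2)[OF this] have "v (t + int l) = v t" .
  moreover have "0 \<le> t" "t < int l" using length_ge_2 by (auto simp: t_def)
  ultimately show ?thesis using refl by (intro disjI2 exI[of _ "nat t"]) auto
next
  case False
  then show ?thesis using rotation by blast
qed

lemma even_length: "even l"
  using rotation_or_reflection parity[of "k + int l" k for k] by fastforce

text \<open>A reversed passage right after the one at i means that the walk turns at i + 1, so j is
  i + 2 and \<open>v (i + 3) = v (i + 1)\<close>. Pairing neighbours at i and i + 2 then gives
  \<open>v (i - 1)\<close> the same value: three visits of one vertex, distinct modulo 2 l because
  \<open>3 \<le> l\<close>.\<close>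

lemma edges_at_most_twice_aux:
  assumes "3 \<le> l" "v i = v j" "v (i + 1) = v (j + 1)" "\<not> 2 * int l dvd i - j" "v k = v (i + 1)" "v (k + 1) = v i"
    and "2 * int l dvd k - (i + 1)"
  shows False
proof -
  have "v (k + 1) = v (i + 2)" using period_cong[OF assms(7), of 1] by (simp add: add.commute)
  then have vi: "v i = v (i + 2)" using assms by simp
  have n2: "\<not> 2 * int l dvd i - (i + 2)" "\<not> 2 * int l dvd i + 1 - (i - 1)"
    using small_multiple[of "-2"] small_multiple[of 2] assms(1) by auto
  have "2 * int l dvd j - (i + 2)"
    using at_most_twice[of i j "i + 2"] vi assms(2,4) n2 by auto
  then have "v (j + 1) = v (i + 3)" using period_cong[of j "i + 2" 1] by (simp add: add.commute)
  then have "v (i + 3) = v (i + 1)" using assms by simp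
  moreover have "i + 2 - 1 = i + 1" "i + 2 + 1 = i + 3" by auto
  ultimately have "v (i - 1) = v (i + 1)" using neighbours[OF vi n2(1)] by metis
  then have "2 * int l dvd i + 1 - (i - 1) \<or> 2 * int l dvd i + 1 - (i + 3) \<or> 2 * int l dvd i - 1 - (i + 3)"
    using \<open>v (i + 3) = v (i + 1)\<close> by (intro at_most_twice) auto
  then show False using small_multiple[of "-2"] small_multiple[of "-4"] n2 assms(1) by auto
qed

text \<open>Among three passages of an edge two have the same direction. A third in that direction
  would visit a vertex three times, and a reversed one is excluded by
  \<open>edges_at_most_twice_aux\<close>. For l = 2 the claim fails: a single edge is then used four
  times.\<close>

lemma edges_at_most_twice:
  assumes "3 \<le> l" "{v i, v (i + 1)} = {v j, v (j + 1)}" "{v i, v (i + 1)} = {v k, v (k + 1)}"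
  shows "2 * int l dvd i - j \<or> 2 * int l dvd i - k \<or> 2 * int l dvd j - k"
proof (rule ccontr)
  assume n: "\<not> ?thesis"
  have two: False if A: "v i = v j" "v (i + 1) = v (j + 1)" "\<not> 2 * int l dvd i - j" 
     "\<not> 2 * int l dvd i - k" "\<not> 2 * int l dvd j - k" "{v i, v (i + 1)} = {v k, v (k + 1)}" for i j k
  proof -
    note B = that
    consider "v k = v i" | "v k = v (i + 1)" "v (k + 1) = v i" using B(6) by (auto simp: doubleton_eq_iff)
    then show False
    proof cases
      case 1
      then show False using at_most_twice[of i j k] that by auto
    next
      case 2
      have "2 * int l dvd k - (i + 1) \<or> 2 * int l dvd k - (j + 1)"
        using at_most_twice[of k "i + 1" "j + 1"] 2 that(2,3) by auto
      then show False
        using edges_at_most_twice_aux[OF assms(1), of i j k] edges_at_most_twice_aux[OF assms(1), of j i k]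
          2 that dvd_diff_commute[of i j] by auto
    qed
  qed
  consider "v i = v j" "v (i + 1) = v (j + 1)" | "v i = v k" "v (i + 1) = v (k + 1)" | "v j = v k" "v (j + 1) = v (k + 1)"
    using assms(2,3) by (auto simp: doubleton_eq_iff)
  then show False
    using two[of i j k] two[of i k j] two[of j k i] n assms(2,3) dvd_diff_commute[of i] dvd_diff_commute[of j k]
      dvd_diff_commute[of i j] dvd_diff_commute[of i k] by cases auto
qed

end

section \<open>From closed walks to doubled cycles\<close>

lemma count_list_card: "count_list w x = card {k. k < length w \<and> w ! k = x}"
proof -
  have "{k. k < length w \<and> w ! k = x} = {k. k < length w \<and> x = w ! k}" by auto
  then show ?thesis by (simp add: count_list_eq_length_filter length_filter_conv_card)
qed

definition unroll :: "'a list \<Rightarrow> int \<Rightarrow> 'a" where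
  "unroll w k = w ! nat (k mod int (length w - 1))"

lemma unroll_period: "unroll w (k + int (length w - 1)) = unroll w k"
  by (simp add: unroll_def)

lemma unroll_nth:
  assumes "hd w = last w" "k < length w" "2 \<le> length w"
  shows "unroll w (int k) = w ! k"
proof (cases "k = length w - 1")
  case True
  have "w ! 0 = w ! k" using assms by (metis True hd_conv_nth last_conv_nth list.size(3) not_numeral_le_zero)
  then show ?thesis using True by (simp add: unroll_def)
next
  case False
  then show ?thesis using assms by (simp add: unroll_def)
qed

lemma card_two_third:
  assumes "card A = 2" "x \<in> A" "y \<in> A" "z \<in> A"
  shows "x = y \<or> x = z \<or> y = z"
  using assms by (auto simp: card_2_iff)

text \<open>Without the final copy of the root there are 2 l entries for l vertices, each occurring
  at least twice, so equality holds throughout. The third occurrence of the root ensures that it too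
  still occurs twice after its last copy is dropped.\<close>

lemma cyclic_core_count:
  assumes w: "w \<in> cyclic_core_walks N \<tau> l b c" and "b + c = l" "x \<in> set w"
  shows "card {k. k < 2 * l \<and> w ! k = x} = 2"
proof -
  have len: "length w = 2 * l + 1" and hl: "hd w = last w" and c2: "\<And>x. x \<in> set w \<Longrightarrow> 2 \<le> count_list w x"
    and c3: "3 \<le> count_list w (hd w)" and card: "card (set w) = l"
    using w num_of_add[of \<tau> w] assms(2)
    by (auto simp: cyclic_core_walks_def core_walks_def closed_walks_def)
  have bw: "w = butlast w @ [last w]" using len by (metis append_butlast_last_id list.size(3) add_is_0 one_neq_zero)
  have cb: "count_list w x = count_list (butlast w) x + (if x = hd w then 1 else 0)" for x
    by (subst bw) (auto simp: hl)
  have ge: "2 \<le> count_list (butlast w) x" if "x \<in> set w" for x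
    using c2[OF that] c3 cb[of x] cb[of "hd w"] by (cases "x = hd w") auto
  have "set (butlast w) \<subseteq> set w" using in_set_butlastD by fast
  then have "(\<Sum>x\<in>set w. count_list (butlast w) x) = (\<Sum>x\<in>set w. 2)"
    using sum_count_set[of "butlast w" "set w"] by (simp add: len card)
  then have "count_list (butlast w) x = 2"
    using sum_mono_inv[of "\<lambda>_. 2" "set w" "count_list (butlast w)" x] ge assms(3) by simp
  moreover have "{k. k < length (butlast w) \<and> butlast w ! k = x} = {k. k < 2 * l \<and> w ! k = x}"
    by (auto simp: len nth_butlast)
  ultimately show ?thesis by (simp add: count_list_card)
qed

lemma doubled_cycle_unroll:
  assumes w: "w \<in> cyclic_core_walks N \<tau> l b c" and bc: "b + c = l" and l: "2 \<le> l"
  shows "doubled_cycle (unroll w) l"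
proof -
  have cl: "w \<in> closed_walks N \<tau> l" and d: "doubled w"
    using w by (auto simp: cyclic_core_walks_def core_walks_def)
  have len: "length w = 2 * l + 1" and hl: "hd w = last w" using cl by (auto simp: closed_walks_def)
  define i where "i k = nat (k mod (2 * int l))" for k
  have un: "unroll w k = w ! i k" for k by (simp add: unroll_def i_def len)
  have ib: "i k < 2 * l" for k
  proof -
    have "k mod (2 * int l) < 2 * int l" using l by simp
    then show ?thesis using l by (simp add: i_def nat_less_iff)
  qed
  have ii: "i (int k) = k" if "k < 2 * l" for k using that by (simp add: i_def)
  have dvd: "2 * int l dvd s - t \<longleftrightarrow> i s = i t" for s t
    unfolding i_def using l by (simp add: mod_eq_dvd_iff[symmetric] nat_eq_iff)
  have i1: "w ! Suc (i k) = unroll w (k + 1)" for k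
  proof -
    have "int (i k) = k mod (2 * int l)" using l by (simp add: i_def)
    then have "2 * int l dvd (k + 1) - int (Suc (i k))" by (simp add: dvd_minus_mod)
    then have "i (k + 1) = i (int (Suc (i k)))" using dvd by blast
    then have "unroll w (k + 1) = unroll w (int (Suc (i k)))" by (simp add: un)
    also have "\<dots> = w ! Suc (i k)" using ib[of k] hl l len by (intro unroll_nth) auto
    finally show ?thesis by simp
  qed
  have ins: "w ! i k \<in> set w" for k using ib[of k] len by simp
  show ?thesis
  proof
    show "2 \<le> l" by (rule l)
    show "unroll w (k + 2 * int l) = unroll w k" for k
      using unroll_period[of w k] len by simp
    show "even (s - t)" if "unroll w s = unroll w t" for s t
    proof -
      have "fst (w ! i s) = fst (w ! i t)" using that un by simp
      then have "even (i s) = even (i t)"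
        using closed_walks_fst_nth[OF cl, of "i s"] closed_walks_fst_nth[OF cl, of "i t"] ib[of s] ib[of t] by auto
      moreover have "even (i k) = even k" for k
      proof -
        have "int (i k) = k mod (2 * int l)" using l by (simp add: i_def)
        moreover have "even (k mod (2 * int l)) = even k" by (metis dvd_mod_iff dvd_triv_left)
        ultimately show ?thesis by (metis even_of_nat)
      qed
      ultimately show ?thesis by simp
    qed
    show "\<exists>t. unroll w t = unroll w s \<and> \<not> 2 * int l dvd t - s" for s
    proof -
      define K where "K = {k. k < 2 * l \<and> w ! k = w ! i s}"
      have "card K = 2" unfolding K_def by (rule cyclic_core_count[OF w bc ins])
      then have "K \<noteq> {i s}" by auto
      moreover have "i s \<in> K" using ib by (simp add: K_def)
      ultimately obtain k where "k \<noteq> i s" "k \<in> K" by blast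
      then have "k \<noteq> i s" "k < 2 * l" "w ! k = w ! i s" by (auto simp: K_def)
      then show ?thesis by (intro exI[of _ "int k"]) (simp add: dvd un ii)
    qed
    show "2 * int l dvd s - t \<or> 2 * int l dvd s - u \<or> 2 * int l dvd t - u"
      if "unroll w s = unroll w t" "unroll w s = unroll w u" for s t u
      unfolding dvd using that ib
      by (intro card_two_third[OF cyclic_core_count[OF w bc ins[of s]]]) (auto simp: un)
    show "\<exists>j. \<not> 2 * int l dvd j - k \<and> {unroll w j, unroll w (j + 1)} = {unroll w k, unroll w (k + 1)}" for k
    proof -
      define e where "e = edges w ! i k"
      have e: "edges w ! i j = {unroll w j, unroll w (j + 1)}" for j
        using nth_edges[of "i j" w] ib[of j] i1[of j] by (simp add: len un)
      have "i k < length (edges w)" using ib[of k] by (simp add: length_edges len)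
      then have "e \<in> set (edges w)" by (simp add: e_def)
      then have "count_list (edges w) e \<noteq> 1" using d by (simp add: doubled_def)
      moreover define K where "K = {j. j < 2 * l \<and> edges w ! j = e}"
      ultimately have "card K \<noteq> 1" by (simp add: count_list_card length_edges len)
      then have "K \<noteq> {i k}" by auto
      moreover have "i k \<in> K" using ib by (simp add: K_def e_def)
      ultimately obtain j where "j \<noteq> i k" "j \<in> K" by blast
      then have j: "j \<noteq> i k" "j < 2 * l" "edges w ! j = e" by (auto simp: K_def)
      then show ?thesis using e[of "int j"] e[of k] by (intro exI[of _ "int j"]) (auto simp: dvd ii e_def)
    qed
  qed
qed

lemma edge_weight_cyclic_core:
  assumes w: "w \<in> cyclic_core_walks N \<tau> l b c" and bc: "b + c = l" and l: "3 \<le> l" and \<mu>: "\<mu> 2 = 1"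
  shows "edge_weight \<mu> w = 1"
proof -
  have "2 \<le> l" using l by simp
  interpret doubled_cycle "unroll w" l by (rule doubled_cycle_unroll[OF w bc \<open>2 \<le> l\<close>])
  have len: "length w = 2 * l + 1" and hl: "hd w = last w" and d: "doubled w"
    using w by (auto simp: closed_walks_def cyclic_core_walks_def core_walks_def)
  have "count_list (edges w) e = 2" if e: "e \<in> set (edges w)" for e
  proof (rule ccontr)
    assume "count_list (edges w) e \<noteq> 2"
    moreover have "count_list (edges w) e \<noteq> 0" using e by (simp add: count_list_0_iff)
    moreover have "count_list (edges w) e \<noteq> 1" using e d by (simp add: doubled_def)
    ultimately have "3 \<le> count_list (edges w) e" by linarith
    moreover define K where "K = {k. k < 2 * l \<and> edges w ! k = e}"
    ultimately have "3 \<le> card K" by (simp add: count_list_card length_edges len)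
    then obtain B where "B \<subseteq> K" "card B = 3" by (metis obtain_subset_with_card_n)
    then obtain i j k where "i \<in> K" "j \<in> K" "k \<in> K" and ne: "i \<noteq> j" "i \<noteq> k" "j \<noteq> k"
      by (auto simp: card_3_iff)
    then have ijk: "i < 2 * l" "j < 2 * l" "k < 2 * l"
      "edges w ! i = e" "edges w ! j = e" "edges w ! k = e" by (auto simp: K_def)
    have un: "edges w ! i = {unroll w (int i), unroll w (int i + 1)}" if "i < 2 * l" for i
      using that nth_edges[of i w] unroll_nth[OF hl, of i] unroll_nth[OF hl, of "Suc i"] len
      by (simp add: add.commute)
    have "2 * int l dvd int i - int j \<or> 2 * int l dvd int i - int k \<or> 2 * int l dvd int j - int k"
      by (rule edges_at_most_twice[OF l]) (simp_all add: un[symmetric] ijk)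
    moreover have "\<bar>int i - int j\<bar> < 2 * int l" "\<bar>int i - int k\<bar> < 2 * int l" "\<bar>int j - int k\<bar> < 2 * int l"
      using ijk(1-3) by linarith+
    ultimately show False
      using small_multiple[of "int i - int j"] small_multiple[of "int i - int k"] small_multiple[of "int j - int k"]
        ijk(1-3) ne by auto
  qed
  then show ?thesis using \<mu> by (simp add: edge_weight_def)
qed

section \<open>Counting the doubled cycles\<close>

definition falling :: "nat \<Rightarrow> nat \<Rightarrow> real" where
  "falling n k = (\<Prod>i<k. real n - real i)"

lemma falling_0 [simp]: "falling n 0 = 1"
  by (simp add: falling_def)

lemma falling_Suc: "falling n (Suc k) = (real n - real k) * falling n k"
  by (simp add: falling_def)

text \<open>Labellings of a cycle by distinct vertices in cyclic order, starting on side
  \<open>\<sigma>\<close>.\<close>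

definition alternating_lists :: "(bool \<Rightarrow> nat) \<Rightarrow> bool \<Rightarrow> nat \<Rightarrow> vertex list set" where
  "alternating_lists N \<sigma> k = {xs. length xs = k \<and> distinct xs \<and> (\<forall>j<k. fst (xs ! j) = (\<sigma> = even j)) \<and>
     (\<forall>x\<in>set xs. snd x < N (fst x))}"

lemma alternating_lists_Suc:
  "alternating_lists N \<sigma> (Suc k) =
    (\<lambda>(xs, x). x # xs) ` (SIGMA xs:alternating_lists N (\<not> \<sigma>) k. {x. fst x = \<sigma> \<and> snd x < N \<sigma> \<and> x \<notin> set xs})"
  (is "?A = ?f ` ?T")
proof (intro Set.set_eqI iffI)
  fix ys assume ys: "ys \<in> ?A"
  then obtain x xs where yx: "ys = x # xs" by (cases ys) (auto simp: alternating_lists_def)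
  have "fst (xs ! j) = ((\<not> \<sigma>) = even j)" if "j < k" for j
    using ys that by (auto simp: yx alternating_lists_def dest!: spec[of _ "Suc j"])
  moreover have "fst x = \<sigma>" using ys by (auto simp: yx alternating_lists_def dest: spec[of _ 0])
  ultimately have "(xs, x) \<in> ?T" using ys by (auto simp: yx alternating_lists_def)
  then show "ys \<in> ?f ` ?T" using yx by force
next
  fix ys assume "ys \<in> ?f ` ?T"
  then obtain x xs where "ys = x # xs" "xs \<in> alternating_lists N (\<not> \<sigma>) k" "fst x = \<sigma>" "snd x < N \<sigma>" "x \<notin> set xs"
    by auto
  then show "ys \<in> ?A" by (auto simp: alternating_lists_def nth_Cons split: nat.splits)
qed

lemma num_of_Cons: "x \<notin> set xs \<Longrightarrow> num_of s (x # xs) = num_of s xs + (if fst x = s then 1 else 0)"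
proof -
  assume x: "x \<notin> set xs"
  have "{z \<in> set (x # xs). fst z = s} =
    (if fst x = s then insert x {z \<in> set xs. fst z = s} else {z \<in> set xs. fst z = s})" by auto
  then show ?thesis using x by (simp add: num_of_def)
qed

lemma num_of_alternating_lists:
  "xs \<in> alternating_lists N \<sigma> k \<Longrightarrow> num_of \<sigma> xs = (k + 1) div 2 \<and> num_of (\<not> \<sigma>) xs = k div 2"
proof (induction k arbitrary: \<sigma> xs)
  case 0
  then show ?case by (simp add: alternating_lists_def num_of_def)
next
  case (Suc k)
  then obtain x ys where xs: "xs = x # ys" "ys \<in> alternating_lists N (\<not> \<sigma>) k" "fst x = \<sigma>" "x \<notin> set ys"
    unfolding alternating_lists_Suc by auto
  then show ?case using Suc.IH[OF xs(2)] by (simp add: num_of_Cons)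
qed

lemma finite_alternating_lists: "finite (alternating_lists N \<sigma> k)"
proof -
  have "alternating_lists N \<sigma> k \<subseteq> {w. set w \<subseteq> (SIGMA s:UNIV. {..<N s}) \<and> length w = k}"
    by (auto simp: alternating_lists_def)
  then show ?thesis by (rule finite_subset) (auto intro!: finite_lists_length_eq finite_SigmaI)
qed

lemma finite_fresh: "finite {x::vertex. fst x = s \<and> snd x < n \<and> x \<notin> A}"
  by (rule finite_subset[of _ "{s} \<times> {..<n}"]) auto

lemma card_alternating_lists:
  "real (card (alternating_lists N \<sigma> k)) = falling (N \<sigma>) ((k + 1) div 2) * falling (N (\<not> \<sigma>)) (k div 2)"
proof (induction k arbitrary: \<sigma>)
  case 0
  have "alternating_lists N \<sigma> 0 = {[]}" by (auto simp: alternating_lists_def)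
  then show ?case by simp
next
  case (Suc k)
  have "card (alternating_lists N \<sigma> (Suc k)) =
    card (SIGMA xs:alternating_lists N (\<not> \<sigma>) k. {x. fst x = \<sigma> \<and> snd x < N \<sigma> \<and> x \<notin> set xs})"
    unfolding alternating_lists_Suc by (intro card_image) (auto simp: inj_on_def)
  also have "\<dots> = (\<Sum>xs\<in>alternating_lists N (\<not> \<sigma>) k. card {x. fst x = \<sigma> \<and> snd x < N \<sigma> \<and> x \<notin> set xs})"
    by (intro card_SigmaI) (auto simp: finite_alternating_lists finite_fresh)
  finally have "real (card (alternating_lists N \<sigma> (Suc k))) =
    (\<Sum>xs\<in>alternating_lists N (\<not> \<sigma>) k. real (card {x. fst x = \<sigma> \<and> snd x < N \<sigma> \<and> x \<notin> set xs}))" by simp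
  also have "\<dots> = (\<Sum>xs\<in>alternating_lists N (\<not> \<sigma>) k. real (N \<sigma>) - real (k div 2))"
  proof (rule sum.cong[OF refl])
    fix xs assume xs: "xs \<in> alternating_lists N (\<not> \<sigma>) k"
    then have "num_of \<sigma> xs = k div 2" using num_of_alternating_lists[OF xs] by simp
    moreover have "\<forall>x\<in>set xs. snd x < N (fst x)" using xs by (simp add: alternating_lists_def)
    ultimately show "real (card {x. fst x = \<sigma> \<and> snd x < N \<sigma> \<and> x \<notin> set xs}) = real (N \<sigma>) - real (k div 2)"
      using card_fresh[of xs N \<sigma>] by (simp add: of_nat_diff)
  qed
  finally show ?case using Suc.IH[of "\<not> \<sigma>"] by (simp add: falling_Suc)
qed

text \<open>Position on the cycle of step \<open>k\<close>: for \<open>t < l\<close> the walk turns back at time \<open>t\<close>, while \<open>t = l\<close>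
  encodes the cycle traversed twice in the same direction. In both cases \<open>t\<close> is sent to 0.\<close>

definition fold_pos :: "nat \<Rightarrow> nat \<Rightarrow> int \<Rightarrow> nat" where
  "fold_pos l t k = (if t = l then nat (k mod int l)
     else nat (min ((k - int t) mod (2 * int l)) ((int t - k) mod (2 * int l))) mod l)"

lemma fold_pos_less: "0 < l \<Longrightarrow> fold_pos l t k < l"
  by (simp add: fold_pos_def nat_less_iff)

lemma fold_pos_cong:
  assumes "2 * int l dvd j - k"
  shows "fold_pos l t j = fold_pos l t k"
proof -
  have "int l dvd j - k" using assms by (rule dvd_mult_right)
  then have "j mod int l = k mod int l" by (simp add: mod_eq_dvd_iff)
  moreover have "(j - int t) mod (2 * int l) = (k - int t) mod (2 * int l)"
    using assms by (simp add: mod_eq_dvd_iff)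
  moreover have "(int t - j) mod (2 * int l) = (int t - k) mod (2 * int l)"
    using assms by (simp add: mod_eq_dvd_iff) (metis dvd_minus_iff minus_diff_eq)
  ultimately show ?thesis by (simp add: fold_pos_def)
qed

text \<open>From time \<open>t\<close> on, the walk first runs once through the cycle in order. This
  shows that every position is reached and lets the list of vertices be recovered from the
  walk.\<close>

lemma fold_pos_start:
  assumes "j < l"
  shows "fold_pos l t (int t + int j) = j"
proof (cases "t = l")
  case True
  then show ?thesis using assms by (simp add: fold_pos_def)
next
  case False
  have "int j \<le> (- int j) mod (2 * int l)"
  proof (cases "j = 0")
    case False
    have "(- int j) mod (2 * int l) = 2 * int l - int j"
      using assms False by (simp add: zmod_zminus1_eq_if)
    then show ?thesis using assms by simp
  qed simp
  then show ?thesis using False assms by (simp add: fold_pos_def)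
qed

lemma fold_pos_parity:
  assumes "even l" "0 < l"
  shows "even (fold_pos l t k + t) = even k"
proof -
  have m: "even (x mod (2 * int l)) = even x" "even (x mod int l) = even x" for x
    using assms by (auto simp: dvd_mod_iff)
  show ?thesis
  proof (cases "t = l")
    case True
    have "int (nat (k mod int l)) = k mod int l" using assms by simp
    then have "even (nat (k mod int l)) = even k" using m(2)[of k] by (metis even_of_nat)
    then show ?thesis using True assms by (simp add: fold_pos_def)
  next
    case False
    define r where "r = min ((k - int t) mod (2 * int l)) ((int t - k) mod (2 * int l))"
    have "0 \<le> r" using assms by (simp add: r_def)
    have "even r = even (k - int t)" unfolding r_def min_def using m(1)[of "k - int t"] m(1)[of "int t - k"] by auto
    then have "even (nat r) = even (k - int t)" using \<open>0 \<le> r\<close> by (simp add: even_nat_iff)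
    moreover have "even (nat r mod l) = even (nat r)" using assms by (auto simp: dvd_mod_iff)
    ultimately show ?thesis using False by (auto simp: fold_pos_def r_def)
  qed
qed

lemma fold_pos_reflect: "t \<noteq> l \<Longrightarrow> fold_pos l t (2 * int t - k) = fold_pos l t k"
  by (simp add: fold_pos_def min.commute)

lemma fold_pos_rotate: "fold_pos l l (k + int l) = fold_pos l l k"
  by (simp add: fold_pos_def)

text \<open>The two turning times t and t + l have circular distance 0 and l from t; the final
  reduction modulo l in \<open>fold_pos\<close> identifies them.\<close>

lemma fold_pos_turn:
  assumes "t \<noteq> l" "int l dvd k - int t"
  shows "fold_pos l t k = 0"
proof -
  define r where "r = min ((k - int t) mod (2 * int l)) ((int t - k) mod (2 * int l))"
  have "int l dvd int t - k" using assms(2) by (metis dvd_minus_iff minus_diff_eq)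
  then have "int l dvd r" using assms(2) unfolding r_def min_def by (simp add: dvd_mod_iff)
  then have "l dvd nat r" by (cases "0 \<le> r") (auto simp flip: int_dvd_int_iff)
  then show ?thesis using assms(1) by (simp add: fold_pos_def r_def)
qed

text \<open>The second visit happens half a period later in a rotation or at a turning time;
  otherwise it is the mirror image 2 t - k, which is a different time because l does not divide k -
  t.\<close>

lemma fold_pos_partner:
  assumes "0 < l"
  shows "\<exists>j. \<not> 2 * int l dvd j - k \<and> fold_pos l t j = fold_pos l t k"
proof -
  have n: "\<not> 2 * int l dvd int l" using assms zdvd_imp_le[of "2 * int l" "int l"] by auto
  consider "t = l" | "t \<noteq> l" "int l dvd k - int t" | "t \<noteq> l" "\<not> int l dvd k - int t" by blast
  then show ?thesis
  proof cases
    case 1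
    then show ?thesis using n by (intro exI[of _ "k + int l"]) (simp add: fold_pos_rotate)
  next
    case 2
    then have "int l dvd (k + int l) - int t" by (metis add_diff_eq diff_add_eq dvd_add dvd_refl)
    then show ?thesis using n 2 by (intro exI[of _ "k + int l"]) (simp add: fold_pos_turn)
  next
    case 3
    have "\<not> 2 * int l dvd (2 * int t - k) - k"
    proof
      assume "2 * int l dvd (2 * int t - k) - k"
      then have "2 * int l dvd 2 * (int t - k)" by (simp add: algebra_simps)
      then have "int l dvd int t - k" by (rule dvd_mult_cancel_left[THEN iffD1, THEN disjE]) auto
      then show False using 3 by (metis dvd_minus_iff minus_diff_eq)
    qed
    then show ?thesis using 3 fold_pos_reflect by blast
  qed
qed

lemma fold_pos_edge_partner:
  assumes "0 < l"
  shows "\<exists>j. \<not> 2 * int l dvd j - k \<and>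
    {fold_pos l t j, fold_pos l t (j + 1)} = {fold_pos l t k, fold_pos l t (k + 1)}"
proof (cases "t = l")
  case True
  have n: "\<not> 2 * int l dvd int l" using assms zdvd_imp_le[of "2 * int l" "int l"] by auto
  have "fold_pos l l (k + int l + 1) = fold_pos l l (k + 1)"
    using fold_pos_rotate[of l "k + 1"] by (simp add: algebra_simps)
  then show ?thesis using n True by (intro exI[of _ "k + int l"]) (simp add: fold_pos_rotate)
next
  case False
  \<comment> \<open>A reflection reverses edges, so the image of the step from k to k + 1 starts at
    2 t - (k + 1). Its distance from k is odd, hence no multiple of 2 l.\<close>
  have "fold_pos l t (2 * int t - 1 - k) = fold_pos l t (k + 1)"
    using fold_pos_reflect[OF False, of "k + 1"] by (simp add: algebra_simps)
  moreover have "fold_pos l t (2 * int t - 1 - k + 1) = fold_pos l t k"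
    using fold_pos_reflect[OF False, of k] by (simp add: algebra_simps)
  moreover have "\<not> 2 * int l dvd 2 * int t - 1 - k - k"
  proof
    assume "2 * int l dvd 2 * int t - 1 - k - k"
    then have "even (2 * int t - 1 - k - k)" by (rule dvd_mult_left)
    then show False by simp
  qed
  ultimately show ?thesis by (intro exI[of _ "2 * int t - 1 - k"]) (simp add: insert_commute)
qed

section \<open>Folded walks are exactly the doubled cycles\<close>

definition fold_walk :: "nat \<Rightarrow> nat \<Rightarrow> 'a list \<Rightarrow> 'a list" where
  "fold_walk l t xs = map (\<lambda>k. xs ! fold_pos l t (int k)) [0..<2 * l + 1]"

lemma length_fold_walk [simp]: "length (fold_walk l t xs) = 2 * l + 1"
  by (simp add: fold_walk_def)

lemma fold_walk_nth: "k \<le> 2 * l \<Longrightarrow> fold_walk l t xs ! k = xs ! fold_pos l t (int k)"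
  unfolding fold_walk_def by (subst nth_map) (auto simp del: upt_Suc)

lemma fold_walk_nth_shift:
  assumes "t \<le> l" "j < l"
  shows "fold_walk l t xs ! (t + j) = xs ! j"
  using fold_walk_nth[of "t + j" l t xs] fold_pos_start[OF assms(2), of t] assms by simp

lemma set_fold_walk:
  assumes "t \<le> l" "0 < l" "length xs = l"
  shows "set (fold_walk l t xs) = set xs"
proof
  show "set (fold_walk l t xs) \<subseteq> set xs"
    using assms fold_pos_less by (auto simp: fold_walk_def simp del: upt_Suc)
  show "set xs \<subseteq> set (fold_walk l t xs)"
  proof
    fix x assume "x \<in> set xs"
    then obtain j where j: "j < l" "x = xs ! j" using assms by (metis in_set_conv_nth)
    then have "x = fold_walk l t xs ! (t + j)" using fold_walk_nth_shift assms by metis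
    then show "x \<in> set (fold_walk l t xs)" using j assms by simp
  qed
qed

lemma hd_last_fold_walk:
  "hd (fold_walk l t xs) = xs ! fold_pos l t 0" "last (fold_walk l t xs) = xs ! fold_pos l t 0"
proof -
  have ne: "fold_walk l t xs \<noteq> []" by (metis length_fold_walk list.size(3) add_is_0 one_neq_zero)
  show "hd (fold_walk l t xs) = xs ! fold_pos l t 0"
    using fold_walk_nth[of 0 l t xs] by (simp add: hd_conv_nth[OF ne])
  have "fold_pos l t (int (2 * l)) = fold_pos l t 0" by (rule fold_pos_cong) simp
  then show "last (fold_walk l t xs) = xs ! fold_pos l t 0"
    using fold_walk_nth[of "2 * l" l t xs] by (simp add: last_conv_nth[OF ne])
qed

lemma count_list_ge_2I':
  assumes "i \<noteq> j" "i < length w" "j < length w" "w ! i = w ! j"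
  shows "2 \<le> count_list w (w ! i)"
  using assms count_list_ge_2I[of i j w] count_list_ge_2I[of j i w] by (cases "i < j") auto

lemma count_list_butlast:
  "w \<noteq> [] \<Longrightarrow> count_list w x = count_list (butlast w) x + (if x = last w then 1 else 0)"
  by (cases w rule: rev_cases) auto

text \<open>Position 0 of the cycle is visited at time t, so it lies on the root side exactly for
  even t; this is the side \<open>\<tau> = even t\<close> on which \<open>xs\<close> starts.\<close>

lemma fold_walk_in_cyclic_core:
  assumes "even l" "0 < l" "t \<le> l" and xs: "xs \<in> alternating_lists N (\<tau> = even t) l"
  shows "fold_walk l t xs \<in> cyclic_core_walks N \<tau> l (l div 2) (l div 2)"
proof -
  define w where "w = fold_walk l t xs"
  have len: "length xs = l" and ty: "\<And>j. j < l \<Longrightarrow> fst (xs ! j) = ((\<tau> = even t) = even j)"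
    and lab: "\<And>x. x \<in> set xs \<Longrightarrow> snd x < N (fst x)" using xs by (auto simp: alternating_lists_def)
  have sw: "set w = set xs" unfolding w_def using assms len by (intro set_fold_walk) auto
  have lw: "length w = 2 * l + 1" by (simp add: w_def)
  have wn: "w ! k = xs ! fold_pos l t (int k)" if "k \<le> 2 * l" for k
    unfolding w_def using that by (rule fold_walk_nth)
  have fw: "fst (w ! k) = (\<tau> = even k)" if "k \<le> 2 * l" for k
  proof -
    have "even (fold_pos l t (int k)) = (even k = even t)"
      using fold_pos_parity[OF assms(1,2), of t "int k"] by auto
    then show ?thesis using ty[OF fold_pos_less[OF assms(2)]] wn[OF that] by auto
  qed
  have hw: "hd w = w ! 0" using lw by (intro hd_conv_nth) auto
  have hl: "hd w = last w" by (simp add: w_def hd_last_fold_walk)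
  have closed: "w \<in> closed_walks N \<tau> l"
    using lw sw lab hl fw[of 0] fw by (auto simp: closed_walks_def successively_conv_nth hw)
  define i where "i k = nat (k mod (2 * int l))" for k
  have ib: "i k < 2 * l" for k
  proof -
    have "k mod (2 * int l) < 2 * int l" using assms by simp
    then show ?thesis using assms by (simp add: i_def nat_less_iff)
  qed
  have id: "2 * int l dvd int (i k) - k" "2 * int l dvd int (Suc (i k)) - (k + 1)" for k
  proof -
    have "int (i k) = k mod (2 * int l)" using assms by (simp add: i_def)
    then show "2 * int l dvd int (i k) - k" by (metis dvd_minus_iff dvd_minus_mod minus_diff_eq)
    then show "2 * int l dvd int (Suc (i k)) - (k + 1)" by simp
  qed
  have ne: "i j \<noteq> k" if "\<not> 2 * int l dvd j - int k" for j k
    using id(1)[of j] that by (metis dvd_minus_iff minus_diff_eq)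
  have wi: "w ! i k = xs ! fold_pos l t k" "w ! Suc (i k) = xs ! fold_pos l t (k + 1)" for k
    using wn[of "i k"] wn[of "Suc (i k)"] ib[of k] fold_pos_cong[OF id(1)[of k], of t] fold_pos_cong[OF id(2)[of k], of t]
    by auto
  have two: "\<exists>j<2 * l. j \<noteq> k \<and> w ! j = w ! k" if "k < 2 * l" for k
  proof -
    obtain j where "\<not> 2 * int l dvd j - int k" "fold_pos l t j = fold_pos l t (int k)"
      using fold_pos_partner[OF assms(2)] by blast
    then show ?thesis using ne ib wi(1)[of j] wn[of k] that by (intro exI[of _ "i j"]) auto
  qed
  have "2 \<le> count_list w x" if x: "x \<in> set w" for x
  proof -
    obtain k where k: "k < 2 * l + 1" "x = w ! k" using x by (auto simp: in_set_conv_nth lw)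
    define k' where "k' = (if k = 2 * l then 0 else k)"
    have "fold_pos l t (int (2 * l)) = fold_pos l t (int 0)" by (rule fold_pos_cong) simp
    then have "w ! (2 * l) = w ! 0" using wn[of 0] wn[of "2 * l"] by simp
    then have k': "k' < 2 * l" "x = w ! k'" using k assms(2) by (auto simp: k'_def)
    then obtain j where "j < 2 * l" "j \<noteq> k'" "w ! j = w ! k'" using two by blast
    then show ?thesis using k' lw count_list_ge_2I'[of k' j w] by simp
  qed
  moreover have "doubled w" unfolding doubled_def
  proof
    fix e assume "e \<in> set (edges w)"
    then obtain k where k: "k < 2 * l" "e = edges w ! k"
      by (auto simp: in_set_conv_nth length_edges lw)
    obtain j where j: "\<not> 2 * int l dvd j - int k"
      "{fold_pos l t j, fold_pos l t (j + 1)} = {fold_pos l t (int k), fold_pos l t (int k + 1)}"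
      using fold_pos_edge_partner[OF assms(2)] by blast
    have "edges w ! i j = (!) xs ` {fold_pos l t j, fold_pos l t (j + 1)}"
      using nth_edges[of "i j" w] ib[of j] wi[of j] lw by simp
    also have "\<dots> = edges w ! k" unfolding j(2)
      using nth_edges[of k w] wn[of k] wn[of "Suc k"] k lw by (simp add: add.commute)
    finally have ee: "edges w ! i j = edges w ! k" .
    then have "2 \<le> count_list (edges w) (edges w ! i j)"
      using ne[OF j(1)] ib[of j] k by (intro count_list_ge_2I'[of _ k]) (auto simp: length_edges lw)
    then show "count_list (edges w) e \<noteq> 1" using ee k by simp
  qed
  moreover have "3 \<le> count_list w (hd w)"
  proof -
    obtain j where j: "j < 2 * l" "j \<noteq> 0" "w ! j = w ! 0" using two[of 0] assms(2) by auto
    have "w \<noteq> []" using lw by auto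
    then have "count_list w (hd w) = count_list (butlast w) (hd w) + 1"
      using count_list_butlast[of w "hd w"] hl by simp
    moreover have "2 \<le> count_list (butlast w) (butlast w ! 0)"
      using j lw by (intro count_list_ge_2I'[of _ j]) (auto simp: nth_butlast)
    ultimately show ?thesis using hw lw assms(2) by (simp add: nth_butlast)
  qed
  moreover have "num_of s w = l div 2" for s
  proof -
    have "num_of s w = num_of s xs" by (simp add: num_of_def sw)
    moreover have "(l + 1) div 2 = l div 2" using assms(1) by (auto elim: evenE)
    ultimately show ?thesis using num_of_alternating_lists[OF xs] by (cases "s = (\<tau> = even t)") auto
  qed
  ultimately show ?thesis using closed by (simp add: cyclic_core_walks_def core_walks_def w_def)
qed

text \<open>By \<open>rotation_or_reflection\<close> the l entries from time t on determine the
  whole walk. They contain all l vertices of the walk and are therefore distinct.\<close>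

lemma cyclic_core_imp_fold_walk:
  assumes w: "w \<in> cyclic_core_walks N \<tau> l b c" and bc: "b + c = l" and l: "2 \<le> l"
  shows "even l \<and> (\<exists>t\<le>l. \<exists>xs\<in>alternating_lists N (\<tau> = even t) l. w = fold_walk l t xs)"
proof -
  interpret doubled_cycle "unroll w" l by (rule doubled_cycle_unroll[OF w bc l])
  let ?v = "unroll w"
  have cl: "w \<in> closed_walks N \<tau> l" and card: "card (set w) = l"
    using w num_of_add[of \<tau> w] bc by (auto simp: cyclic_core_walks_def core_walks_def)
  have len: "length w = 2 * l + 1" and hl: "hd w = last w" using cl by (auto simp: closed_walks_def)
  have un: "?v (int k) = w ! k" if "k \<le> 2 * l" for k
    using that len hl l by (intro unroll_nth) auto
  \<comment> \<open>For a rotation the witness is l, the value that \<open>fold_pos\<close> reserves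
    for this shape; for a reflection it is the centre t < l.\<close>
  have "\<exists>t\<le>l. \<forall>k. ?v k = ?v (int t + int (fold_pos l t k))"
    using rotation_or_reflection
  proof
    assume rot: "\<forall>k. ?v (k + int l) = ?v k"
    have "?v k = ?v (int l + int (fold_pos l l k))" for k
    proof -
      have m: "int (fold_pos l l k) = k mod int l" using l by (simp add: fold_pos_def)
      have e: "?v (k + int l) = ?v k" for k using rot by blast
      obtain q where q: "k = k mod int l + int l * q" by (metis mod_mult_div_eq)
      have "?v (a + int l * q) = ?v a" for a q
      proof (induction q rule: int_induct[where k = 0])
        case (step1 i)
        then show ?case using e[of "a + int l * i"] by (simp add: algebra_simps)
      next
        case (step2 i)
        then show ?case using e[of "a + int l * (i - 1)"] by (simp add: algebra_simps)
      qed simp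
      then have "?v k = ?v (k mod int l)" using q by metis
      then show ?thesis using e[of "k mod int l"] m by (simp add: add.commute)
    qed
    then show ?thesis by blast
  next
    assume "\<exists>t<l. (\<forall>k. ?v (int t + k) = ?v (int t - k)) \<and> ?v (int t + int l) = ?v (int t)"
    then obtain t where t: "t < l" "\<And>k. ?v (int t + k) = ?v (int t - k)" "?v (int t + int l) = ?v (int t)" by blast
    have "?v k = ?v (int t + int (fold_pos l t k))" for k
    proof -
      define r where "r = (k - int t) mod (2 * int l)"
      have r: "0 \<le> r" "r < 2 * int l" using l by (auto simp: r_def)
      have "2 * int l dvd (k - int t) - r" by (simp add: r_def dvd_minus_mod)
      then have d: "2 * int l dvd k - (int t + r)" by (simp add: algebra_simps)
      then have vk: "?v k = ?v (int t + r)" by (rule period_cong0)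
      have fp: "fold_pos l t k = fold_pos l t (int t + r)" using d by (rule fold_pos_cong)
      consider "r < int l" | "r = int l" | "int l < r" by linarith
      then show ?thesis
      proof cases
        case 1
        then have "fold_pos l t (int t + r) = nat r" using fold_pos_start[of "nat r" l t] r by simp
        then show ?thesis using vk fp r by simp
      next
        case 2
        then have "fold_pos l t (int t + r) = 0" using t(1) by (intro fold_pos_turn) auto
        then show ?thesis using vk fp 2 t(3) by simp
      next
        case 3
        have "fold_pos l t (int t + r) = fold_pos l t (int t - r)"
          using fold_pos_reflect[of t l "int t + r"] t(1) by (simp add: algebra_simps)
        also have "\<dots> = fold_pos l t (int t + (2 * int l - r))" by (rule fold_pos_cong) simp
        also have "\<dots> = nat (2 * int l - r)" using fold_pos_start[of "nat (2 * int l - r)" l t] r 3 by simp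
        finally have "int t + int (fold_pos l t k) = int t - r + 2 * int l" using fp r by simp
        then show ?thesis using vk t(2)[of r] periodic[of "int t - r"] by metis
      qed
    qed
    then show ?thesis using t(1) by (meson less_imp_le)
  qed
  then obtain t where t: "t \<le> l" "\<And>k. ?v k = ?v (int t + int (fold_pos l t k))" by blast
  define xs where "xs = map (\<lambda>j. w ! (t + j)) [0..<l]"
  have xn: "xs ! j = w ! (t + j)" if "j < l" for j using that by (simp add: xs_def)
  have lx: "length xs = l" by (simp add: xs_def)
  have wf: "w = fold_walk l t xs"
  proof (rule nth_equalityI)
    show "length w = length (fold_walk l t xs)" by (simp add: len)
    fix k assume "k < length w"
    then have k: "k \<le> 2 * l" using len by simp
    have f: "fold_pos l t (int k) < l" using l by (intro fold_pos_less) simp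
    have "w ! k = ?v (int (t + fold_pos l t (int k)))" using un[OF k] t(2)[of "int k"] by simp
    also have "\<dots> = w ! (t + fold_pos l t (int k))" using f t(1) by (intro un) simp
    finally show "w ! k = fold_walk l t xs ! k" using fold_walk_nth[OF k, of t xs] xn[OF f] by simp
  qed
  have sx: "set w = set xs" unfolding wf using t(1) lx l by (intro set_fold_walk) auto
  have "distinct xs" using card lx sx by (intro card_distinct) simp
  moreover have "fst (xs ! j) = ((\<tau> = even t) = even j)" if "j < l" for j
    using closed_walks_fst_nth[OF cl, of "t + j"] that t(1) xn[OF that] by auto
  moreover have "\<forall>x\<in>set xs. snd x < N (fst x)" using cl sx by (simp add: closed_walks_def)
  ultimately have "xs \<in> alternating_lists N (\<tau> = even t) l" using lx by (simp add: alternating_lists_def)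
  then show ?thesis using even_length t(1) wf by blast
qed

section \<open>Distinct shapes give distinct walks\<close>

context doubled_cycle
begin

text \<open>The second mirror makes b + 1 and b - 1 visits of one vertex, and the first adds 2 a - b
  - 1. As two of these three agree modulo 2 l, either l divides a - b or it divides b - a + 1. With
  the roles exchanged, l would also divide a - b + 1, hence the sum 2.\<close>

lemma two_reflections:
  assumes l: "3 \<le> l" and s: "\<And>k. v (2 * s - k) = v k" and t: "\<And>k. v (2 * t - k) = v k"
  shows "int l dvd s - t"
proof (rule ccontr)
  assume n: "\<not> int l dvd s - t"
  have aux: "int l dvd a - b \<or> int l dvd b - a + 1"
    if a: "\<And>k. v (2 * a - k) = v k" and b: "\<And>k. v (2 * b - k) = v k" for a b
  proof -
    have "v (b + 1) = v (b - 1)" using b[of "b - 1"] by simp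
    moreover have "v (b + 1) = v (2 * a - (b + 1))" using a[of "b + 1"] by simp
    ultimately have "2 * int l dvd (b + 1) - (b - 1) \<or> 2 * int l dvd (b + 1) - (2 * a - (b + 1))
      \<or> 2 * int l dvd (b - 1) - (2 * a - (b + 1))" by (rule at_most_twice)
    moreover have "\<not> 2 * int l dvd (b + 1) - (b - 1)" using small_multiple[of 2] l by auto
    moreover have "(b + 1) - (2 * a - (b + 1)) = 2 * (b - a + 1)" "(b - 1) - (2 * a - (b + 1)) = 2 * (b - a)" by auto
    ultimately have "2 * int l dvd 2 * (b - a + 1) \<or> 2 * int l dvd 2 * (b - a)" by metis
    then have "int l dvd b - a + 1 \<or> int l dvd b - a" by (metis dvd_mult_cancel_left zero_neq_numeral)
    then show ?thesis by (metis dvd_minus_iff minus_diff_eq)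
  qed
  have "int l dvd t - s + 1" "int l dvd s - t + 1"
    using aux[OF s t] aux[OF t s] n by (metis dvd_minus_iff minus_diff_eq)+
  then have "int l dvd (t - s + 1) + (s - t + 1)" by (rule dvd_add)
  then have "int l dvd 2" by simp
  then show False using l zdvd_imp_le[of "int l" 2] by simp
qed

text \<open>Otherwise s - 1, s + 1 and s + 1 + l would be three visits of one vertex.\<close>

lemma reflection_not_rotation:
  assumes l: "3 \<le> l" and s: "\<And>k. v (2 * s - k) = v k" and r: "\<And>k. v (k + int l) = v k"
  shows False
proof -
  have "v (s + 1) = v (s - 1)" using s[of "s - 1"] by simp
  moreover have "v (s + 1) = v (s + 1 + int l)" using r[of "s + 1"] by simp
  ultimately have "2 * int l dvd (s + 1) - (s - 1) \<or> 2 * int l dvd (s + 1) - (s + 1 + int l)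
    \<or> 2 * int l dvd (s - 1) - (s + 1 + int l)" by (rule at_most_twice)
  then show False using small_multiple[of 2] small_multiple[of "- int l"] small_multiple[of "- 2 - int l"] l by auto
qed

end

lemma unroll_fold_walk:
  assumes "0 < l"
  shows "unroll (fold_walk l t xs) k = xs ! fold_pos l t k"
proof -
  define i where "i = nat (k mod (2 * int l))"
  have "k mod (2 * int l) < 2 * int l" using assms by simp
  then have ib: "i < 2 * l" using assms by (simp add: i_def nat_less_iff)
  have "int i = k mod (2 * int l)" using assms by (simp add: i_def)
  then have "2 * int l dvd int i - k" by (metis dvd_minus_iff dvd_minus_mod minus_diff_eq)
  then have "fold_pos l t (int i) = fold_pos l t k" by (rule fold_pos_cong)
  then show ?thesis using ib fold_walk_nth[of i l t xs] by (simp add: unroll_def i_def)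
qed

lemma fold_walk_shape_unique:
  assumes l: "3 \<le> l" and t: "t \<le> l" "t' \<le> l" and w: "fold_walk l t xs = fold_walk l t' xs'"
    and c: "doubled_cycle (unroll (fold_walk l t xs)) l"
  shows "t = t'"
proof -
  interpret doubled_cycle "unroll (fold_walk l t xs)" l by (rule c)
  let ?v = "unroll (fold_walk l t xs)"
  have v1: "?v k = xs ! fold_pos l t k" for k using l by (intro unroll_fold_walk) simp
  have v2: "?v k = xs' ! fold_pos l t' k" for k unfolding w using l by (intro unroll_fold_walk) simp
  have refl: "?v (2 * int s - k) = ?v k" if "s = t \<or> s = t'" "s \<noteq> l" for s k
    using that v1 v2 fold_pos_reflect by metis
  have rot: "?v (k + int l) = ?v k" if "t = l \<or> t' = l" for k
    using that v1 v2 fold_pos_rotate by metis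
  show ?thesis
  proof (cases "t = l \<or> t' = l")
    case True
    then show ?thesis
      using reflection_not_rotation[OF l refl rot] by blast
  next
    case False
    then have "int l dvd int t - int t'" using refl by (intro two_reflections[OF l]) auto
    moreover have "\<bar>int t - int t'\<bar> < int l" using False t by linarith
    ultimately show ?thesis using dvd_imp_le_int[of "int t - int t'" "int l"] by auto
  qed
qed

definition core_coeff :: "(nat \<Rightarrow> real) \<Rightarrow> nat \<Rightarrow> real" where
  "core_coeff \<mu> m = (if m = 1 then \<mu> 4 else 2 * real m + 1)"

lemma inj_on_fold_walk: "t \<le> l \<Longrightarrow> inj_on (fold_walk l t) (alternating_lists N \<sigma> l)"
proof (rule inj_onI)
  fix xs ys assume t: "t \<le> l" and xy: "xs \<in> alternating_lists N \<sigma> l" "ys \<in> alternating_lists N \<sigma> l"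
    "fold_walk l t xs = fold_walk l t ys"
  show "xs = ys"
  proof (rule nth_equalityI)
    show "length xs = length ys" using xy by (simp add: alternating_lists_def)
    fix j assume "j < length xs"
    then have "j < l" using xy by (simp add: alternating_lists_def)
    then show "xs ! j = ys ! j" using fold_walk_nth_shift[OF t, of j xs] fold_walk_nth_shift[OF t, of j ys] xy(3) by simp
  qed
qed

lemma cyclic_core_walks_eq:
  assumes "b + c = l" "2 \<le> l"
  shows "cyclic_core_walks N \<tau> l b c = (if even l \<and> b = l div 2
    then (\<Union>t\<le>l. fold_walk l t ` alternating_lists N (\<tau> = even t) l) else {})"
proof -
  have "w \<in> cyclic_core_walks N \<tau> l b c \<longleftrightarrow> even l \<and> b = l div 2 \<and>
     (\<exists>t\<le>l. \<exists>xs\<in>alternating_lists N (\<tau> = even t) l. w = fold_walk l t xs)" (is "?L \<longleftrightarrow> ?R") for w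
  proof
    assume L: ?L
    then have R: "even l" "\<exists>t\<le>l. \<exists>xs\<in>alternating_lists N (\<tau> = even t) l. w = fold_walk l t xs"
      using cyclic_core_imp_fold_walk[OF L assms] by auto
    then have "w \<in> cyclic_core_walks N \<tau> l (l div 2) (l div 2)"
      using fold_walk_in_cyclic_core[OF R(1)] assms(2) by auto
    then have "b = l div 2" using L by (simp add: cyclic_core_walks_def core_walks_def)
    then show ?R using R by blast
  next
    assume R: ?R
    then have "c = l div 2" using assms(1) by auto
    then show ?L using fold_walk_in_cyclic_core[of l] R assms(2) by auto
  qed
  then have iff: "cyclic_core_walks N \<tau> l b c = {w. even l \<and> b = l div 2 \<and>
     (\<exists>t\<le>l. \<exists>xs\<in>alternating_lists N (\<tau> = even t) l. w = fold_walk l t xs)}" by blast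
  show ?thesis
  proof (cases "even l \<and> b = l div 2")
    case True
    then have "cyclic_core_walks N \<tau> l b c = (\<Union>t\<le>l. fold_walk l t ` alternating_lists N (\<tau> = even t) l)"
      unfolding iff by blast
    then show ?thesis using True by simp
  next
    case False
    then have "cyclic_core_walks N \<tau> l b c = {}" unfolding iff by blast
    then show ?thesis using False by (simp only: if_False)
  qed
qed

lemma card_alternating_lists_even:
  assumes "even l"
  shows "real (card (alternating_lists N \<sigma> l)) = falling (N \<tau>) (l div 2) * falling (N (\<not> \<tau>)) (l div 2)"
proof -
  have "(l + 1) div 2 = l div 2" using assms by (auto elim: evenE)
  then show ?thesis unfolding card_alternating_lists by (cases "\<sigma> = \<tau>") auto
qed

text \<open>The l + 1 shapes t give disjoint families, each in bijection with the alternating lists,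
  and every walk has weight 1; disjointness and weight both rely on \<open>3 \<le> l\<close>. With l
  = 2 m the number of shapes is the \<open>2 * real m + 1\<close> of
  \<open>core_coeff\<close>.\<close>

lemma sum_cyclic_core_ge_3:
  assumes bc: "b + c = l" and l: "3 \<le> l" and \<mu>: "\<mu> 2 = 1"
  shows "(\<Sum>w\<in>cyclic_core_walks N \<tau> l b c. edge_weight \<mu> w) =
    (if even l \<and> b = l div 2 then falling (N \<tau>) b * falling (N (\<not> \<tau>)) c * core_coeff \<mu> (l div 2) else 0)"
proof -
  have l2: "2 \<le> l" using l by simp
  have "(\<Sum>w\<in>cyclic_core_walks N \<tau> l b c. edge_weight \<mu> w) = real (card (cyclic_core_walks N \<tau> l b c))"
    using edge_weight_cyclic_core[where \<mu> = \<mu>, OF _ bc l \<mu>] by simp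
  also have "\<dots> = (if even l \<and> b = l div 2 then falling (N \<tau>) b * falling (N (\<not> \<tau>)) c * core_coeff \<mu> (l div 2) else 0)"
  proof (cases "even l \<and> b = l div 2")
    case False
    then show ?thesis using cyclic_core_walks_eq[OF bc l2, of N \<tau>] by (simp only: if_False card.empty of_nat_0)
  next
    case True
    let ?I = "\<lambda>t. fold_walk l t ` alternating_lists N (\<tau> = even t) l"
    have "card (\<Union>t\<in>{..l}. ?I t) = (\<Sum>t\<in>{..l}. card (?I t))"
    proof (rule card_UN_disjoint)
      show "\<forall>t\<in>{..l}. finite (?I t)" by (simp add: finite_alternating_lists)
      show "\<forall>t\<in>{..l}. \<forall>t'\<in>{..l}. t \<noteq> t' \<longrightarrow> ?I t \<inter> ?I t' = {}"
      proof (intro ballI impI, rule ccontr)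
        fix t t' assume tt: "t \<in> {..l}" "t' \<in> {..l}" "t \<noteq> t'" "?I t \<inter> ?I t' \<noteq> {}"
        then obtain xs ys where xy: "xs \<in> alternating_lists N (\<tau> = even t) l" "fold_walk l t xs = fold_walk l t' ys" by auto
        have "fold_walk l t xs \<in> cyclic_core_walks N \<tau> l (l div 2) (l div 2)"
          using True tt xy l by (intro fold_walk_in_cyclic_core) auto
        then have "doubled_cycle (unroll (fold_walk l t xs)) l"
          by (rule doubled_cycle_unroll) (use True l in auto)
        then show False using fold_walk_shape_unique[OF l _ _ xy(2)] tt by auto
      qed
    qed simp
    also have "real \<dots> = (\<Sum>t\<in>{..l}. falling (N \<tau>) (l div 2) * falling (N (\<not> \<tau>)) (l div 2))"
      unfolding of_nat_sum
    proof (rule sum.cong[OF refl])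
      fix t assume "t \<in> {..l}"
      then have "card (?I t) = card (alternating_lists N (\<tau> = even t) l)" by (intro card_image inj_on_fold_walk) simp
      then show "real (card (?I t)) = falling (N \<tau>) (l div 2) * falling (N (\<not> \<tau>)) (l div 2)"
        using card_alternating_lists_even[of l N _ \<tau>] True by simp
    qed
    also have "\<dots> = falling (N \<tau>) b * falling (N (\<not> \<tau>)) c * core_coeff \<mu> (l div 2)"
    proof -
      have "c = l div 2" "l div 2 \<noteq> 1" "2 * real (l div 2) = real l" using True bc l by (auto elim!: evenE)
      then show ?thesis using True by (simp add: core_coeff_def)
    qed
    finally show ?thesis using cyclic_core_walks_eq[OF bc l2, of N \<tau>] True by simp
  qed
  finally show ?thesis .
qed

section \<open>The degenerate cycle: one edge of multiplicity four\<close>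

lemma fold_walk_2: 
  "fold_walk 2 0 [x, y] = [x, y, x, y, x]" "fold_walk 2 1 [x, y] = [y, x, y, x, y]" "fold_walk 2 2 [x, y] = [x, y, x, y, x]"
  by (simp_all add: fold_walk_def fold_pos_def upt_rec eval_nat_numeral)

text \<open>All three shapes yield walks of the form x, y, x, y, x, so the union collapses to one
  family; turning at time 1 merely swaps the two entries of the list.\<close>

lemma cyclic_core_walks_2:
  "cyclic_core_walks N \<tau> 2 1 1 = (\<lambda>xs. [xs ! 0, xs ! 1, xs ! 0, xs ! 1, xs ! 0]) ` alternating_lists N \<tau> 2"
proof -
  let ?g = "\<lambda>xs::vertex list. [xs ! 0, xs ! 1, xs ! 0, xs ! 1, xs ! 0]"
  have ex: "\<exists>x y. xs = [x, y]" if "xs \<in> alternating_lists N \<sigma> 2" for xs \<sigma>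
    using that by (auto simp: alternating_lists_def length_Suc_conv numeral_2_eq_2)
  have I: "fold_walk 2 0 ` alternating_lists N \<tau> 2 = ?g ` alternating_lists N \<tau> 2"
      "fold_walk 2 2 ` alternating_lists N \<tau> 2 = ?g ` alternating_lists N \<tau> 2"
    using ex fold_walk_2 by (force intro!: image_cong)+
  have "fold_walk 2 1 ` alternating_lists N (\<not> \<tau>) 2 \<subseteq> ?g ` alternating_lists N \<tau> 2"
  proof
    fix w assume "w \<in> fold_walk 2 1 ` alternating_lists N (\<not> \<tau>) 2"
    then obtain xs where xs: "xs \<in> alternating_lists N (\<not> \<tau>) 2" "w = fold_walk 2 1 xs" by auto
    then obtain x y where xy: "xs = [x, y]" using ex by blast
    have "[y, x] \<in> alternating_lists N \<tau> 2" using xs(1)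
      unfolding xy by (auto simp: alternating_lists_def less_Suc_eq numeral_2_eq_2)
    then show "w \<in> ?g ` alternating_lists N \<tau> 2" using xs(2) fold_walk_2(2)[of x y] by (force simp: xy)
  qed
  moreover have "{..2::nat} = {0, 1, 2}" by auto
  ultimately show ?thesis using cyclic_core_walks_eq[of 1 1 2 N \<tau>] I by auto
qed

lemma sum_cyclic_core_2:
  "(\<Sum>w\<in>cyclic_core_walks N \<tau> 2 1 1. edge_weight \<mu> w) = falling (N \<tau>) 1 * falling (N (\<not> \<tau>)) 1 * \<mu> 4"
proof -
  let ?g = "\<lambda>xs::vertex list. [xs ! 0, xs ! 1, xs ! 0, xs ! 1, xs ! 0]"
  have inj: "inj_on ?g (alternating_lists N \<tau> 2)"
    by (auto simp: inj_on_def alternating_lists_def numeral_2_eq_2 length_Suc_conv)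
  have wt: "edge_weight \<mu> (?g xs) = \<mu> 4" for xs
  proof -
    have "edges (?g xs) = replicate 4 {xs ! 0, xs ! 1}" by (simp add: eval_nat_numeral insert_commute)
    then show ?thesis by (simp add: edge_weight_def count_list_eq_length_filter eval_nat_numeral)
  qed
  have "(\<Sum>w\<in>cyclic_core_walks N \<tau> 2 1 1. edge_weight \<mu> w) = real (card (alternating_lists N \<tau> 2)) * \<mu> 4"
    unfolding cyclic_core_walks_2 sum.reindex[OF inj] comp_def wt by simp
  then show ?thesis using card_alternating_lists[of N \<tau> 2] by simp
qed

lemma sum_cyclic_core:
  assumes bc: "b + c = l" and l: "2 \<le> l" and \<mu>: "\<mu> 2 = 1"
  shows "(\<Sum>w\<in>cyclic_core_walks N \<tau> l b c. edge_weight \<mu> w) =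
    (if even l \<and> b = l div 2 then falling (N \<tau>) b * falling (N (\<not> \<tau>)) c * core_coeff \<mu> (l div 2) else 0)"
proof (cases "l = 2")
  case False
  then show ?thesis using sum_cyclic_core_ge_3[where \<mu> = \<mu>, OF bc _ \<mu>] l by simp
next
  case True
  show ?thesis
  proof (cases "b = 1")
    case b: True
    then have "c = 1" using bc True by simp
    then show ?thesis using sum_cyclic_core_2[of \<mu> N \<tau>] b True by (simp add: core_coeff_def)
  next
    case False
    then show ?thesis using cyclic_core_walks_eq[OF bc l, of N \<tau>] True by simp
  qed
qed

section \<open>Summation over all leafless walks with maximally many vertices\<close>

lemma edge_weight_wrap:
  assumes "\<mu> 2 = (1::real)" "v \<noteq> []" "hd v = last v" "r \<notin> set v"
  shows "edge_weight \<mu> (r # v @ [r]) = edge_weight \<mu> v"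
proof (rule edge_weight_new_double_edge[where \<mu> = \<mu> and f = "{r, hd v}", OF assms(1)])
  show "{r, hd v} \<notin> set (edges v)" using assms(4) edges_subset[of "{r, hd v}" v] by blast
  show "count_list (edges (r # v @ [r])) e = count_list (edges v) e + (if e = {r, hd v} then 2 else 0)" for e
    unfolding edges_wrap[OF assms(2)] using assms(3) by (auto simp: insert_commute)
qed

lemma closed_walks_num_of_pos:
  assumes "w \<in> closed_walks N \<tau> l"
  shows "0 < num_of \<tau> w" "0 < l \<Longrightarrow> 0 < num_of (\<not> \<tau>) w"
proof -
  have len: "length w = 2 * l + 1" using assms by (simp add: closed_walks_def)
  have "w ! 0 \<in> {x \<in> set w. fst x = \<tau>}" using len closed_walks_fst_nth[OF assms, of 0] by simp
  then show "0 < num_of \<tau> w" unfolding num_of_def card_gt_0_iff by (intro conjI; (blast | simp))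
  assume "0 < l"
  then have "w ! 1 \<in> {x \<in> set w. fst x = (\<not> \<tau>)}" using len closed_walks_fst_nth[OF assms, of 1] by simp
  then show "0 < num_of (\<not> \<tau>) w" unfolding num_of_def card_gt_0_iff by (intro conjI; (blast | simp))
qed

lemma sum_core_walks_Suc:
  assumes "\<mu> 2 = 1"
  shows "(\<Sum>w\<in>core_walks N \<tau> (Suc l) (Suc b) c. edge_weight \<mu> w) =
    (\<Sum>w\<in>cyclic_core_walks N \<tau> (Suc l) (Suc b) c. edge_weight \<mu> w) +
    (real (N \<tau>) - real b) * (\<Sum>w\<in>core_walks N (\<not> \<tau>) l c b. edge_weight \<mu> w)"
proof -
  define A where "A = {w \<in> core_walks N \<tau> (Suc l) (Suc b) c. \<not> 3 \<le> count_list w (hd w)}"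
  define T where "T = (SIGMA v:core_walks N (\<not> \<tau>) l c b. {x. fst x = \<tau> \<and> snd x < N \<tau> \<and> x \<notin> set v})"
  have "core_walks N \<tau> (Suc l) (Suc b) c = cyclic_core_walks N \<tau> (Suc l) (Suc b) c \<union> A"
    "cyclic_core_walks N \<tau> (Suc l) (Suc b) c \<inter> A = {}" by (auto simp: A_def cyclic_core_walks_def)
  then have split: "(\<Sum>w\<in>core_walks N \<tau> (Suc l) (Suc b) c. edge_weight \<mu> w) =
    (\<Sum>w\<in>cyclic_core_walks N \<tau> (Suc l) (Suc b) c. edge_weight \<mu> w) + sum (edge_weight \<mu>) A"
    using finite_core_walks by (metis finite_Un sum.union_disjoint)
  have A: "A = (\<lambda>(v, r). r # v @ [r]) ` T" unfolding A_def T_def by (rule core_walks_strip_root)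
  have inj: "inj_on (\<lambda>(v, r). r # v @ [r]) T" by (auto simp: inj_on_def)
  have vfacts: "v \<noteq> []" "hd v = last v" if "v \<in> core_walks N (\<not> \<tau>) l c b" for v
    using that by (auto simp: core_walks_def closed_walks_def)
  have "sum (edge_weight \<mu>) A = (\<Sum>(v, r)\<in>T. edge_weight \<mu> (r # v @ [r]))"
    unfolding A sum.reindex[OF inj] by (simp add: case_prod_unfold comp_def)
  also have "\<dots> = (\<Sum>(v, r)\<in>T. edge_weight \<mu> v)"
    using assms vfacts by (intro sum.cong refl) (auto simp: T_def intro!: edge_weight_wrap)
  also have "\<dots> = (\<Sum>v\<in>core_walks N (\<not> \<tau>) l c b. \<Sum>x\<in>{x. fst x = \<tau> \<and> snd x < N \<tau> \<and> x \<notin> set v}. edge_weight \<mu> v)"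
    unfolding T_def by (rule sum.Sigma[symmetric]) (auto simp: finite_core_walks finite_fresh)
  also have "\<dots> = (\<Sum>v\<in>core_walks N (\<not> \<tau>) l c b. (real (N \<tau>) - real b) * edge_weight \<mu> v)"
  proof (rule sum.cong[OF refl])
    fix v assume v: "v \<in> core_walks N (\<not> \<tau>) l c b"
    then have "\<forall>x\<in>set v. snd x < N (fst x)" "num_of \<tau> v = b" by (auto simp: core_walks_def closed_walks_def)
    then show "(\<Sum>x\<in>{x. fst x = \<tau> \<and> snd x < N \<tau> \<and> x \<notin> set v}. edge_weight \<mu> v) = (real (N \<tau>) - real b) * edge_weight \<mu> v"
      using card_fresh[of v N \<tau>] by (simp add: of_nat_diff)
  qed
  finally show ?thesis using split by (simp only: sum_distrib_left)
qed

text \<open>Stripping swaps the sides at each step and stops once the root lies on the cycle, which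
  has equally many vertices on both sides; so the root side has as many vertices as the other one,
  or one more. The recursion on l meets one new cycle at each even length, whence the range of
  m.\<close>

lemma sum_core_walks:
  assumes "\<mu> 2 = 1" "b + c = l" "1 \<le> l"
  shows "(\<Sum>w\<in>core_walks N \<tau> l b c. edge_weight \<mu> w) =
    (if b = (l + 1) div 2 then falling (N \<tau>) b * falling (N (\<not> \<tau>)) c * (\<Sum>m = 1..l div 2. core_coeff \<mu> m) else 0)"
  using assms(2,3)
proof (induction l arbitrary: \<tau> b c)
  case (Suc l)
  show ?case
  proof (cases "l = 0 \<or> b = 0")
    case True
    have "core_walks N \<tau> (Suc l) b c = {}"
    proof (rule equals0I)
      fix w assume "w \<in> core_walks N \<tau> (Suc l) b c"
      then have "w \<in> closed_walks N \<tau> (Suc l)" "num_of \<tau> w = b" "num_of (\<not> \<tau>) w = c"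
        by (auto simp: core_walks_def)
      then have "0 < b" "0 < c" using closed_walks_num_of_pos by blast+
      then show False using True Suc.prems by auto
    qed
    then show ?thesis using True by auto
  next
    case False
    then obtain b' where b: "b = Suc b'" by (cases b) auto
    have IH: "(\<Sum>w\<in>core_walks N (\<not> \<tau>) l c b'. edge_weight \<mu> w) =
      (if c = (l + 1) div 2 then falling (N (\<not> \<tau>)) c * falling (N \<tau>) b' * (\<Sum>m = 1..l div 2. core_coeff \<mu> m) else 0)"
      using Suc.IH[of c b' "\<not> \<tau>"] Suc.prems False b by simp
    have cyc: "(\<Sum>w\<in>cyclic_core_walks N \<tau> (Suc l) (Suc b') c. edge_weight \<mu> w) =
      (if even (Suc l) \<and> Suc b' = Suc l div 2 then falling (N \<tau>) (Suc b') * falling (N (\<not> \<tau>)) c * core_coeff \<mu> (Suc l div 2) else 0)"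
      by (rule sum_cyclic_core[where \<mu> = \<mu>, OF _ _ assms(1)]) (use Suc.prems False b in simp_all)
    have e: "c = (l + 1) div 2 \<longleftrightarrow> b = (Suc l + 1) div 2" 
    proof -
      have l: "l = b' + c" using Suc.prems b by simp
      show ?thesis unfolding l b by auto
    qed
    have S: "(\<Sum>m = 1..Suc l div 2. core_coeff \<mu> m) =
        (if even (Suc l) then core_coeff \<mu> (Suc l div 2) else 0) + (\<Sum>m = 1..l div 2. core_coeff \<mu> m)"
    proof (cases "even (Suc l)")
      case True
      then have "Suc l div 2 = Suc (l div 2)" by presburger
      then show ?thesis using True by simp
    next
      case odd: False
      then have "Suc l div 2 = l div 2" by presburger
      then show ?thesis using odd by simp
    qed
    have e': "even (Suc l) \<and> Suc b' = Suc l div 2 \<longleftrightarrow> even (Suc l) \<and> b = (Suc l + 1) div 2"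
      unfolding b by auto
    show ?thesis
      unfolding b sum_core_walks_Suc[where \<mu> = \<mu>, OF assms(1)] IH cyc e' e S
      by (cases "b = (Suc l + 1) div 2"; cases "even (Suc l)")
        (simp_all add: b falling_Suc algebra_simps)
  qed
qed simp

section \<open>Closed forms at first and second order\<close>

lemma late_sum_eq_0:
  assumes "b = 0 \<or> c = 0" "1 \<le> l"
  shows "late_sum \<mu> N \<tau> l b c a = 0"
proof -
  have "late_walks N \<tau> l b c a = {}"
  proof (rule equals0I)
    fix w assume "w \<in> late_walks N \<tau> l b c a"
    then have "w \<in> closed_walks N \<tau> l" "num_of \<tau> w = b" "num_of (\<not> \<tau>) w = c" by (auto simp: late_walks_def)
    then show False using closed_walks_num_of_pos[of w N \<tau> l] assms by auto
  qed
  then show ?thesis by (simp add: late_sum_def)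
qed

lemma late_sum_from_0: "late_sum \<mu> N \<tau> l b c 0 = late_sum \<mu> N \<tau> l b c 1"
proof -
  have "late_walks N \<tau> l b c 0 = late_walks N \<tau> l b c 1" by (auto simp: late_walks_def leaf_at_def)
  then show ?thesis by (simp add: late_sum_def)
qed

lemma late_sum_length_0: "late_sum \<mu> N \<tau> 0 b c a = (if b = 1 \<and> c = 0 then real (N \<tau>) else 0)"
proof -
  have cw: "closed_walks N \<tau> 0 = (\<lambda>x. [x]) ` ({\<tau>} \<times> {..<N \<tau>})"
    by (force simp: closed_walks_def length_Suc_conv)
  have n: "num_of s [x] = (if fst x = s then 1 else 0)" for s x
    using num_of_Cons[of x "[]" s] by (simp add: num_of_def)
  have lw: "late_walks N \<tau> 0 b c a = (if b = 1 \<and> c = 0 then closed_walks N \<tau> 0 else {})"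
    unfolding late_walks_def cw by (auto simp: n leaf_at_def)
  have "(\<Sum>w\<in>closed_walks N \<tau> 0. edge_weight \<mu> w) = real (N \<tau>)"
    unfolding cw by (subst sum.reindex) (auto simp: inj_on_def edge_weight_def card_cartesian_product)
  then show ?thesis by (simp add: late_sum_def lw)
qed

lemma late_sum_top_eq_0:
  assumes "\<mu> 1 = 0" "1 \<le> l" "l < b + c"
  shows "late_sum \<mu> N \<tau> l b c (2 * l) = 0"
proof -
  have "core_walks N \<tau> l b c = {}" using core_walks_small assms(3) by fastforce
  then show ?thesis by (simp add: late_sum_core[where \<mu> = \<mu>, OF assms(1,2)])
qed

text \<open>Leafless walks of nonzero weight have at most l vertices, so the boundary value is 0.
  Deleting a leaf lowers l and the number of vertices by one each, so the surplus persists through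
  the recursion.\<close>

lemma late_sum_too_many:
  assumes \<mu>: "\<mu> 1 = 0" "\<mu> 2 = 1"
  shows "l + 2 \<le> b + c \<Longrightarrow> a \<le> 2 * l \<Longrightarrow> late_sum \<mu> N \<tau> l b c a = 0"
proof (induction l arbitrary: a b c)
  case 0
  then show ?case by (auto simp: late_sum_length_0)
next
  case (Suc l)
  have pos: "late_sum \<mu> N \<tau> (Suc l) b c a = 0" if "1 \<le> a" "a \<le> 2 * Suc l" for a
    using that(2,1)
  proof (induction rule: inc_induct)
    case base
    show ?case using Suc.prems by (intro late_sum_top_eq_0 \<mu>(1)) auto
  next
    case (step a)
    show ?case
    proof (cases "b = 0 \<or> c = 0")
      case True
      then show ?thesis by (intro late_sum_eq_0) auto
    next
      case False
      then obtain b' c' where bc: "b = Suc b'" "c = Suc c'" by (metis old.nat.exhaust)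
      show ?thesis
      proof (cases "even a")
        case True
        have "late_sum \<mu> N \<tau> l b' c (a - 1) = 0" using Suc.prems step bc by (intro Suc.IH) auto
        then show ?thesis
          using late_sum_leaf[where \<mu> = \<mu> and b = b' and c = c and b' = b and c' = c, OF \<mu>(2) step.prems, of l N \<tau>] step bc True by simp
      next
        case odd: False
        have "late_sum \<mu> N \<tau> l b c' (a - 1) = 0" using Suc.prems step bc by (intro Suc.IH) auto
        then show ?thesis
          using late_sum_leaf[where \<mu> = \<mu> and b = b and c = c' and b' = b and c' = c, OF \<mu>(2) step.prems, of l N \<tau>] step bc odd by simp
      qed
    qed
  qed
  show ?case
  proof (cases "a = 0")
    case True
    then show ?thesis using pos[of 1] by (simp add: late_sum_from_0)
  next
    case False
    then show ?thesis using pos Suc.prems by simp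
  qed
qed

lemma late_sum_even:
  assumes "\<mu> 2 = 1" "even a" "1 \<le> a" "a \<le> 2 * l + 1"
  shows "late_sum \<mu> N \<tau> (Suc l) (Suc b) c a = late_sum \<mu> N \<tau> (Suc l) (Suc b) c (Suc a)
    + (real (N \<tau>) - real b) * late_sum \<mu> N \<tau> l b c (a - 1)"
  using late_sum_leaf[where \<mu> = \<mu> and b = b and c = c and b' = "Suc b" and c' = c, OF assms(1,3,4)] assms(2) by simp

lemma late_sum_odd:
  assumes "\<mu> 2 = 1" "odd a" "a \<le> 2 * l + 1"
  shows "late_sum \<mu> N \<tau> (Suc l) b (Suc c) a = late_sum \<mu> N \<tau> (Suc l) b (Suc c) (Suc a)
    + (real (N (\<not> \<tau>)) - real c) * late_sum \<mu> N \<tau> l b c (a - 1)"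
proof -
  have "1 \<le> a" using assms(2) by (cases a) auto
  then show ?thesis
    using late_sum_leaf[where \<mu> = \<mu> and b = b and c = c and b' = b and c' = "Suc c", OF assms(1) _ assms(3)] assms(2) by simp
qed

text \<open>Each m solves the leaf recursion separately, with the falling factorials absorbing the
  numbers of free labels; the boundary values agree by \<open>ballot_top\<close> and
  \<open>sum_core_walks\<close>. The limit \<open>M\<close> is kept apart from \<open>l\<close> so
  that the sums compared for consecutive lengths have the same range.\<close>

lemma late_sum_second_order:
  assumes \<mu>: "\<mu> 1 = 0" "\<mu> 2 = 1" and "b \<le> l" "l \<le> M" "a \<le> 2 * l"
  shows "late_sum \<mu> N \<tau> l b (l - b) a = falling (N \<tau>) b * falling (N (\<not> \<tau>)) (l - b) *
    (\<Sum>m = 1..M. core_coeff \<mu> m * ballot l (int b - int m) (int b + int m) a)"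
proof -
  define F where "F l b a = (if b \<le> l then late_sum \<mu> N \<tau> l b (l - b) a else 0)" for l b a
  define S where "S l b a = (\<Sum>m = 1..M. core_coeff \<mu> m * ballot l (int b - int m) (int b + int m) a)" for l b a
  define G where "G l b a = (if b \<le> l then falling (N \<tau>) b * falling (N (\<not> \<tau>)) (l - b) * S l b a else 0)" for l b a
  have S0: "S l b a = 0" if "b = 0 \<or> l \<le> b" "a div 2 \<le> l" for l b a
    unfolding S_def using that by (intro sum.neutral) (auto intro!: ballot_eq_0)
  have "F l b a = G l b a"
  proof (rule leaf_recursion_unique[where top = "\<lambda>l. 2 * l" and M = M and \<alpha> = "\<lambda>b. real (N \<tau>) - real b"
      and \<beta> = "\<lambda>l b. real (N (\<not> \<tau>)) - real (l - b)" and d = "\<lambda>l. l"])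
    show "F 0 b a = G 0 b a" if "a \<le> 2 * 0" for b a
      using that S0[of 0 0 a] by (auto simp: F_def G_def late_sum_length_0)
    show "F (Suc l) b (2 * Suc l) = G (Suc l) b (2 * Suc l)" if "l < M" for l b
    proof (cases "b \<le> Suc l")
      case True
      have "S (Suc l) b (2 * Suc l) = (\<Sum>m = 1..M. if b = (Suc l + 1) div 2 \<and> m \<le> Suc l div 2 then core_coeff \<mu> m else 0)"
        unfolding S_def by (intro sum.cong refl) (subst ballot_top, auto)
      also have "\<dots> = (if b = (Suc l + 1) div 2 then \<Sum>m = 1..Suc l div 2. core_coeff \<mu> m else 0)"
      proof -
        have "(\<Sum>m = 1..Suc l div 2. core_coeff \<mu> m) = (\<Sum>m = 1..M. if m \<le> Suc l div 2 then core_coeff \<mu> m else 0)"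
          using that by (intro sum.mono_neutral_cong_left) auto
        then show ?thesis by simp
      qed
      finally have S: "S (Suc l) b (2 * Suc l) = (if b = (Suc l + 1) div 2 then \<Sum>m = 1..Suc l div 2. core_coeff \<mu> m else 0)" .
      have "F (Suc l) b (2 * Suc l) = (\<Sum>w\<in>core_walks N \<tau> (Suc l) b (Suc l - b). edge_weight \<mu> w)"
        unfolding F_def using True late_sum_core[where \<mu> = \<mu>, OF \<mu>(1), of "Suc l"] by simp
      also have "\<dots> = (if b = (Suc l + 1) div 2 then falling (N \<tau>) b * falling (N (\<not> \<tau>)) (Suc l - b) *
          (\<Sum>m = 1..Suc l div 2. core_coeff \<mu> m) else 0)"
        using True by (intro sum_core_walks \<mu>) auto
      finally show ?thesis unfolding G_def S using True by (simp only: if_True if_distrib[where f = "\<lambda>x. _ * x"] mult_zero_right)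
    qed (simp add: F_def G_def)
    show "F (Suc l) b 0 = F (Suc l) b 1" for l b by (simp add: F_def late_sum_from_0)
    show "G (Suc l) b 0 = G (Suc l) b 1" for l b by (simp add: G_def S_def ballot_0)
    show "F (Suc l) 0 a = G (Suc l) 0 a" if "a \<le> 2 * Suc l" for l a
      using that S0[of 0 "Suc l" a] by (simp add: F_def G_def late_sum_eq_0)
    show "F (Suc l) (Suc b) a = F (Suc l) (Suc b) (Suc a) + (real (N \<tau>) - real b) * F l b (a - 1)"
      if "even a" "1 \<le> a" "a < 2 * Suc l" for l b a
      using that late_sum_even[where \<mu> = \<mu>, OF \<mu>(2)] by (simp add: F_def)
    show "G (Suc l) (Suc b) a = G (Suc l) (Suc b) (Suc a) + (real (N \<tau>) - real b) * G l b (a - 1)"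
      if a: "even a" "1 \<le> a" "a < 2 * Suc l" for l b a
    proof -
      have "S (Suc l) (Suc b) a = S (Suc l) (Suc b) (Suc a) + S l b (a - 1)"
        unfolding S_def sum.distrib[symmetric]
      proof (rule sum.cong[OF refl])
        fix m
        have "int (Suc b) - int m - 1 = int b - int m" "int (Suc b) + int m - 1 = int b + int m" by auto
        then show "core_coeff \<mu> m * ballot (Suc l) (int (Suc b) - int m) (int (Suc b) + int m) a =
            core_coeff \<mu> m * ballot (Suc l) (int (Suc b) - int m) (int (Suc b) + int m) (Suc a) +
            core_coeff \<mu> m * ballot l (int b - int m) (int b + int m) (a - 1)"
          using a by (simp only: ballot_even[of a l "int (Suc b) - int m" "int (Suc b) + int m"] distrib_left)
      qed
      then show ?thesis by (simp add: G_def falling_Suc algebra_simps)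
    qed
    show "F (Suc l) b a = F (Suc l) b (Suc a) + (real (N (\<not> \<tau>)) - real (l - b)) * F l b (a - 1)"
      if "odd a" "a < 2 * Suc l" "b \<le> l" for l b a
      using that late_sum_odd[where \<mu> = \<mu>, OF \<mu>(2)] by (simp add: F_def Suc_diff_le)
    show "G (Suc l) b a = G (Suc l) b (Suc a) + (real (N (\<not> \<tau>)) - real (l - b)) * G l b (a - 1)"
      if a: "odd a" "a < 2 * Suc l" "b \<le> l" for l b a
    proof -
      have "S (Suc l) b a = S (Suc l) b (Suc a) + S l b (a - 1)"
        unfolding S_def sum.distrib[symmetric] by (simp only: ballot_odd[OF a(1,2)] distrib_left)
      then show ?thesis using a by (simp add: G_def falling_Suc Suc_diff_le algebra_simps)
    qed
    show "F (Suc l) b a = G (Suc l) b a" if "a \<le> 2 * Suc l" "l < b" for l b a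
      using that S0[of b "Suc l" a] by (cases "b = Suc l") (auto simp: F_def G_def late_sum_eq_0)
  qed (use assms in auto)
  then show ?thesis using assms(3) by (simp add: F_def G_def S_def)
qed

text \<open>The difference is a reflection principle: a walk of length 2 (l + 1) with l + 2 vertices
  has too many vertices to be leafless, and subtracting the shifted \<open>ballot\<close> term makes
  the boundary vanish except for the single edge at l = 0. The boundary lies at 2 l + 1, the last
  interior position of these walks.\<close>

lemma late_sum_first_order:
  assumes \<mu>: "\<mu> 1 = 0" "\<mu> 2 = 1" and "b \<le> l + 2" "a \<le> 2 * l + 1"
  shows "late_sum \<mu> N \<tau> (Suc l) b (l + 2 - b) a = falling (N \<tau>) b * falling (N (\<not> \<tau>)) (l + 2 - b) *
    (ballot l (int b - 1) (int b - 1) a - ballot l (int b - 2) (int b) a)"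
proof -
  define F where "F l b a = (if b \<le> l + 2 then late_sum \<mu> N \<tau> (Suc l) b (l + 2 - b) a else 0)" for l b a
  define S where "S l b a = ballot l (int b - 1) (int b - 1) a - ballot l (int b - 2) (int b) a" for l b a
  define G where "G l b a = (if b \<le> l + 2 then falling (N \<tau>) b * falling (N (\<not> \<tau>)) (l + 2 - b) * S l b a else 0)" for l b a
  have S0: "S l b a = 0" if "b = 0 \<or> l + 2 \<le> b" "a div 2 \<le> l" for l b a
    unfolding S_def using that ballot_eq_0[of "int b - 1" l "int b - 1" a] ballot_eq_0[of "int b - 2" l "int b" a] by auto
  have Stop: "S l b (2 * l + 1) = (if l = 0 \<and> b = 1 then 1 else 0)" for l b
    unfolding S_def by (rule ballot_diff_top)
  have "F l b a = G l b a"
  proof (rule leaf_recursion_unique[where top = "\<lambda>l. 2 * l + 1" and M = l and \<alpha> = "\<lambda>b. real (N \<tau>) - real b"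
      and \<beta> = "\<lambda>l b. real (N (\<not> \<tau>)) - real (l + 2 - b)" and d = "\<lambda>l. l + 2"])
    show "F 0 b a = G 0 b a" if "a \<le> 2 * 0 + 1" for b a
    proof -
      have "F 0 b a = F 0 b 1" "G 0 b a = G 0 b 1"
        using that by (cases a; auto simp: F_def G_def S_def late_sum_from_0 ballot_0)+
      moreover have "late_sum \<mu> N \<tau> (Suc 0) 1 1 1 = real (N \<tau>) * real (N (\<not> \<tau>))"
        using late_sum_odd[where \<mu> = \<mu> and l = 0 and a = 1 and b = 1 and c = 0 and N = N and \<tau> = \<tau>, OF \<mu>(2)]
          late_sum_top_eq_0[where \<mu> = \<mu> and l = 1 and b = 1 and c = 1 and N = N and \<tau> = \<tau>, OF \<mu>(1)]
        by (simp add: late_sum_length_0 numeral_2_eq_2)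
      moreover have "b = 1 \<or> b = 0 \<or> b = 2 \<or> 2 < b" by linarith
      ultimately show ?thesis using Stop[of 0 b]
        by (auto simp: F_def G_def late_sum_eq_0 falling_def)
    qed
    show "F (Suc l) b (2 * Suc l + 1) = G (Suc l) b (2 * Suc l + 1)" for l b
    proof -
      have "G (Suc l) b (2 * Suc l + 1) = 0" using Stop[of "Suc l" b] by (simp add: G_def)
      \<comment> \<open>At the last interior position one step of the recursion leaves two leafless
        sums, one for each length, and in both the number of vertices exceeds half the
        length.\<close>
      moreover have "F (Suc l) b (2 * Suc l + 1) = 0"
      proof (cases "b \<le> l + 2")
        case True
        then have c: "Suc l + 2 - b = Suc (l + 2 - b)" by simp
        have "late_sum \<mu> N \<tau> (Suc (Suc l)) b (Suc (l + 2 - b)) (2 * Suc (Suc l)) = 0"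
          "late_sum \<mu> N \<tau> (Suc l) b (l + 2 - b) (2 * Suc l) = 0"
          using True by (intro late_sum_top_eq_0 \<mu>; simp)+
        then show ?thesis unfolding F_def c
          using late_sum_odd[where \<mu> = \<mu> and l = "Suc l" and a = "2 * Suc l + 1" and b = b and c = "l + 2 - b" and N = N and \<tau> = \<tau>, OF \<mu>(2)]
          by simp
      qed (auto simp: F_def late_sum_eq_0)
      ultimately show ?thesis by simp
    qed
    show "F (Suc l) b 0 = F (Suc l) b 1" for l b by (simp add: F_def late_sum_from_0)
    show "G (Suc l) b 0 = G (Suc l) b 1" for l b by (simp add: G_def S_def ballot_0)
    show "F (Suc l) 0 a = G (Suc l) 0 a" if "a \<le> 2 * Suc l + 1" for l a
      using that S0[of 0 "Suc l" a] by (simp add: F_def G_def late_sum_eq_0)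
    show "F (Suc l) (Suc b) a = F (Suc l) (Suc b) (Suc a) + (real (N \<tau>) - real b) * F l b (a - 1)"
      if "even a" "1 \<le> a" "a < 2 * Suc l + 1" for l b a
      using that late_sum_even[where \<mu> = \<mu>, OF \<mu>(2)] by (simp add: F_def)
    show "G (Suc l) (Suc b) a = G (Suc l) (Suc b) (Suc a) + (real (N \<tau>) - real b) * G l b (a - 1)"
      if a: "even a" "1 \<le> a" "a < 2 * Suc l + 1" for l b a
    proof -
      have "S (Suc l) (Suc b) a = S (Suc l) (Suc b) (Suc a) + S l b (a - 1)"
        unfolding S_def using ballot_even[OF a, of "int (Suc b) - 1" "int (Suc b) - 1"]
          ballot_even[OF a, of "int (Suc b) - 2" "int (Suc b)"] by simp
      then show ?thesis by (simp add: G_def falling_Suc algebra_simps)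
    qed
    show "F (Suc l) b a = F (Suc l) b (Suc a) + (real (N (\<not> \<tau>)) - real (l + 2 - b)) * F l b (a - 1)"
      if "odd a" "a < 2 * Suc l + 1" "b \<le> l + 2" for l b a
    proof -
      have c: "Suc l + 2 - b = Suc (l + 2 - b)" using that by simp
      show ?thesis unfolding F_def c
        using that late_sum_odd[where \<mu> = \<mu>, OF \<mu>(2), of a "Suc l"] by simp
    qed
    show "G (Suc l) b a = G (Suc l) b (Suc a) + (real (N (\<not> \<tau>)) - real (l + 2 - b)) * G l b (a - 1)"
      if a: "odd a" "a < 2 * Suc l + 1" "b \<le> l + 2" for l b a
    proof -
      have a': "a < 2 * Suc l" using a by presburger
      have c: "Suc l + 2 - b = Suc (l + 2 - b)" using a by simp
      have "S (Suc l) b a = S (Suc l) b (Suc a) + S l b (a - 1)"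
        unfolding S_def using ballot_odd[OF a(1) a'] by simp
      then show ?thesis unfolding G_def c using a by (simp add: falling_Suc algebra_simps)
    qed
    show "F (Suc l) b a = G (Suc l) b a" if "a \<le> 2 * Suc l + 1" "l + 2 < b" for l b a
      using that S0[of b "Suc l" a] by (cases "b = l + 3") (auto simp: F_def G_def late_sum_eq_0)
  qed (use assms in auto)
  then show ?thesis using assms(3) by (simp add: F_def G_def S_def)
qed

section \<open>Binomial identities\<close>

lemma falling_binomial: "falling n k = fact k * real (n choose k)"
proof -
  have "real n gchoose k = (\<Prod>i<k. real n - real i) / fact k"
    by (simp add: gbinomial_prod_rev atLeast0LessThan)
  then show ?thesis by (simp add: falling_def binomial_gbinomial)
qed

lemma ibinom_absorb: "(of_int k + 1) * ibinom n (k + 1) = (real n - of_int k) * ibinom n k"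
proof (cases "0 \<le> k")
  case True
  then obtain j where k: "k = int j" by (metis nonneg_eq_int)
  have "real (Suc j) * real (n choose Suc j) = (real n - real j) * real (n choose j)"
    using falling_Suc[of n j] by (simp add: falling_binomial)
  then show ?thesis by (simp add: k ibinom_def nat_add_distrib add.commute)
next
  case False
  then show ?thesis by (cases "k = -1") (auto simp: ibinom_def)
qed

text \<open>The 2 by 2 determinant of binomials is the Narayana number with parameters l + 1 and b;
  the factorials come from the falling factorials in the count of labels. Clearing the denominators
  k + 1 and l - k + 1, with k = b - 1, reduces everything to the absorption identity.\<close>

lemma narayana:
  assumes "1 \<le> b" "b \<le> Suc l"
  shows "fact b * fact (l + 2 - b) * (ibinom l (int b - 1) * ibinom l (int b - 1) - ibinom l (int b - 2) * ibinom l (int b))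
     = fact (Suc l) * real (l choose (b - 1))"
proof -
  obtain k where b: "b = Suc k" using assms by (cases b) auto
  have kl: "k \<le> l" using assms b by simp
  define j where "j = l - k"
  define B where "B = real (l choose k)"
  have l: "l = k + j" using kl by (simp add: j_def)
  have B0: "ibinom l (int b - 1) = B" by (simp add: b B_def ibinom_def)
  have B1: "(real k + 1) * ibinom l (int b) = real j * B"
    using ibinom_absorb[of "int k" l] by (simp add: b B_def ibinom_of_nat l add.commute)
  have B2: "real k * B = (real j + 1) * ibinom l (int b - 2)"
    using ibinom_absorb[of "int k - 1" l] by (simp add: b B_def ibinom_of_nat l algebra_simps)
  define D where "D = ibinom l (int b - 1) * ibinom l (int b - 1) - ibinom l (int b - 2) * ibinom l (int b)"
  have "(real k + 1) * (real j + 1) * D = (real k + 1) * (real j + 1) * B * B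
      - ((real j + 1) * ibinom l (int b - 2)) * ((real k + 1) * ibinom l (int b))"
    by (simp add: D_def B0 algebra_simps)
  also have "\<dots> = (real l + 1) * B * B" unfolding B1 B2[symmetric] by (simp add: l algebra_simps)
  finally have D: "(real k + 1) * (real j + 1) * D = (real l + 1) * B * B" .
  have fl: "fact k * fact j * B = fact l"
    using binomial_fact_lemma[OF kl] by (metis B_def j_def of_nat_fact of_nat_mult)
  have "fact b * fact (l + 2 - b) * D = fact k * fact j * ((real k + 1) * (real j + 1) * D)"
  proof -
    have "l + 2 - b = Suc j" using b l by simp
    then show ?thesis by (simp add: b algebra_simps)
  qed
  also have "\<dots> = (real l + 1) * (fact k * fact j * B) * B" unfolding D by (simp add: algebra_simps)
  also have "\<dots> = fact (Suc l) * B" unfolding fl by (simp add: algebra_simps)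
  finally show ?thesis by (simp add: D_def B_def b)
qed

text \<open>By absorption, (b + m) (l - b + m) times the m-th product equals (b - m + 1) (l - b - m
  + 1) times the previous one. Since (b + m) (l - b + m) - (b - m) (l - b - m) = 2 l m, the sum
  telescopes after multiplication by l.\<close>

lemma telescoping_products:
  assumes "1 \<le> l"
  shows "(\<Sum>m = 1..M. 2 * real m * (ibinom l (int b - int m) * ibinom l (int b + int m))) =
    (real b * (real l - real b) * real (l choose b) ^ 2
      - (real b + real M + 1) * (real l - real b + real M + 1) * (ibinom l (int b - int (Suc M)) * ibinom l (int b + int (Suc M)))) / real l"
proof -
  define f where "f m = ibinom l (int b - int m) * ibinom l (int b + int m)" for m
  have step: "(real b + real m + 1) * (real l - real b + real m + 1) * f (Suc m) = (real b - real m) * (real l - real b - real m) * f m" for m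
  proof -
    have up: "(real b + real m + 1) * ibinom l (int b + int (Suc m)) = (real l - real b - real m) * ibinom l (int b + int m)"
      using ibinom_absorb[of "int b + int m" l] by (simp add: algebra_simps)
    have down: "(real l - real b + real m + 1) * ibinom l (int b - int (Suc m)) = (real b - real m) * ibinom l (int b - int m)"
      using ibinom_absorb[of "int b - int (Suc m)" l] by (simp add: algebra_simps)
    have "(real b + real m + 1) * (real l - real b + real m + 1) * f (Suc m) =
        ((real l - real b + real m + 1) * ibinom l (int b - int (Suc m))) * ((real b + real m + 1) * ibinom l (int b + int (Suc m)))"
      by (simp only: f_def mult_ac)
    then show ?thesis unfolding up down by (simp only: f_def mult_ac)
  qed
  have "real l * (\<Sum>m = 1..M. 2 * real m * f m) = real b * (real l - real b) * f 0
      - (real b + real M + 1) * (real l - real b + real M + 1) * f (Suc M)"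
  proof (induction M)
    case 0
    then show ?case using step[of 0] by simp
  next
    case (Suc M)
    have "(real b + real (Suc M) + 1) * (real l - real b + real (Suc M) + 1) * f (Suc (Suc M)) =
        (real b - real (Suc M)) * (real l - real b - real (Suc M)) * f (Suc M)" by (rule step)
    then show ?case using Suc by (simp add: algebra_simps)
  qed
  moreover have "f 0 = real (l choose b) ^ 2" by (simp add: f_def ibinom_of_nat power2_eq_square)
  ultimately show ?thesis using assms by (simp add: f_def field_simps)
qed

text \<open>In the convolution for \<open>((2 * l) choose (2 * b))\<close> the indices k and 2 b - k
  give equal terms; the middle one, k = b, is the square.\<close>

lemma vandermonde_symmetric:
  assumes "b \<le> M"
  shows "(\<Sum>m = 1..M. ibinom l (int b - int m) * ibinom l (int b + int m)) =
    (real ((2 * l) choose (2 * b)) - real (l choose b) ^ 2) / 2"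
proof -
  define f where "f m = ibinom l (int b - int m) * ibinom l (int b + int m)" for m
  have "(\<Sum>m = 1..M. f m) = (\<Sum>m = 1..b. f m)"
    using assms by (intro sum.mono_neutral_right) (auto simp: f_def ibinom_eq_0)
  moreover have "real ((2 * l) choose (2 * b)) = (\<Sum>k\<le>2 * b. real (l choose k) * real (l choose (2 * b - k)))"
    using vandermonde[of l l "2 * b"] by (simp flip: of_nat_mult of_nat_sum add: mult_2)
  moreover have "(\<Sum>k\<le>2 * b. g k) = (\<Sum>k<b. g k) + g b + (\<Sum>k\<in>{b<..2 * b}. g k)" for g :: "nat \<Rightarrow> real"
  proof -
    have "(\<Sum>k\<le>2 * b. g k) = (\<Sum>k\<in>{..b}. g k) + (\<Sum>k\<in>{b<..2 * b}. g k)"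
      by (subst sum.union_disjoint[symmetric]) (auto intro!: sum.cong)
    then show ?thesis by (simp add: lessThan_Suc_atMost[symmetric])
  qed
  moreover have "(\<Sum>k<b. real (l choose k) * real (l choose (2 * b - k))) = (\<Sum>m = 1..b. f m)"
  proof (rule sum.reindex_bij_witness[where i = "\<lambda>m. b - m" and j = "\<lambda>k. b - k"])
    fix k assume "k \<in> {..<b}"
    then have "int b - int (b - k) = int k" "int b + int (b - k) = int (2 * b - k)" by auto
    then show "f (b - k) = real (l choose k) * real (l choose (2 * b - k))"
      by (simp only: f_def ibinom_of_nat)
  qed auto
  moreover have "(\<Sum>k\<in>{b<..2 * b}. real (l choose k) * real (l choose (2 * b - k))) = (\<Sum>m = 1..b. f m)"
  proof (rule sum.reindex_bij_witness[where i = "\<lambda>m. b + m" and j = "\<lambda>k. k - b"])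
    fix k assume "k \<in> {b<..2 * b}"
    then have "int b - int (k - b) = int (2 * b - k)" "int b + int (k - b) = int k" by auto
    then show "f (k - b) = real (l choose k) * real (l choose (2 * b - k))"
      by (simp only: f_def ibinom_of_nat mult.commute)
  qed auto
  ultimately show ?thesis unfolding f_def[symmetric] by (simp add: power2_eq_square)
qed

text \<open>Splits \<open>core_coeff\<close> into 1, 2 m and, at m = 1 only, the excess
  \<open>\<mu> 4 - 3\<close> over the generic value 3. Vandermonde handles the first part and
  telescoping the second.\<close>

lemma core_coeff_sum:
  assumes "1 \<le> b" "b \<le> l"
  shows "(\<Sum>m = 1..l. core_coeff \<mu> m * (ibinom l (int b - int m) * ibinom l (int b + int m))) =
    (real ((2 * l) choose (2 * b)) - real (l choose b) ^ 2) / 2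
    + real b * (real l - real b) / real l * real (l choose b) ^ 2
    + (\<mu> 4 - 3) * real (l choose (b - 1)) * real (l choose (b + 1))"
proof -
  define f where "f m = ibinom l (int b - int m) * ibinom l (int b + int m)" for m
  have "(\<Sum>m = 1..l. core_coeff \<mu> m * f m) = (\<Sum>m = 1..l. f m + 2 * real m * f m + (if m = 1 then (\<mu> 4 - 3) * f 1 else 0))"
    by (intro sum.cong) (auto simp: core_coeff_def algebra_simps)
  also have "\<dots> = (\<Sum>m = 1..l. f m) + (\<Sum>m = 1..l. 2 * real m * f m) + (\<mu> 4 - 3) * f 1"
    using assms by (simp add: sum.distrib)
  also have "(\<Sum>m = 1..l. f m) = (real ((2 * l) choose (2 * b)) - real (l choose b) ^ 2) / 2"
    unfolding f_def using assms(2) by (rule vandermonde_symmetric)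
  also have "(\<Sum>m = 1..l. 2 * real m * f m) = real b * (real l - real b) / real l * real (l choose b) ^ 2"
  proof -
    have "ibinom l (int b + int (Suc l)) = 0" by (intro ibinom_eq_0) simp
    then show ?thesis unfolding f_def using telescoping_products[where l = l and M = l and b = b] assms by simp
  qed
  also have "f 1 = real (l choose (b - 1)) * real (l choose (b + 1))"
  proof -
    have "int b - int 1 = int (b - 1)" "int b + int 1 = int (b + 1)" using assms(1) by auto
    then show ?thesis by (simp only: f_def ibinom_of_nat)
  qed
  finally show ?thesis by (simp add: f_def)
qed

text \<open>Vandermonde with n = b + (n - b): the displayed terms are those with k = 0 and, in the
  second estimate, k = 1. In the remaining ones the binomial of n - b has lower index at most c - 1,
  and their coefficients \<open>b choose k\<close> sum to at most 2^b.\<close>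

lemma binomial_shift:
  assumes "b \<le> n" "1 \<le> c"
  shows "\<bar>real (n choose c) - real ((n - b) choose c)\<bar> \<le> 2 ^ b * real n ^ (c - 1)"
    and "\<bar>real (n choose (c + 1)) - real ((n - b) choose (c + 1)) - real b * real ((n - b) choose c)\<bar> \<le> 2 ^ b * real n ^ (c - 1)"
proof -
  have V: "real (n choose r) = (\<Sum>k\<le>r. real (b choose k) * real ((n - b) choose (r - k)))" for r
    using vandermonde[of b "n - b" r] assms(1) by (simp flip: of_nat_mult of_nat_sum)
  have pow: "real ((n - b) choose j) \<le> real n ^ (c - 1)" if "j \<le> c - 1" "0 < n" for j
  proof -
    have "(n - b) choose j \<le> (n - b) ^ j" by (cases "j \<le> n - b") (auto simp: binomial_le_pow binomial_eq_0)
    also have "\<dots> \<le> n ^ j" by (intro power_mono) auto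
    also have "\<dots> \<le> n ^ (c - 1)" using that by (intro power_increasing) auto
    finally have "real ((n - b) choose j) \<le> real (n ^ (c - 1))" by (rule of_nat_mono)
    then show ?thesis by simp
  qed
  have two: "(\<Sum>k\<in>A. real (b choose k)) \<le> 2 ^ b" if "finite A" for A
  proof -
    have "(\<Sum>k\<in>A. b choose k) \<le> (\<Sum>k\<in>A \<union> {..b}. b choose k)" using that by (intro sum_mono2) auto
    also have "\<dots> = (\<Sum>k\<le>b. b choose k)" using that by (intro sum.mono_neutral_right) (auto intro: binomial_eq_0)
    also have "\<dots> = 2 ^ b" by (rule choose_row_sum)
    finally have "real (\<Sum>k\<in>A. b choose k) \<le> real (2 ^ b)" by (rule of_nat_mono)
    then show ?thesis by simp
  qed
  have tail: "\<bar>\<Sum>k\<in>A. real (b choose k) * real ((n - b) choose (r - k))\<bar> \<le> 2 ^ b * real n ^ (c - 1)"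
    if A: "finite A" "\<And>k. k \<in> A \<Longrightarrow> r - k \<le> c - 1" "\<And>k. k \<in> A \<Longrightarrow> 1 \<le> k" for A r
  proof (cases "0 < n")
    case True
    have "\<bar>\<Sum>k\<in>A. real (b choose k) * real ((n - b) choose (r - k))\<bar> = (\<Sum>k\<in>A. real (b choose k) * real ((n - b) choose (r - k)))"
      by (intro abs_of_nonneg sum_nonneg) auto
    also have "\<dots> \<le> (\<Sum>k\<in>A. real (b choose k) * real n ^ (c - 1))"
      using A True by (intro sum_mono mult_left_mono pow) auto
    also have "\<dots> = (\<Sum>k\<in>A. real (b choose k)) * real n ^ (c - 1)" by (simp add: sum_distrib_right)
    also have "\<dots> \<le> 2 ^ b * real n ^ (c - 1)" using A by (intro mult_right_mono two) auto
    finally show ?thesis .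
  next
    case False
    then have "b choose k = 0" if "k \<in> A" for k using A(3)[OF that] assms(1) by simp
    then have "(\<Sum>k\<in>A. real (b choose k) * real ((n - b) choose (r - k))) = 0"
      by (intro sum.neutral) simp
    then show ?thesis by simp
  qed
  have "real (n choose c) - real ((n - b) choose c) = (\<Sum>k\<in>{1..c}. real (b choose k) * real ((n - b) choose (c - k)))"
  proof -
    have "{..c} = insert 0 {1..c}" by auto
    then show ?thesis unfolding V[of c] by simp
  qed
  moreover have "\<bar>\<Sum>k\<in>{1..c}. real (b choose k) * real ((n - b) choose (c - k))\<bar> \<le> 2 ^ b * real n ^ (c - 1)"
    by (rule tail) auto
  ultimately show "\<bar>real (n choose c) - real ((n - b) choose c)\<bar> \<le> 2 ^ b * real n ^ (c - 1)"
    by (simp only:)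
  have "real (n choose (c + 1)) - real ((n - b) choose (c + 1)) - real b * real ((n - b) choose c)
      = (\<Sum>k\<in>{2..c + 1}. real (b choose k) * real ((n - b) choose (c + 1 - k)))"
  proof -
    have "{..c + 1} = insert 0 (insert 1 {2..c + 1})" by auto
    then show ?thesis unfolding V[of "c + 1"] by simp
  qed
  moreover have "\<bar>\<Sum>k\<in>{2..c + 1}. real (b choose k) * real ((n - b) choose (c + 1 - k))\<bar> \<le> 2 ^ b * real n ^ (c - 1)"
    by (rule tail) auto
  ultimately show "\<bar>real (n choose (c + 1)) - real ((n - b) choose (c + 1)) - real b * real ((n - b) choose c)\<bar> \<le> 2 ^ b * real n ^ (c - 1)"
    by (simp only:)
qed

section \<open>Asymptotics of the walk sum\<close>

lemma num_of_le_length: "num_of s w \<le> length w"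
proof -
  have "num_of s w \<le> card (set w)" unfolding num_of_def by (intro card_mono) auto
  also have "\<dots> \<le> length w" by (rule card_length)
  finally show ?thesis .
qed

lemma closed_walks_sum_decompose:
  assumes \<mu>: "\<mu> 1 = 0" "\<mu> 2 = 1" and l: "1 \<le> l"
  shows "(\<Sum>w\<in>closed_walks N \<tau> l. edge_weight \<mu> w) =
    (\<Sum>b = 1..min l (N \<tau>). \<Sum>c = 1..l + 1 - b. late_sum \<mu> N \<tau> l b c 0)"
proof -
  define T where "T = {..2 * l + 1} \<times> {..2 * l + 1}"
  define I where "I = (SIGMA b:{1..min l (N \<tau>)}. {1..l + 1 - b})"
  define g where "g w = (num_of \<tau> w, num_of (\<not> \<tau>) w)" for w
  have lw: "late_walks N \<tau> l b c 0 = {w \<in> closed_walks N \<tau> l. g w = (b, c)}" for b c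
    by (auto simp: late_walks_def g_def)
  have "(\<Sum>w\<in>closed_walks N \<tau> l. edge_weight \<mu> w) = (\<Sum>y\<in>T. \<Sum>w\<in>{w \<in> closed_walks N \<tau> l. g w = y}. edge_weight \<mu> w)"
  proof (rule sum.group[symmetric])
    show "g ` closed_walks N \<tau> l \<subseteq> T"
    proof
      fix y assume "y \<in> g ` closed_walks N \<tau> l"
      then obtain w where "w \<in> closed_walks N \<tau> l" "y = g w" by blast
      moreover from this have "length w = 2 * l + 1" by (simp add: closed_walks_def)
      ultimately show "y \<in> T" using num_of_le_length[of _ w] unfolding T_def g_def by (metis atMost_iff mem_Times_iff fst_conv snd_conv)
    qed
  qed (auto simp: finite_closed_walks T_def)
  also have "\<dots> = (\<Sum>y\<in>T. late_sum \<mu> N \<tau> l (fst y) (snd y) 0)"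
    unfolding late_sum_def lw by simp
  also have "\<dots> = (\<Sum>y\<in>I. late_sum \<mu> N \<tau> l (fst y) (snd y) 0)"
  proof (rule sum.mono_neutral_right)
    show "finite T" by (simp add: T_def)
    show "I \<subseteq> T" by (auto simp: I_def T_def)
    show "\<forall>y\<in>T - I. late_sum \<mu> N \<tau> l (fst y) (snd y) 0 = 0"
    proof
      fix y assume y: "y \<in> T - I"
      obtain b c where bc: "y = (b, c)" by (cases y)
      consider "b = 0 \<or> c = 0" | "N \<tau> < b" | "l + 2 \<le> b + c"
        using y by (auto simp: bc I_def) linarith+
      then show "late_sum \<mu> N \<tau> l (fst y) (snd y) 0 = 0"
      proof cases
        case 1
        then show ?thesis using l late_sum_eq_0 by (simp add: bc)
      next
        case 2
        have "late_walks N \<tau> l b c 0 = {}"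
          using 2 card_fresh(2)[of _ N \<tau>] by (fastforce simp: late_walks_def closed_walks_def)
        then show ?thesis by (simp add: bc late_sum_def)
      next
        case 3
        then show ?thesis using late_sum_too_many[where \<mu> = \<mu>, OF \<mu>] by (simp add: bc)
      qed
    qed
  qed
  also have "\<dots> = (\<Sum>b = 1..min l (N \<tau>). \<Sum>c = 1..l + 1 - b. late_sum \<mu> N \<tau> l b c 0)"
    unfolding I_def by (subst sum.Sigma) (auto simp: case_prod_unfold)
  finally show ?thesis .
qed

lemma edge_weight_bound:
  assumes "\<And>k. k \<le> 2 * l \<Longrightarrow> \<bar>\<mu> k\<bar> \<le> K" "1 \<le> K" "length w = 2 * l + 1"
  shows "\<bar>edge_weight \<mu> w\<bar> \<le> K ^ (2 * l)"
proof -
  have le: "length (edges w) = 2 * l" using assms(3) by (simp add: length_edges)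
  have "\<bar>edge_weight \<mu> w\<bar> = (\<Prod>e\<in>set (edges w). \<bar>\<mu> (count_list (edges w) e)\<bar>)"
    by (simp add: edge_weight_def abs_prod)
  also have "\<dots> \<le> (\<Prod>e\<in>set (edges w). K)"
    using assms(1) le count_le_length[of "edges w"] by (intro prod_mono) auto
  also have "\<dots> = K ^ card (set (edges w))" by simp
  also have "\<dots> \<le> K ^ (2 * l)" using assms(2) le card_length[of "edges w"] by (intro power_increasing) auto
  finally show ?thesis .
qed

lemma binomial_le_power: "n choose k \<le> n ^ k"
  by (cases "k \<le> n") (auto simp: binomial_le_pow binomial_eq_0)

lemma card_late_walks_le:
  "card (late_walks N \<tau> l b c a) \<le> (2 * l + 1) ^ (2 * l + 1) * N \<tau> ^ b * N (\<not> \<tau>) ^ c"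
proof -
  define V where "V s = Pair s ` {..<N s}" for s :: bool
  define P where "P = {A. A \<subseteq> V \<tau> \<and> card A = b} \<times> {B. B \<subseteq> V (\<not> \<tau>) \<and> card B = c}"
  \<comment> \<open>The guard on the cardinality makes the bound (2 l + 1)^(2 l + 1) valid for every
    pair of vertex sets, as b + c is not restricted here.\<close>
  define W where "W S = (if card S \<le> 2 * l + 1 then {w. set w \<subseteq> S \<and> length w = 2 * l + 1} else {})" for S :: "vertex set"
  have fV: "finite (V s)" and cV: "card (V s) = N s" for s
    by (auto simp: V_def card_image inj_on_def)
  have fP: "finite P" unfolding P_def using fV by simp
  have fS: "finite (A \<union> B)" if "(A, B) \<in> P" for A B
    using that fV by (auto simp: P_def intro: finite_subset)
  have "late_walks N \<tau> l b c a \<subseteq> (\<Union>(A, B)\<in>P. W (A \<union> B))"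
  proof
    fix w assume w: "w \<in> late_walks N \<tau> l b c a"
    define A B where "A = {x \<in> set w. fst x = \<tau>}" and "B = {x \<in> set w. fst x = (\<not> \<tau>)}"
    have lab: "\<forall>x\<in>set w. snd x < N (fst x)" and len: "length w = 2 * l + 1"
      using w by (auto simp: late_walks_def closed_walks_def)
    have AB: "set w = A \<union> B" by (auto simp: A_def B_def)
    have "(A, B) \<in> P" using lab w by (force simp: P_def A_def B_def V_def late_walks_def num_of_def)
    moreover have "card (A \<union> B) \<le> 2 * l + 1" using card_length[of w] len by (simp add: AB)
    then have "w \<in> W (A \<union> B)" using len by (simp add: W_def AB)
    ultimately show "w \<in> (\<Union>(A, B)\<in>P. W (A \<union> B))" by blast
  qed
  moreover have fW: "finite (W (A \<union> B))" if "(A, B) \<in> P" for A B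
    unfolding W_def using fS[OF that] by (auto intro: finite_lists_length_eq)
  ultimately have "card (late_walks N \<tau> l b c a) \<le> card (\<Union>(A, B)\<in>P. W (A \<union> B))"
    using fP by (intro card_mono) auto
  also have "\<dots> \<le> (\<Sum>y\<in>P. card (case y of (A, B) \<Rightarrow> W (A \<union> B)))" using fP by (rule card_UN_le)
  also have "\<dots> \<le> (\<Sum>y\<in>P. (2 * l + 1) ^ (2 * l + 1))"
  proof (rule sum_mono)
    fix y assume "y \<in> P"
    then obtain A B where y: "y = (A, B)" "(A, B) \<in> P" by (cases y) auto
    then show "card (case y of (A, B) \<Rightarrow> W (A \<union> B)) \<le> (2 * l + 1) ^ (2 * l + 1)"
      using card_lists_length_eq[OF fS[OF y(2)], of "2 * l + 1"] power_mono[of "card (A \<union> B)" "2 * l + 1" "2 * l + 1"]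
      by (auto simp: W_def)
  qed
  also have "\<dots> = card P * (2 * l + 1) ^ (2 * l + 1)" by simp
  also have "card P = (N \<tau> choose b) * (N (\<not> \<tau>) choose c)"
    unfolding P_def card_cartesian_product using n_subsets[OF fV] cV by simp
  also have "\<dots> * (2 * l + 1) ^ (2 * l + 1) \<le> (N \<tau> ^ b * N (\<not> \<tau>) ^ c) * (2 * l + 1) ^ (2 * l + 1)"
    by (intro mult_le_mono binomial_le_power) auto
  finally show ?thesis by (simp add: mult_ac)
qed

lemma late_sum_bound:
  assumes "\<And>k. k \<le> 2 * l \<Longrightarrow> \<bar>\<mu> k\<bar> \<le> K" "1 \<le> K"
  shows "\<bar>late_sum \<mu> N \<tau> l b c a\<bar> \<le> real ((2 * l + 1) ^ (2 * l + 1)) * K ^ (2 * l) * (real (N \<tau>) ^ b * real (N (\<not> \<tau>)) ^ c)"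
proof -
  have "\<bar>late_sum \<mu> N \<tau> l b c a\<bar> \<le> (\<Sum>w\<in>late_walks N \<tau> l b c a. \<bar>edge_weight \<mu> w\<bar>)"
    unfolding late_sum_def by (rule sum_abs)
  also have "\<dots> \<le> (\<Sum>w\<in>late_walks N \<tau> l b c a. K ^ (2 * l))"
    using edge_weight_bound[where \<mu> = \<mu>, OF assms] by (intro sum_mono) (auto simp: late_walks_def closed_walks_def)
  also have "\<dots> = real (card (late_walks N \<tau> l b c a)) * K ^ (2 * l)" by simp
  also have "\<dots> \<le> real ((2 * l + 1) ^ (2 * l + 1) * N \<tau> ^ b * N (\<not> \<tau>) ^ c) * K ^ (2 * l)"
    using assms(2) by (intro mult_right_mono of_nat_mono card_late_walks_le) auto
  finally show ?thesis by (simp add: mult_ac)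
qed

section \<open>The two coefficients and the error term\<close>

definition first_coeff :: "nat \<Rightarrow> nat \<Rightarrow> real" where
  "first_coeff l b = fact l * real ((l - 1) choose (b - 1))"

definition second_coeff :: "real \<Rightarrow> nat \<Rightarrow> nat \<Rightarrow> real" where
  "second_coeff m4 l b = fact b * fact (l - b) / 2
      * (real ((2 * l) choose (2 * b)) + (2 * real b - 1) * real (l choose b) ^ 2)
    + (m4 - 3) * (if b < l then 1 else 0) * fact b * fact (l - b) * real (l choose (b - 1)) * real (l choose (b + 1))"

lemma late_sum_first_coeff:
  assumes \<mu>: "\<mu> 1 = 0" "\<mu> 2 = 1" and b: "1 \<le> b" "b \<le> l"
  shows "late_sum \<mu> N \<tau> l b (l + 1 - b) 0 = real (N \<tau> choose b) * real (N (\<not> \<tau>) choose (l + 1 - b)) * first_coeff l b"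
proof -
  obtain k where l: "l = Suc k" using b by (cases l) auto
  have "late_sum \<mu> N \<tau> (Suc k) b (k + 2 - b) 0 = falling (N \<tau>) b * falling (N (\<not> \<tau>)) (k + 2 - b) *
    (ballot k (int b - 1) (int b - 1) 0 - ballot k (int b - 2) (int b) 0)"
    using b l by (intro late_sum_first_order \<mu>) auto
  also have "\<dots> = real (N \<tau> choose b) * real (N (\<not> \<tau>) choose (k + 2 - b)) * (fact b * fact (k + 2 - b) *
    (ibinom k (int b - 1) * ibinom k (int b - 1) - ibinom k (int b - 2) * ibinom k (int b)))"
    by (simp add: falling_binomial ballot_0 ballot_start mult_ac)
  also have "fact b * fact (k + 2 - b) * (ibinom k (int b - 1) * ibinom k (int b - 1) - ibinom k (int b - 2) * ibinom k (int b))
    = first_coeff l b"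
    using narayana[of b k] b by (simp add: first_coeff_def l)
  finally show ?thesis by (simp add: l)
qed

text \<open>The term subtracted from \<open>second_coeff\<close> anticipates the replacement of n by
  n - b in the leading binomial, which contributes b times \<open>first_coeff\<close> at this
  order.\<close>

lemma late_sum_second_coeff:
  assumes \<mu>: "\<mu> 1 = 0" "\<mu> 2 = 1" and b: "1 \<le> b" "b \<le> l"
  shows "late_sum \<mu> N \<tau> l b (l - b) 0 = real (N \<tau> choose b) * real (N (\<not> \<tau>) choose (l - b)) *
    (second_coeff (\<mu> 4) l b - real b * first_coeff l b)"
proof -
  define B where "B = real (l choose b)"
  have "late_sum \<mu> N \<tau> l b (l - b) 0 = falling (N \<tau>) b * falling (N (\<not> \<tau>)) (l - b) *
    (\<Sum>m = 1..l. core_coeff \<mu> m * ballot l (int b - int m) (int b + int m) 0)"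
    using b by (intro late_sum_second_order \<mu>) auto
  also have "(\<Sum>m = 1..l. core_coeff \<mu> m * ballot l (int b - int m) (int b + int m) 0) =
      (\<Sum>m = 1..l. core_coeff \<mu> m * (ibinom l (int b - int m) * ibinom l (int b + int m)))"
    by (simp add: ballot_0 ballot_start)
  also have "\<dots> = (real ((2 * l) choose (2 * b)) - B ^ 2) / 2 + real b * (real l - real b) / real l * B ^ 2
      + (\<mu> 4 - 3) * real (l choose (b - 1)) * real (l choose (b + 1))"
    unfolding B_def by (rule core_coeff_sum[OF b])
  finally have ls: "late_sum \<mu> N \<tau> l b (l - b) 0 = real (N \<tau> choose b) * real (N (\<not> \<tau>) choose (l - b)) *
      (fact b * fact (l - b) * ((real ((2 * l) choose (2 * b)) - B ^ 2) / 2 + real b * (real l - real b) / real l * B ^ 2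
      + (\<mu> 4 - 3) * real (l choose (b - 1)) * real (l choose (b + 1))))"
    by (simp add: falling_binomial mult_ac)
  have fc: "real b * first_coeff l b = fact b * fact (l - b) * (real b ^ 2 / real l * B ^ 2)"
  proof -
    have fl: "fact b * fact (l - b) * B = fact l"
      using binomial_fact_lemma[OF b(2)] by (metis B_def of_nat_fact of_nat_mult)
    have "b * (l choose b) = l * ((l - 1) choose (b - 1))"
      using b binomial_absorption[of "b - 1" l] by simp
    then have "real b * B = real l * real ((l - 1) choose (b - 1))"
      unfolding B_def by (metis of_nat_mult)
    then have "real ((l - 1) choose (b - 1)) = real b * B / real l" using b by (simp add: field_simps)
    then have "real b * first_coeff l b = real b ^ 2 * (fact l * B) / real l"
      by (simp add: first_coeff_def power2_eq_square)
    then show ?thesis unfolding fl[symmetric] by (simp add: power2_eq_square)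
  qed
  have sc: "second_coeff (\<mu> 4) l b = fact b * fact (l - b) *
      ((real ((2 * l) choose (2 * b)) + (2 * real b - 1) * B ^ 2) / 2
        + (\<mu> 4 - 3) * real (l choose (b - 1)) * real (l choose (b + 1)))"
    using b unfolding second_coeff_def B_def by (auto simp: binomial_eq_0 field_simps)
  define q where "q = real b ^ 2 / real l"
  have qe: "real b * (real l - real b) / real l = real b - q"
    using b by (simp add: q_def field_simps power2_eq_square)
  show ?thesis unfolding ls sc fc qe q_def[symmetric] by (simp add: field_simps)
qed

text \<open>Only c = l + 1 - b and c = l - b are needed exactly; \<open>binomial_shift\<close> moves
  them to n - b. A smaller c satisfies c \<le> l - b - 1, so its crude bound p^b n^c is already at
  most p^b n^l / n^(b + 1).\<close>

lemma late_sum_column_estimate: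
  assumes \<mu>: "\<mu> 1 = 0" "\<mu> 2 = 1" and K: "\<And>k. k \<le> 2 * l \<Longrightarrow> \<bar>\<mu> k\<bar> \<le> K" "1 \<le> K"
    and b: "1 \<le> b" "b \<le> l" "b \<le> n"
    and D: "D = real ((2 * l + 1) ^ (2 * l + 1)) * K ^ (2 * l)" and N: "N \<tau> = p" "N (\<not> \<tau>) = n"
  shows "\<bar>(\<Sum>c = 1..l + 1 - b. late_sum \<mu> N \<tau> l b c 0)
      - (real (p choose b) * real ((n - b) choose (l + 1 - b)) * first_coeff l b
         + real (p choose b) * real ((n - b) choose (l - b)) * second_coeff (\<mu> 4) l b)\<bar>
    \<le> ((\<bar>first_coeff l b\<bar> + \<bar>second_coeff (\<mu> 4) l b - real b * first_coeff l b\<bar>) * 2 ^ b + real l * D)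
        * real p ^ b * real n ^ l / real n ^ (b + 1)"
proof -
  define A where "A = first_coeff l b"
  define E where "E = second_coeff (\<mu> 4) l b - real b * first_coeff l b"
  define P where "P = real (p choose b)"
  define L where "L c = late_sum \<mu> N \<tau> l b c 0" for c
  have D0: "0 \<le> D" using K(2) by (simp add: D)
  have L1: "L (l + 1 - b) = P * real (n choose (l + 1 - b)) * A"
    unfolding L_def P_def A_def using late_sum_first_coeff[where \<mu> = \<mu>, OF \<mu> b(1,2)] N by simp
  have L2: "L (l - b) = P * real (n choose (l - b)) * E"
    unfolding L_def P_def E_def using late_sum_second_coeff[where \<mu> = \<mu>, OF \<mu> b(1,2)] N by simp
  \<comment> \<open>For b = l the index l - b is 0 and lies outside the range of summation; the
    value 0 lets the same splitting cover this case.\<close>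
  have L0: "L 0 = 0" unfolding L_def using b by (intro late_sum_eq_0) auto
  have split: "(\<Sum>c = 1..l + 1 - b. L c) = (\<Sum>c = 1..<l - b. L c) + L (l - b) + L (l + 1 - b)"
  proof (cases "b = l")
    case True
    then show ?thesis by (simp add: L0)
  next
    case False
    then have "{1..l + 1 - b} = insert (l + 1 - b) (insert (l - b) {1..<l - b})" using b by auto
    then show ?thesis using False b by (simp add: Suc_diff_le)
  qed
  define X where "X = real (n choose (l + 1 - b)) - real ((n - b) choose (l + 1 - b)) - real b * real ((n - b) choose (l - b))"
  define Y where "Y = real (n choose (l - b)) - real ((n - b) choose (l - b))"
  have diff: "(\<Sum>c = 1..l + 1 - b. L c) - (P * real ((n - b) choose (l + 1 - b)) * A
      + P * real ((n - b) choose (l - b)) * second_coeff (\<mu> 4) l b)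
    = P * (A * X + E * Y) + (\<Sum>c = 1..<l - b. L c)"
    unfolding split L1 L2 X_def Y_def E_def A_def by (simp add: algebra_simps)
  have bound: "\<bar>P * (A * X + E * Y) + (\<Sum>c = 1..<l - b. L c)\<bar> \<le> ((\<bar>A\<bar> + \<bar>E\<bar>) * 2 ^ b + real l * D) * real p ^ b * real n ^ l / real n ^ (b + 1)"
  proof (cases "b = l")
    case True
    \<comment> \<open>Both shifts are exact for b = l, as n - (n - b) - b = 0, and no smaller c
      remains; the whole difference is 0.\<close>
    then have "X = 0" "Y = 0" using b by (auto simp: X_def Y_def of_nat_diff)
    then show ?thesis using True D0 by simp
  next
    case False
    define R where "R = real n ^ (l - b - 1)"
    have n: "1 \<le> n" using b by simp
    have R: "real n ^ l / real n ^ (b + 1) = R"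
      unfolding R_def using False b n power_diff[of "real n" "b + 1" l] by simp
    have X: "\<bar>X\<bar> \<le> 2 ^ b * R" using binomial_shift(2)[of b n "l - b"] b False
      by (simp add: X_def R_def Suc_diff_le)
    have Y: "\<bar>Y\<bar> \<le> 2 ^ b * R" using binomial_shift(1)[of b n "l - b"] b False by (simp add: Y_def R_def)
    have P: "0 \<le> P" "P \<le> real p ^ b"
      unfolding P_def using binomial_le_power[of p b] by (auto simp flip: of_nat_power)
    have "\<bar>P * (A * X + E * Y)\<bar> \<le> real p ^ b * ((\<bar>A\<bar> + \<bar>E\<bar>) * (2 ^ b * R))"
    proof -
      have "\<bar>A * X + E * Y\<bar> \<le> \<bar>A\<bar> * \<bar>X\<bar> + \<bar>E\<bar> * \<bar>Y\<bar>" by (metis abs_mult abs_triangle_ineq)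
      also have "\<dots> \<le> \<bar>A\<bar> * (2 ^ b * R) + \<bar>E\<bar> * (2 ^ b * R)" using X Y by (intro add_mono mult_left_mono) auto
      finally have "\<bar>A * X + E * Y\<bar> \<le> (\<bar>A\<bar> + \<bar>E\<bar>) * (2 ^ b * R)" by (simp add: algebra_simps)
      then show ?thesis unfolding abs_mult[of P] using P by (intro mult_mono) auto
    qed
    moreover have "\<bar>\<Sum>c = 1..<l - b. L c\<bar> \<le> real l * (D * (real p ^ b * R))"
    proof -
      have "\<bar>L c\<bar> \<le> D * (real p ^ b * R)" if "c \<in> {1..<l - b}" for c
      proof -
        have "\<bar>L c\<bar> \<le> D * (real p ^ b * real n ^ c)"
          unfolding L_def D using late_sum_bound[where \<mu> = \<mu>, OF K, where N = N and \<tau> = \<tau>] N by simp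
        also have "\<dots> \<le> D * (real p ^ b * R)"
          unfolding R_def using that n D0 by (intro mult_left_mono power_increasing) auto
        finally show ?thesis .
      qed
      then have "\<bar>\<Sum>c = 1..<l - b. L c\<bar> \<le> (\<Sum>c = 1..<l - b. D * (real p ^ b * R))"
        by (intro order_trans[OF sum_abs] sum_mono) auto
      also have "\<dots> = real (l - b - 1) * (D * (real p ^ b * R))" by simp
      also have "\<dots> \<le> real l * (D * (real p ^ b * R))"
        using D0 by (intro mult_right_mono) (auto simp: R_def)
      finally show ?thesis .
    qed
    ultimately have "\<bar>P * (A * X + E * Y) + (\<Sum>c = 1..<l - b. L c)\<bar>
        \<le> real p ^ b * ((\<bar>A\<bar> + \<bar>E\<bar>) * (2 ^ b * R)) + real l * (D * (real p ^ b * R))"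
      by (intro order_trans[OF abs_triangle_ineq] add_mono)
    also have "\<dots> = ((\<bar>A\<bar> + \<bar>E\<bar>) * 2 ^ b + real l * D) * real p ^ b * (real n ^ l / real n ^ (b + 1))"
      unfolding R by (simp add: algebra_simps)
    finally show ?thesis by simp
  qed
  show ?thesis using bound[folded diff] unfolding L_def A_def E_def P_def .
qed

lemma closed_walks_sum_asymptotics:
  assumes \<mu>: "\<mu> 1 = 0" "\<mu> 2 = 1" and l: "1 \<le> l"
  shows "\<exists>C. \<forall>p n N. p \<le> n \<longrightarrow> N True = p \<longrightarrow> N False = n \<longrightarrow>
    \<bar>(\<Sum>w\<in>closed_walks N True l. edge_weight \<mu> w) / real n ^ l
      - (\<Sum>b = 1..min l p. real (p choose b) * real ((n - b) choose (l + 1 - b)) / real n ^ l * first_coeff l b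
         + real (p choose b) * real ((n - b) choose (l - b)) / real n ^ l * second_coeff (\<mu> 4) l b)\<bar>
    \<le> (\<Sum>b = 1..min l p. C * real p ^ b / real n ^ (b + 1))"
proof -
  \<comment> \<open>A walk has 2 l steps, so only multiplicities up to 2 l occur. Including 1 gives
    \<open>1 \<le> K\<close>, so the number of distinct edges in the exponent may be raised to 2
    l.\<close>
  define K where "K = Max (insert 1 ((\<lambda>k. \<bar>\<mu> k\<bar>) ` {..2 * l}))"
  have K: "\<And>k. k \<le> 2 * l \<Longrightarrow> \<bar>\<mu> k\<bar> \<le> K" "1 \<le> K" 
    unfolding K_def by (rule Max_ge; simp)+
  define D where "D = real ((2 * l + 1) ^ (2 * l + 1)) * K ^ (2 * l)"
  define c where "c b = (\<bar>first_coeff l b\<bar> + \<bar>second_coeff (\<mu> 4) l b - real b * first_coeff l b\<bar>) * 2 ^ b + real l * D" for b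
  define C where "C = (\<Sum>b = 1..l. c b)"
  have D0: "0 \<le> D" using K(2) by (simp add: D_def)
  have c0: "0 \<le> c b" for b using D0 by (simp add: c_def)
  have cC: "c b \<le> C" if "1 \<le> b" "b \<le> l" for b
    unfolding C_def using that c0 by (intro member_le_sum) auto
  show ?thesis
  proof (intro exI[of _ C] allI impI)
    fix p n and N :: "bool \<Rightarrow> nat" assume pn: "p \<le> n" and N: "N True = p" "N False = n"
    define S where "S b = (\<Sum>c = 1..l + 1 - b. late_sum \<mu> N True l b c 0)" for b
    define m where "m b = real (p choose b) * real ((n - b) choose (l + 1 - b)) * first_coeff l b
         + real (p choose b) * real ((n - b) choose (l - b)) * second_coeff (\<mu> 4) l b" for b
    have W: "(\<Sum>w\<in>closed_walks N True l. edge_weight \<mu> w) = (\<Sum>b = 1..min l p. S b)"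
      unfolding S_def using closed_walks_sum_decompose[where \<mu> = \<mu>, OF \<mu> l, of N True] N by simp
    have "(\<Sum>w\<in>closed_walks N True l. edge_weight \<mu> w) / real n ^ l
      - (\<Sum>b = 1..min l p. real (p choose b) * real ((n - b) choose (l + 1 - b)) / real n ^ l * first_coeff l b
         + real (p choose b) * real ((n - b) choose (l - b)) / real n ^ l * second_coeff (\<mu> 4) l b)
      = (\<Sum>b = 1..min l p. (S b - m b) / real n ^ l)"
      unfolding W m_def sum_divide_distrib sum_subtractf[symmetric]
      by (intro sum.cong refl) (simp add: diff_divide_distrib add_divide_distrib)
    also have "\<bar>\<dots>\<bar> \<le> (\<Sum>b = 1..min l p. C * real p ^ b / real n ^ (b + 1))"
    proof (intro order_trans[OF sum_abs] sum_mono)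
      fix b assume "b \<in> {1..min l p}"
      then have b: "1 \<le> b" "b \<le> l" "b \<le> n" using pn by auto
      have "\<bar>S b - m b\<bar> \<le> c b * real p ^ b * real n ^ l / real n ^ (b + 1)"
        unfolding S_def m_def c_def
        using late_sum_column_estimate[where \<mu> = \<mu>, OF \<mu> K b D_def, of N True p] N by simp
      then have "\<bar>S b - m b\<bar> / real n ^ l \<le> (c b * real p ^ b * real n ^ l / real n ^ (b + 1)) / real n ^ l"
        by (intro divide_right_mono) auto
      also have "\<dots> = c b * (real p ^ b / real n ^ (b + 1))" using b by simp
      also have "\<dots> \<le> C * (real p ^ b / real n ^ (b + 1))" using cC[OF b(1,2)] by (intro mult_right_mono) auto
      finally show "\<bar>(S b - m b) / real n ^ l\<bar> \<le> C * real p ^ b / real n ^ (b + 1)" by simp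
    qed
    finally show "\<bar>(\<Sum>w\<in>closed_walks N True l. edge_weight \<mu> w) / real n ^ l
      - (\<Sum>b = 1..min l p. real (p choose b) * real ((n - b) choose (l + 1 - b)) / real n ^ l * first_coeff l b
         + real (p choose b) * real ((n - b) choose (l - b)) / real n ^ l * second_coeff (\<mu> 4) l b)\<bar>
      \<le> (\<Sum>b = 1..min l p. C * real p ^ b / real n ^ (b + 1))" .
  qed
qed

section \<open>The expected trace as a walk sum\<close>

text \<open>Edges are unordered, so row and column index are recovered from the sides of the
  endpoints.\<close>

definition edge_entry :: "(nat \<Rightarrow> nat \<Rightarrow> 'b) \<Rightarrow> vertex set \<Rightarrow> 'b" where
  "edge_entry y e = y (THE i. (True, i) \<in> e) (THE j. (False, j) \<in> e)"

lemma edge_entry_doubleton [simp]: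
  "edge_entry y {(True, i), (False, j)} = y i j" "edge_entry y {(False, j), (True, i)} = y i j"
  by (simp_all add: edge_entry_def)

definition walk_prod :: "(nat \<Rightarrow> nat \<Rightarrow> real) \<Rightarrow> vertex list \<Rightarrow> real" where
  "walk_prod y w = prod_list (map (edge_entry y) (edges w))"

definition walks_between :: "nat \<Rightarrow> nat \<Rightarrow> nat \<Rightarrow> nat \<Rightarrow> nat \<Rightarrow> vertex list set" where
  "walks_between p n l i i' = {w. length w = 2 * l + 1 \<and> (\<forall>x\<in>set w. snd x < (if fst x then p else n)) \<and>
     successively (\<lambda>x y. fst x \<noteq> fst y) w \<and> hd w = (True, i) \<and> last w = (True, i')}"

lemma walks_between_0: "i' < p \<Longrightarrow> walks_between p n 0 i i' = (if i = i' then {[(True, i)]} else {})"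
  by (auto simp: walks_between_def length_Suc_conv)

lemma walks_between_Suc:
  assumes "i' < p"
  shows "walks_between p n (Suc l) i i' = (\<lambda>(k, w, j). w @ [(False, j), (True, i')]) `
    (SIGMA k:{..<p}. walks_between p n l i k \<times> {..<n})" (is "?A = ?f ` ?T")
proof (intro Set.set_eqI iffI)
  fix w assume w: "w \<in> ?A"
  define v where "v = take (2 * l + 1) w"
  define a where "a = w ! (2 * l + 1)"
  define b where "b = w ! (2 * l + 2)"
  have len: "length w = 2 * l + 3" using w by (simp add: walks_between_def)
  have "drop (2 * l + 1) w = [a, b]"
    unfolding a_def b_def using len by (intro nth_equalityI) (auto simp: nth_Cons less_Suc_eq split: nat.splits)
  then have wv: "w = v @ [a, b]" unfolding v_def by (metis append_take_drop_id)
  have lv: "length v = 2 * l + 1" using len by (simp add: v_def)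
  then have vne: "v \<noteq> []" by auto
  have b: "b = (True, i')" using w by (simp add: walks_between_def wv)
  have suc: "successively (\<lambda>x y. fst x \<noteq> fst y) v" "fst (last v) \<noteq> fst a" "fst a \<noteq> fst b"
    using w vne by (auto simp: walks_between_def wv successively_append_iff)
  obtain k where k: "last v = (True, k)" using suc b by (cases "last v") auto
  obtain j where j: "a = (False, j)" using suc b by (cases a) auto
  have lab: "\<forall>x\<in>set v. snd x < (if fst x then p else n)" "j < n" using w by (auto simp: walks_between_def wv j)
  have "last v \<in> set v" using vne by simp
  then have "k < p" using lab k by fastforce
  moreover have "v \<in> walks_between p n l i k"
    using w lv vne suc lab k by (simp add: walks_between_def wv)
  ultimately show "w \<in> ?f ` ?T" using lab(2) by (force simp: wv j b)
next
  fix w assume "w \<in> ?f ` ?T"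
  then obtain k v j where v: "v \<in> walks_between p n l i k" "k < p" "j < n" "w = v @ [(False, j), (True, i')]" by auto
  then have "v \<noteq> []" by (auto simp: walks_between_def)
  then show "w \<in> ?A" using v assms by (auto simp: walks_between_def successively_append_iff)
qed

lemma finite_walks_between: "finite (walks_between p n l i i')"
proof -
  have "walks_between p n l i i' \<subseteq> {w. set w \<subseteq> (SIGMA s:UNIV. {..<if s then p else n}) \<and> length w = 2 * l + 1}"
    by (auto simp: walks_between_def split: if_splits)
  then show ?thesis by (rule finite_subset) (auto intro!: finite_lists_length_eq finite_SigmaI)
qed

lemma walk_prod_append2:
  assumes "last w = (True, k)" "w \<noteq> []"
  shows "walk_prod y (w @ [(False, j), (True, i)]) = walk_prod y w * y k j * y i j"
proof -
  have w: "w = butlast w @ [(True, k)]" using assms by (metis append_butlast_last_id)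
  have "edges (butlast w @ (True, k) # [(False, j), (True, i)]) =
      edges (butlast w @ [(True, k)]) @ edges ((True, k) # [(False, j), (True, i)])" by (rule edges_append)
  then have "edges (w @ [(False, j), (True, i)]) = edges w @ [{(True, k), (False, j)}, {(False, j), (True, i)}]"
    using w by (metis append.assoc append_Cons append_Nil edges.simps(1,3))
  then show ?thesis by (simp add: walk_prod_def mult.assoc)
qed

lemma gram_power_entry:
  fixes y :: "nat \<Rightarrow> nat \<Rightarrow> real" and p n :: nat
  defines "A \<equiv> mat p n (\<lambda>(i, j). y i j)"
  assumes "i < p" "i' < p"
  shows "((c \<cdot>\<^sub>m (A * transpose_mat A)) ^\<^sub>m l) $$ (i, i') = c ^ l * (\<Sum>w\<in>walks_between p n l i i'. walk_prod y w)"
  using assms(3)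
proof (induction l arbitrary: i')
  case 0
  then show ?case using assms(2) by (auto simp: walks_between_0 walk_prod_def A_def)
next
  case (Suc l)
  define B where "B = c \<cdot>\<^sub>m (A * transpose_mat A)"
  have dims: "dim_row B = p" "dim_col B = p" by (auto simp: B_def A_def)
  have Bent: "B $$ (k, i') = c * (\<Sum>j<n. y k j * y i' j)" if "k < p" for k
    using that Suc.prems by (simp add: B_def A_def scalar_prod_def lessThan_atLeast0)
  have inj: "inj_on (\<lambda>(k, w, j). w @ [(False, j), (True, i')]) (SIGMA k:{..<p}. walks_between p n l i k \<times> {..<n})"
    by (auto simp: inj_on_def walks_between_def)
  have "(B ^\<^sub>m Suc l) $$ (i, i') = (\<Sum>k<p. (B ^\<^sub>m l) $$ (i, k) * B $$ (k, i'))"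
    using assms(2) Suc.prems dims by (simp add: scalar_prod_def lessThan_atLeast0)
  also have "\<dots> = (\<Sum>k<p. c ^ l * (\<Sum>w\<in>walks_between p n l i k. walk_prod y w) * (c * (\<Sum>j<n. y k j * y i' j)))"
    using Suc.IH Bent by (intro sum.cong refl) (auto simp: B_def)
  also have "\<dots> = c ^ Suc l * (\<Sum>k<p. \<Sum>w\<in>walks_between p n l i k. \<Sum>j<n. walk_prod y w * (y k j * y i' j))"
    by (simp add: sum_distrib_left sum_product mult_ac)
  also have "(\<Sum>k<p. \<Sum>w\<in>walks_between p n l i k. \<Sum>j<n. walk_prod y w * (y k j * y i' j)) =
     (\<Sum>(k, w, j)\<in>(SIGMA k:{..<p}. walks_between p n l i k \<times> {..<n}). walk_prod y w * (y k j * y i' j))"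
    by (simp add: sum.Sigma sum.cartesian_product finite_walks_between case_prod_unfold)
  also have "\<dots> = (\<Sum>(k, w, j)\<in>(SIGMA k:{..<p}. walks_between p n l i k \<times> {..<n}). walk_prod y (w @ [(False, j), (True, i')]))"
  proof (intro sum.cong refl, clarify)
    fix k w j assume "w \<in> walks_between p n l i k"
    then have "w \<noteq> []" "last w = (True, k)" by (auto simp: walks_between_def)
    then show "walk_prod y w * (y k j * y i' j) = walk_prod y (w @ [(False, j), (True, i')])"
      by (simp add: walk_prod_append2 mult.assoc)
  qed
  also have "\<dots> = (\<Sum>w\<in>walks_between p n (Suc l) i i'. walk_prod y w)"
    unfolding walks_between_Suc[OF Suc.prems] sum.reindex[OF inj] by (simp add: case_prod_unfold comp_def)
  finally show ?case by (simp add: B_def)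
qed

lemma closed_walks_as_walks_between:
  assumes "N True = p" "N False = n"
  shows "closed_walks N True l = (\<Union>i<p. walks_between p n l i i)"
proof -
  have Nf: "N s = (if s then p else n)" for s using assms by (cases s) auto
  show ?thesis
  proof (intro Set.set_eqI iffI)
    fix w assume w: "w \<in> closed_walks N True l"
    then have ne: "w \<noteq> []" by (auto simp: closed_walks_def)
    obtain i where i: "hd w = (True, i)" using w by (cases "hd w") (auto simp: closed_walks_def)
    have "snd (hd w) < N (fst (hd w))" using w hd_in_set[OF ne] unfolding closed_walks_def by blast
    then have "i < p" using i assms by simp
    moreover have "w \<in> walks_between p n l i i"
      using w i by (simp add: closed_walks_def walks_between_def Nf)
    ultimately show "w \<in> (\<Union>i<p. walks_between p n l i i)" by blast
  next
    fix w assume "w \<in> (\<Union>i<p. walks_between p n l i i)"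
    then show "w \<in> closed_walks N True l"
      by (auto simp: closed_walks_def walks_between_def Nf)
  qed
qed

lemma trace_gram_power:
  fixes y :: "nat \<Rightarrow> nat \<Rightarrow> real" and p n :: nat
  defines "A \<equiv> mat p n (\<lambda>(i, j). y i j)"
  assumes N: "N True = p" "N False = n"
  shows "mat_trace ((c \<cdot>\<^sub>m (A * transpose_mat A)) ^\<^sub>m l) = c ^ l * (\<Sum>w\<in>closed_walks N True l. walk_prod y w)"
proof -
  have "mat_trace ((c \<cdot>\<^sub>m (A * transpose_mat A)) ^\<^sub>m l) = (\<Sum>i<p. c ^ l * (\<Sum>w\<in>walks_between p n l i i. walk_prod y w))"
    unfolding mat_trace_def A_def by (intro sum.cong) (auto simp: gram_power_entry)
  also have "\<dots> = c ^ l * (\<Sum>w\<in>closed_walks N True l. walk_prod y w)"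
    unfolding closed_walks_as_walks_between[OF N] sum_distrib_left[symmetric]
    using finite_walks_between by (subst sum.UNION_disjoint) (auto, auto simp: walks_between_def)
  finally show ?thesis .
qed

section \<open>Expectation of a walk by independence\<close>

lemma prod_list_map_count:
  "prod_list (map f xs) = (\<Prod>x\<in>set xs. (f x :: real) ^ count_list xs x)"
proof (induction xs)
  case (Cons a xs)
  show ?case
  proof (cases "a \<in> set xs")
    case True
    have "(\<Prod>x\<in>set (a # xs). f x ^ count_list (a # xs) x) = (\<Prod>x\<in>set xs. (if x = a then f a else 1) * f x ^ count_list xs x)"
      using True by (intro prod.cong) (auto simp: insert_absorb)
    then show ?thesis using True Cons by (simp add: prod.distrib)
  next
    case False
    then have "count_list xs a = 0" by (simp add: count_list_0_iff)
    moreover have "(\<Prod>x\<in>set xs. f x ^ count_list (a # xs) x) = (\<Prod>x\<in>set xs. f x ^ count_list xs x)"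
      using False by (intro prod.cong) auto
    ultimately show ?thesis using False Cons by simp
  qed
qed simp

lemma alternating_edge:
  assumes "successively (\<lambda>x y. fst x \<noteq> fst y) w" "e \<in> set (edges w)"
  obtains i j where "e = {(True, i), (False, j)}"
proof -
  obtain k where k: "k < length w - 1" "e = edges w ! k" using assms(2) by (auto simp: in_set_conv_nth length_edges)
  then have e: "e = {w ! k, w ! Suc k}" using nth_edges[of k w] by simp
  have "fst (w ! k) \<noteq> fst (w ! Suc k)"
    using successively_nth[OF assms(1), of k] k by simp
  then show ?thesis using that e by (cases "w ! k"; cases "w ! Suc k"; cases "fst (w ! k)") (auto simp: insert_commute)
qed

lemma integrable_power_mono:
  fixes f :: "'a \<Rightarrow> real"
  assumes "finite_measure M" "f \<in> borel_measurable M" "integrable M (\<lambda>x. f x ^ (2 * l))" "k \<le> 2 * l"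
  shows "integrable M (\<lambda>x. f x ^ k)"
proof (rule Bochner_Integration.integrable_bound)
  show "integrable M (\<lambda>x. 1 + f x ^ (2 * l))"
    using assms(1,3) by (intro Bochner_Integration.integrable_add finite_measure.integrable_const)
  show "(\<lambda>x. f x ^ k) \<in> borel_measurable M" using assms(2) by simp
  have "\<bar>f x\<bar> ^ k \<le> 1 + f x ^ (2 * l)" for x
  proof (cases "\<bar>f x\<bar> \<le> 1")
    case True
    then have "\<bar>f x\<bar> ^ k \<le> 1" by (intro power_le_one) auto
    moreover have "0 \<le> f x ^ (2 * l)" by simp
    ultimately show ?thesis by linarith
  next
    case False
    then have "\<bar>f x\<bar> ^ k \<le> \<bar>f x\<bar> ^ (2 * l)" using assms(4) by (intro power_increasing) auto
    then show ?thesis by (simp add: power_even_abs)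
  qed
  then show "AE x in M. norm (f x ^ k) \<le> norm (1 + f x ^ (2 * l))"
    by (intro AE_I2) (simp add: power_abs add_nonneg_nonneg)
qed

text \<open>Grouping the factors by edge gives powers of entries at distinct matrix positions. These
  are independent, and by identical distribution each expectation is a moment of
  \<open>Y 1 1\<close> of order the multiplicity of the edge.\<close>

lemma expectation_walk_prod:
  fixes Y :: "nat \<Rightarrow> nat \<Rightarrow> 'a \<Rightarrow> real"
  assumes "prob_space M"
    and rv: "\<And>i j. Y i j \<in> borel_measurable M"
    and indep: "prob_space.indep_vars M (\<lambda>_. borel) (\<lambda>(i, j). Y i j) UNIV"
    and ident: "\<And>i j. distr M borel (Y i j) = distr M borel (Y 1 1)"
    and moments: "\<And>k. k \<le> 2 * l \<Longrightarrow> integrable M (\<lambda>x. Y 1 1 x ^ k)"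
    and w: "w \<in> closed_walks N \<tau> l"
  shows "integrable M (\<lambda>x. walk_prod (\<lambda>i j. Y (Suc i) (Suc j) x) w)"
    and "integral\<^sup>L M (\<lambda>x. walk_prod (\<lambda>i j. Y (Suc i) (Suc j) x) w) = edge_weight (\<lambda>k. integral\<^sup>L M (\<lambda>x. Y 1 1 x ^ k)) w"
proof -
  interpret prob_space M by fact
  define E where "E = set (edges w)"
  \<comment> \<open>Vertices count from 0, the matrix entries from \<open>Y 1 1\<close>. Every edge
    joins a row to a column, so \<open>pos\<close> is injective on the edges, and \<open>s\<close>
    can carry multiplicities over to index pairs.\<close>
  define pos where "pos = edge_entry (\<lambda>i j. (Suc i, Suc j))"
  define r where "r e = count_list (edges w) e" for e
  define s where "s q = r (inv_into E pos q)" for q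
  have alt: "successively (\<lambda>x y. fst x \<noteq> fst y) w" and len: "length w = 2 * l + 1" using w by (auto simp: closed_walks_def)
  have inj: "inj_on pos E"
  proof (rule inj_onI)
    fix e e' assume "e \<in> E" "e' \<in> E" "pos e = pos e'"
    then show "e = e'" unfolding E_def pos_def
      by (elim alternating_edge[OF alt]) auto
  qed
  have entry: "edge_entry (\<lambda>i j. Y (Suc i) (Suc j) x) e = (case pos e of (i, j) \<Rightarrow> Y i j x)" for e x
    by (simp add: edge_entry_def pos_def)
  have rb: "r e \<le> 2 * l" for e using count_le_length[of "edges w" e] by (simp add: r_def length_edges len)
  have prod: "walk_prod (\<lambda>i j. Y (Suc i) (Suc j) x) w = (\<Prod>q\<in>pos ` E. (case q of (i, j) \<Rightarrow> Y i j x) ^ s q)" for x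
    unfolding walk_prod_def prod_list_map_count entry prod.reindex[OF inj] comp_def E_def[symmetric]
    by (intro prod.cong) (auto simp: s_def r_def inv_into_f_f[OF inj])
  have mom: "integrable M (\<lambda>x. Y i j x ^ k) \<longleftrightarrow> integrable M (\<lambda>x. Y 1 1 x ^ k)"
    "integral\<^sup>L M (\<lambda>x. Y i j x ^ k) = integral\<^sup>L M (\<lambda>x. Y 1 1 x ^ k)" for i j k
  proof -
    have "integrable (distr M borel (Y i j)) (\<lambda>z. z ^ k) \<longleftrightarrow> integrable M (\<lambda>x. Y i j x ^ k)" for i j
      using rv by (intro integrable_distr_eq) auto
    then show "integrable M (\<lambda>x. Y i j x ^ k) \<longleftrightarrow> integrable M (\<lambda>x. Y 1 1 x ^ k)" using ident by metis
    have "integral\<^sup>L (distr M borel (Y i j)) (\<lambda>z. z ^ k) = integral\<^sup>L M (\<lambda>x. Y i j x ^ k)" for i j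
      using rv by (intro integral_distr) auto
    then show "integral\<^sup>L M (\<lambda>x. Y i j x ^ k) = integral\<^sup>L M (\<lambda>x. Y 1 1 x ^ k)" using ident by metis
  qed
  have ind: "indep_vars (\<lambda>_. borel) (\<lambda>q x. (case q of (i, j) \<Rightarrow> Y i j x) ^ s q) (pos ` E)"
  proof -
    have "indep_vars (\<lambda>_. borel) (\<lambda>(i, j). Y i j) (pos ` E)" using indep by (rule indep_vars_subset) simp
    then have "indep_vars (\<lambda>_. borel) (\<lambda>q x. (\<lambda>z. z ^ s q) ((case q of (i, j) \<Rightarrow> Y i j) x)) (pos ` E)"
      by (rule indep_vars_compose2) simp
    then show ?thesis by (simp add: case_prod_unfold)
  qed
  have int: "integrable M (\<lambda>x. (case q of (i, j) \<Rightarrow> Y i j x) ^ s q)" for q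
    using mom(1)[of "fst q" "snd q" "s q"] moments rb by (simp add: case_prod_unfold s_def)
  have fin: "finite (pos ` E)" by (simp add: E_def)
  show "integrable M (\<lambda>x. walk_prod (\<lambda>i j. Y (Suc i) (Suc j) x) w)"
    unfolding prod by (rule indep_vars_integrable[OF fin ind int])
  have "integral\<^sup>L M (\<lambda>x. walk_prod (\<lambda>i j. Y (Suc i) (Suc j) x) w) =
      (\<Prod>q\<in>pos ` E. integral\<^sup>L M (\<lambda>x. (case q of (i, j) \<Rightarrow> Y i j x) ^ s q))"
    unfolding prod by (rule indep_vars_lebesgue_integral[OF fin ind int])
  also have "\<dots> = (\<Prod>q\<in>pos ` E. integral\<^sup>L M (\<lambda>x. Y 1 1 x ^ s q))"
    unfolding case_prod_unfold by (intro prod.cong refl mom(2))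
  also have "\<dots> = edge_weight (\<lambda>k. integral\<^sup>L M (\<lambda>x. Y 1 1 x ^ k)) w"
    unfolding edge_weight_def prod.reindex[OF inj] comp_def E_def[symmetric]
    by (intro prod.cong) (auto simp: s_def r_def inv_into_f_f[OF inj])
  finally show "integral\<^sup>L M (\<lambda>x. walk_prod (\<lambda>i j. Y (Suc i) (Suc j) x) w) = edge_weight (\<lambda>k. integral\<^sup>L M (\<lambda>x. Y 1 1 x ^ k)) w" .
qed

lemma expectation_trace_power:
  fixes Y :: "nat \<Rightarrow> nat \<Rightarrow> 'a \<Rightarrow> real"
  assumes "prob_space M"
    and rv: "\<And>i j. Y i j \<in> borel_measurable M"
    and indep: "prob_space.indep_vars M (\<lambda>_. borel) (\<lambda>(i, j). Y i j) UNIV"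
    and ident: "\<And>i j. distr M borel (Y i j) = distr M borel (Y 1 1)"
    and moment: "integrable M (\<lambda>w. (Y 1 1 w) ^ (2 * l))"
    and N: "N True = p" "N False = n"
  shows "integral\<^sup>L M (\<lambda>x. mat_trace (Smat Y p n x ^\<^sub>m l)) =
    (\<Sum>w\<in>closed_walks N True l. edge_weight (\<lambda>k. integral\<^sup>L M (\<lambda>x. Y 1 1 x ^ k)) w) / real n ^ l"
proof -
  interpret prob_space M by fact
  have moments: "integrable M (\<lambda>x. Y 1 1 x ^ k)" if "k \<le> 2 * l" for k
    using integrable_power_mono[OF _ rv moment that] finite_measure_axioms by blast
  note walk = expectation_walk_prod[where Y = Y, OF \<open>prob_space M\<close> rv indep ident moments]
  have "mat_trace (Smat Y p n x ^\<^sub>m l) = (1 / real n) ^ l * (\<Sum>w\<in>closed_walks N True l. walk_prod (\<lambda>i j. Y (Suc i) (Suc j) x) w)" for x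
    unfolding Smat_def Xmat_def using N by (rule trace_gram_power)
  then have "integral\<^sup>L M (\<lambda>x. mat_trace (Smat Y p n x ^\<^sub>m l)) =
      (1 / real n) ^ l * integral\<^sup>L M (\<lambda>x. \<Sum>w\<in>closed_walks N True l. walk_prod (\<lambda>i j. Y (Suc i) (Suc j) x) w)" by simp
  also have "integral\<^sup>L M (\<lambda>x. \<Sum>w\<in>closed_walks N True l. walk_prod (\<lambda>i j. Y (Suc i) (Suc j) x) w) =
      (\<Sum>w\<in>closed_walks N True l. integral\<^sup>L M (\<lambda>x. walk_prod (\<lambda>i j. Y (Suc i) (Suc j) x) w))"
    by (rule Bochner_Integration.integral_sum) (rule walk(1))
  also have "\<dots> = (\<Sum>w\<in>closed_walks N True l. edge_weight (\<lambda>k. integral\<^sup>L M (\<lambda>x. Y 1 1 x ^ k)) w)"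
    by (intro sum.cong refl) (rule walk(2))
  finally show ?thesis by (simp add: power_one_over)
qed

theorem theorem1:
  fixes M :: "'a measure" and Y :: "nat \<Rightarrow> nat \<Rightarrow> 'a \<Rightarrow> real" and l :: nat
  assumes "prob_space M"
    and rv: "\<And>i j. Y i j \<in> borel_measurable M"
    and indep: "prob_space.indep_vars M (\<lambda>_. borel) (\<lambda>(i, j). Y i j) UNIV"
    and ident: "\<And>i j. distr M borel (Y i j) = distr M borel (Y 1 1)"
    and mean0: "integrable M (Y 1 1)" "integral\<^sup>L M (Y 1 1) = 0"
    and var1: "integral\<^sup>L M (\<lambda>w. (Y 1 1 w)\<^sup>2) = 1"
    and l_pos: "l \<ge> 1"
    and moment: "integrable M (\<lambda>w. (Y 1 1 w) ^ (2 * l))"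
  shows "\<exists>C. \<forall>p n. p \<le> n \<longrightarrow>
    \<bar>integral\<^sup>L M (\<lambda>w. mat_trace (Smat Y p n w ^\<^sub>m l))
      - (\<Sum>b = 1..min l p.
          real (p choose b) * real ((n - b) choose (l + 1 - b)) / real n ^ l
            * fact l * real ((l - 1) choose (b - 1))
          + real (p choose b) * real ((n - b) choose (l - b)) / real n ^ l
            * (fact b * fact (l - b) / 2
                 * (real ((2 * l) choose (2 * b)) + (2 * real b - 1) * real (l choose b) ^ 2)
               + (integral\<^sup>L M (\<lambda>w. (Y 1 1 w) ^ 4) - 3) * (if b < l then 1 else 0)
                 * fact b * fact (l - b) * real (l choose (b - 1)) * real (l choose (b + 1))))\<bar>
    \<le> (\<Sum>b = 1..min l p. C * real p ^ b / real n ^ (b + 1))"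
proof -
  \<comment> \<open>For l = 1 the fourth moment may be infinite; \<open>\<mu> 4\<close> is then the
    default value 0 of the integral, and its coefficient vanishes because only b = l occurs.\<close>
  define \<mu> where "\<mu> k = integral\<^sup>L M (\<lambda>x. Y 1 1 x ^ k)" for k
  have \<mu>: "\<mu> 1 = 0" "\<mu> 2 = 1" using mean0(2) var1 by (auto simp: \<mu>_def)
  obtain C where C: "\<And>p n N. p \<le> n \<Longrightarrow> N True = p \<Longrightarrow> N False = n \<Longrightarrow>
    \<bar>(\<Sum>w\<in>closed_walks N True l. edge_weight \<mu> w) / real n ^ l
      - (\<Sum>b = 1..min l p. real (p choose b) * real ((n - b) choose (l + 1 - b)) / real n ^ l * first_coeff l b
         + real (p choose b) * real ((n - b) choose (l - b)) / real n ^ l * second_coeff (\<mu> 4) l b)\<bar>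
    \<le> (\<Sum>b = 1..min l p. C * real p ^ b / real n ^ (b + 1))"
    using closed_walks_sum_asymptotics[where \<mu> = \<mu>, OF \<mu> l_pos] by blast
  show ?thesis
  proof (intro exI[of _ C] allI impI)
    fix p n :: nat assume pn: "p \<le> n"
    define N where "N s = (if s then p else n)" for s
    have N: "N True = p" "N False = n" by (auto simp: N_def)
    have "integral\<^sup>L M (\<lambda>w. mat_trace (Smat Y p n w ^\<^sub>m l)) = (\<Sum>w\<in>closed_walks N True l. edge_weight \<mu> w) / real n ^ l"
      unfolding \<mu>_def by (rule expectation_trace_power[OF assms(1) rv indep ident moment N])
    then show "\<bar>integral\<^sup>L M (\<lambda>w. mat_trace (Smat Y p n w ^\<^sub>m l))
      - (\<Sum>b = 1..min l p.
          real (p choose b) * real ((n - b) choose (l + 1 - b)) / real n ^ l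
            * fact l * real ((l - 1) choose (b - 1))
          + real (p choose b) * real ((n - b) choose (l - b)) / real n ^ l
            * (fact b * fact (l - b) / 2
                 * (real ((2 * l) choose (2 * b)) + (2 * real b - 1) * real (l choose b) ^ 2)
               + (integral\<^sup>L M (\<lambda>w. (Y 1 1 w) ^ 4) - 3) * (if b < l then 1 else 0)
                 * fact b * fact (l - b) * real (l choose (b - 1)) * real (l choose (b + 1))))\<bar>
      \<le> (\<Sum>b = 1..min l p. C * real p ^ b / real n ^ (b + 1))"
      using C[OF pn N] unfolding first_coeff_def second_coeff_def \<mu>_def by (simp only: mult.assoc)
  qed
qed

end
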